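(* Let $H$ be a finite-dimensional non-semisimple Hopf algebra over an algebraically closed field $\mathbf{k}$, let $R=r(H)$ be its Green ring with basis $\{x_i\}_{i\in\mathfrak{I}}$ of isomorphism classes of indecomposable modules, and let $I_{\mathfrak{X}}$ be a representation ideal of $R$, spanned by $\{x_i\}_{i\in\mathfrak{X}}$. Let $R_{\mathfrak{X}}=R/I_{\mathfrak{X}}$. The following statements are equivalent: (1) The bilinear form $[-,-]_{\mathfrak{X}}$ on $R_{\mathfrak{X}}$ given by $[\overline{x},\overline{y}]_{\mathfrak{X}}=[xy:\mathbf{1}]$ is non-degenerate. (2) $\mathcal{P}_+=\mathcal{P}_-=I_{\mathfrak{X}}=I_{\operatorname{max}}$. (3) $R_{\mathfrak{X}}$ is transitive with respect to the basis $\{\overline{x_i}\}_{i\in\mathfrak{I}\setminus\mathfrak{X}}$.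
   Context: All modules are finite-dimensional left $H$-modules. The Green ring $R=r(H)$ is the abelian group generated by isomorphism classes $[V]$ of modules with relations $[U\oplus V]=[U]+[V]$ and product $[U][V]=[U\otimes V]$; it has $\mathbb{Z}$-basis $\{x_i\}_{i\in\mathfrak{I}}$, the isomorphism classes of indecomposable modules, with $x_0=\mathbf{1}=[\mathbf{k}]$ the class of the trivial module. For $x=\sum a_ix_i$ write $[x:x_i]=a_i$. The duality operator $*$ on $R$ is the additive map induced by $[V]^*=[V^*]$, where $V^*=\operatorname{Hom}_{\mathbf{k}}(V,\mathbf{k})$ with $(hf)(v)=f(S(h)v)$, $S$ the antipode. Define $\mathcal{P}_+:=\mathbb{Z}\{x_i\mid [x_ix_i^*:\mathbf{1}]=0\}$ and $\mathcal{P}_-:=\mathbb{Z}\{x_i\mid [x_i^*x_i:\mathbf{1}]=0\}$. A representation ideal of $R$ is a (two-sided) ideal $I_{\mathfrak{X}}$ that is the $\mathbb{Z}$-span of $\{x_i\}_{i\in\mathfrak{X}}$ for some proper subset $\mathfrak{X}\subsetneq\mathfrak{I}$ and is closed under $*$. $I_{\operatorname{max}}$ denotes the maximal (i.e. largest) representation ideal of $R$. $\overline{x}$ denotes the image of $x\in R$ in $R_{\mathfrak{X}}$. The bilinear form $[-,-]_{\mathfrak{X}}$ is called non-degenerate if both its left and right radicals are zero. A ring with $\mathbb{Z}$-basis $\mathbb{I}$ and non-negative integer structure constants is transitive (with respect to $\mathbb{I}$) if for any $X,Z\in\mathbb{I}$ there exist $Y_1,Y_2\in\mathbb{I}$ such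 that $Z$ appears with nonzero coefficient in both $XY_1$ and $Y_2X$. *)

theory Defs
  imports
    "HOL-Algebra.QuotRing"
    "HOL-Algebra.Generated_Groups"
    "HOL-Library.Poly_Mapping"
    "HOL-Library.FuncSet"
    "HOL-Computational_Algebra.Polynomial"
    "Jordan_Normal_Form.Matrix"
begin

section \<open>Finite-dimensional Hopf algebras\<close>

text \<open>
  An element of \<open>H \<otimes> H\<close> is written as a list \<open>[(a\<^sub>1, b\<^sub>1), \<dots>]\<close> standing for the finite sum
  \<open>a\<^sub>1 \<otimes> b\<^sub>1 + \<dots>\<close>; scalars can be absorbed into the first factor, so every tensor arises in this
  way. Two such lists stand for the same tensor iff every bilinear form takes the same value on
  them: this is the universal property of \<open>H \<otimes> H\<close>, and target \<open>k\<close> suffices because linear forms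
  separate the points of a vector space. In particular \<open>comult H h\<close> is a Sweedler expansion
  of \<open>\<Delta>(h)\<close>, and all conditions on it are required only modulo this equality of tensors.
\<close>

record ('k, 'h) hopf =
  hscale :: "'k \<Rightarrow> 'h \<Rightarrow> 'h"
  comult :: "'h \<Rightarrow> ('h \<times> 'h) list"
  counit :: "'h \<Rightarrow> 'k"
  antipode :: "'h \<Rightarrow> 'h"

definition linear_form :: "('k::field, 'h::ring_1) hopf \<Rightarrow> ('h \<Rightarrow> 'k) \<Rightarrow> bool" where
  "linear_form H f \<longleftrightarrow> Vector_Spaces.linear (hscale H) (*) f"

definition bilinear_form :: "('k::field, 'h::ring_1) hopf \<Rightarrow> ('h \<Rightarrow> 'h \<Rightarrow> 'k) \<Rightarrow> bool" where
  "bilinear_form H \<beta> \<longleftrightarrow>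
     (\<forall>b. linear_form H (\<lambda>a. \<beta> a b)) \<and> (\<forall>a. linear_form H (\<lambda>b. \<beta> a b))"

definition trilinear_form :: "('k::field, 'h::ring_1) hopf \<Rightarrow> ('h \<Rightarrow> 'h \<Rightarrow> 'h \<Rightarrow> 'k) \<Rightarrow> bool" where
  "trilinear_form H \<tau> \<longleftrightarrow>
     (\<forall>b c. linear_form H (\<lambda>a. \<tau> a b c)) \<and> (\<forall>a c. linear_form H (\<lambda>b. \<tau> a b c)) \<and>
     (\<forall>a b. linear_form H (\<lambda>c. \<tau> a b c))"

definition tensor2_eq ::
  "('k::field, 'h::ring_1) hopf \<Rightarrow> ('h \<times> 'h) list \<Rightarrow> ('h \<times> 'h) list \<Rightarrow> bool" where
  "tensor2_eq H s t \<longleftrightarrow>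
     (\<forall>\<beta>. bilinear_form H \<beta> \<longrightarrow> (\<Sum>(a, b)\<leftarrow>s. \<beta> a b) = (\<Sum>(a, b)\<leftarrow>t. \<beta> a b))"

definition tensor3_eq ::
  "('k::field, 'h::ring_1) hopf \<Rightarrow> ('h \<times> 'h \<times> 'h) list \<Rightarrow> ('h \<times> 'h \<times> 'h) list \<Rightarrow> bool" where
  "tensor3_eq H s t \<longleftrightarrow>
     (\<forall>\<tau>. trilinear_form H \<tau> \<longrightarrow> (\<Sum>(a, b, c)\<leftarrow>s. \<tau> a b c) = (\<Sum>(a, b, c)\<leftarrow>t. \<tau> a b c))"

locale fin_dim_hopf_algebra =
  fixes H :: "('k::field, 'h::ring_1) hopf"
  assumes fin_dim: "\<exists>B. finite_dimensional_vector_space (hscale H) B"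
    and scale_mult_left: "hscale H c x * y = hscale H c (x * y)"
    and scale_mult_right: "x * hscale H c y = hscale H c (x * y)"
    and counit_linear: "linear_form H (counit H)"
    and antipode_linear: "Vector_Spaces.linear (hscale H) (hscale H) (antipode H)"
    and comult_add: "tensor2_eq H (comult H (x + y)) (comult H x @ comult H y)"
    and comult_scale:
      "tensor2_eq H (comult H (hscale H c x)) [(hscale H c a, b). (a, b) \<leftarrow> comult H x]"
    and coassoc:
      "tensor3_eq H [(a\<^sub>1, a\<^sub>2, b). (a, b) \<leftarrow> comult H x, (a\<^sub>1, a\<^sub>2) \<leftarrow> comult H a]
                    [(a, b\<^sub>1, b\<^sub>2). (a, b) \<leftarrow> comult H x, (b\<^sub>1, b\<^sub>2) \<leftarrow> comult H b]"
    and counit_left: "(\<Sum>(a, b)\<leftarrow>comult H x. hscale H (counit H a) b) = x"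
    and counit_right: "(\<Sum>(a, b)\<leftarrow>comult H x. hscale H (counit H b) a) = x"
    and comult_mult:
      "tensor2_eq H (comult H (x * y))
                    [(a * c, b * d). (a, b) \<leftarrow> comult H x, (c, d) \<leftarrow> comult H y]"
    and comult_one: "tensor2_eq H (comult H 1) [(1, 1)]"
    and counit_mult: "counit H (x * y) = counit H x * counit H y"
    and counit_one: "counit H 1 = 1"
    and antipode_left: "(\<Sum>(a, b)\<leftarrow>comult H x. antipode H a * b) = hscale H (counit H x) 1"
    and antipode_right: "(\<Sum>(a, b)\<leftarrow>comult H x. a * antipode H b) = hscale H (counit H x) 1"

text \<open>
  For a unital algebra, the left ideals of the underlying ring are automatically \<open>k\<close>-subspaces,
  so they are exactly the submodules of the left regular module.
\<close>

definition left_ideal :: "'h::ring_1 set \<Rightarrow> bool" where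
  "left_ideal L \<longleftrightarrow> 0 \<in> L \<and> (\<forall>x\<in>L. \<forall>y\<in>L. x + y \<in> L) \<and> (\<forall>h. \<forall>x\<in>L. h * x \<in> L)"

definition simple_left_ideal :: "'h::ring_1 set \<Rightarrow> bool" where
  "simple_left_ideal L \<longleftrightarrow>
     left_ideal L \<and> L \<noteq> {0} \<and> (\<forall>M. left_ideal M \<and> M \<subseteq> L \<longrightarrow> M = {0} \<or> M = L)"

text \<open>The left regular module is an internal direct sum of finitely many simple submodules.\<close>

definition semisimple_ring :: "'h::ring_1 itself \<Rightarrow> bool" where
  "semisimple_ring _ \<longleftrightarrow>
     (\<exists>\<S> :: 'h set set. finite \<S> \<and> (\<forall>L\<in>\<S>. simple_left_ideal L) \<and>
        (\<forall>h. \<exists>!f. f \<in> (\<Pi>\<^sub>E L\<in>\<S>. L) \<and> h = (\<Sum>L\<in>\<S>. f L)))"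

section \<open>Finite-dimensional left modules\<close>

text \<open>
  A finite-dimensional left module has, after choice of a basis, underlying space \<open>k\<^sup>n\<close> (column
  vectors) and is given by the matrices with which the elements of \<open>H\<close> act; \<open>n = 0\<close> is allowed.
  Every isomorphism class of finite-dimensional modules contains such modules.
\<close>

type_synonym ('k, 'h) hmod = "'h \<Rightarrow> 'k mat"

definition hdim :: "('k, 'h::ring_1) hmod \<Rightarrow> nat" where
  "hdim V = dim_row (V 1)"

definition is_hmod :: "('k::field, 'h::ring_1) hopf \<Rightarrow> ('k, 'h) hmod \<Rightarrow> bool" where
  "is_hmod H V \<longleftrightarrow>
     (\<forall>h. V h \<in> carrier_mat (hdim V) (hdim V)) \<and>
     (\<forall>g h. V (g + h) = V g + V h) \<and>
     (\<forall>c h. V (hscale H c h) = c \<cdot>\<^sub>m V h) \<and>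
     (\<forall>g h. V (g * h) = V g * V h) \<and>
     V 1 = 1\<^sub>m (hdim V)"

definition hmod_iso :: "('k::field, 'h::ring_1) hmod \<Rightarrow> ('k, 'h) hmod \<Rightarrow> bool" where
  "hmod_iso V W \<longleftrightarrow>
     (\<exists>P\<in>carrier_mat (hdim W) (hdim V). invertible_mat P \<and> (\<forall>h. P * V h = W h * P))"

definition direct_sum_hmod :: "('k::field, 'h::ring_1) hmod \<Rightarrow> ('k, 'h) hmod \<Rightarrow> ('k, 'h) hmod" where
  "direct_sum_hmod V W =
     (\<lambda>h. four_block_mat (V h) (0\<^sub>m (hdim V) (hdim W)) (0\<^sub>m (hdim W) (hdim V)) (W h))"

definition indecomposable_hmod :: "('k::field, 'h::ring_1) hopf \<Rightarrow> ('k, 'h) hmod \<Rightarrow> bool" where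
  "indecomposable_hmod H V \<longleftrightarrow>
     is_hmod H V \<and> hdim V \<noteq> 0 \<and>
     (\<forall>U W. is_hmod H U \<and> is_hmod H W \<and> hmod_iso V (direct_sum_hmod U W) \<longrightarrow>
        hdim U = 0 \<or> hdim W = 0)"

definition trivial_hmod :: "('k::field, 'h::ring_1) hopf \<Rightarrow> ('k, 'h) hmod" where
  "trivial_hmod H = (\<lambda>h. mat 1 1 (\<lambda>_. counit H h))"

text \<open>Matrix of \<open>A \<otimes> B\<close> with respect to the basis \<open>e\<^sub>i \<otimes> f\<^sub>j\<close> in lexicographic order.\<close>

definition kronecker :: "'k::field mat \<Rightarrow> 'k mat \<Rightarrow> 'k mat" where
  "kronecker A B = mat (dim_row A * dim_row B) (dim_col A * dim_col B)
     (\<lambda>(i, j). A $$ (i div dim_row B, j div dim_col B) * B $$ (i mod dim_row B, j mod dim_col B))"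

text \<open>\<open>h (u \<otimes> v) = \<Sum> h\<^sub>1 u \<otimes> h\<^sub>2 v\<close>\<close>

definition tensor_hmod ::
  "('k::field, 'h::ring_1) hopf \<Rightarrow> ('k, 'h) hmod \<Rightarrow> ('k, 'h) hmod \<Rightarrow> ('k, 'h) hmod" where
  "tensor_hmod H V W =
     (\<lambda>h. mat (hdim V * hdim W) (hdim V * hdim W)
        (\<lambda>ij. \<Sum>(a, b)\<leftarrow>comult H h. kronecker (V a) (W b) $$ ij))"

text \<open>\<open>(h f)(v) = f (S(h) v)\<close>, with respect to the dual basis\<close>

definition dual_hmod :: "('k::field, 'h::ring_1) hopf \<Rightarrow> ('k, 'h) hmod \<Rightarrow> ('k, 'h) hmod" where
  "dual_hmod H V = (\<lambda>h. transpose_mat (V (antipode H h)))"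

section \<open>The Green ring\<close>

definition iso_class :: "('k::field, 'h::ring_1) hopf \<Rightarrow> ('k, 'h) hmod \<Rightarrow> ('k, 'h) hmod set" where
  "iso_class H V = {W. is_hmod H W \<and> hmod_iso V W}"

definition tensor_class ::
  "('k::field, 'h::ring_1) hopf \<Rightarrow> ('k, 'h) hmod set \<Rightarrow> ('k, 'h) hmod set \<Rightarrow> ('k, 'h) hmod set" where
  "tensor_class H C D = (\<Union>U\<in>C. \<Union>V\<in>D. iso_class H (tensor_hmod H U V))"

definition dual_class ::
  "('k::field, 'h::ring_1) hopf \<Rightarrow> ('k, 'h) hmod set \<Rightarrow> ('k, 'h) hmod set" where
  "dual_class H C = (\<Union>V\<in>C. iso_class H (dual_hmod H V))"

text \<open>
  The free abelian group on all isomorphism classes, with the tensor product extended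
  bilinearly; the Green ring is its quotient by the relations \<open>[U \<oplus> V] = [U] + [V]\<close>.
\<close>

definition free_class_ring ::
  "('k::field, 'h::ring_1) hopf \<Rightarrow> (('k, 'h) hmod set \<Rightarrow>\<^sub>0 int) ring" where
  "free_class_ring H =
     \<lparr>carrier = {x. Poly_Mapping.keys x \<subseteq> {iso_class H V |V. is_hmod H V}},
      monoid.mult = (\<lambda>x y. frag_extend (\<lambda>C. frag_extend (\<lambda>D. frag_of (tensor_class H C D)) y) x),
      one = frag_of (iso_class H (trivial_hmod H)),
      zero = 0,
      add = (+)\<rparr>"

definition green_relations ::
  "('k::field, 'h::ring_1) hopf \<Rightarrow> (('k, 'h) hmod set \<Rightarrow>\<^sub>0 int) set" where
  "green_relations H = generate (add_monoid (free_class_ring H))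
     {frag_of (iso_class H (direct_sum_hmod U V)) - frag_of (iso_class H U) - frag_of (iso_class H V)
        |U V. is_hmod H U \<and> is_hmod H V}"

type_synonym ('k, 'h) green_elem = "(('k, 'h) hmod set \<Rightarrow>\<^sub>0 int) set"

definition green_ring :: "('k::field, 'h::ring_1) hopf \<Rightarrow> ('k, 'h) green_elem ring" where
  "green_ring H = free_class_ring H Quot green_relations H"

definition green_class ::
  "('k::field, 'h::ring_1) hopf \<Rightarrow> ('k, 'h) hmod \<Rightarrow> ('k, 'h) green_elem" where
  "green_class H V = green_relations H +>\<^bsub>free_class_ring H\<^esub> frag_of (iso_class H V)"

definition green_dual ::
  "('k::field, 'h::ring_1) hopf \<Rightarrow> ('k, 'h) green_elem \<Rightarrow> ('k, 'h) green_elem" where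
  "green_dual H A =
     (\<Union>a\<in>A. green_relations H +>\<^bsub>free_class_ring H\<^esub>
        frag_extend (\<lambda>C. frag_of (dual_class H C)) a)"

text \<open>The basis elements \<open>x\<^sub>i\<close> themselves serve as the index set.\<close>

definition green_basis :: "('k::field, 'h::ring_1) hopf \<Rightarrow> ('k, 'h) green_elem set" where
  "green_basis H = {green_class H V |V. indecomposable_hmod H V}"

section \<open>Integral bases of rings\<close>

definition int_comb :: "('a, 'm) ring_scheme \<Rightarrow> ('a \<Rightarrow>\<^sub>0 int) \<Rightarrow> 'a" where
  "int_comb R n = (\<Oplus>\<^bsub>R\<^esub>b\<in>Poly_Mapping.keys n. [Poly_Mapping.lookup n b] \<cdot>\<^bsub>R\<^esub> b)"

definition int_span :: "('a, 'm) ring_scheme \<Rightarrow> 'a set \<Rightarrow> 'a set" where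
  "int_span R S = {int_comb R n |n. Poly_Mapping.keys n \<subseteq> S}"

text \<open>The coefficient \<open>[x : b]\<close>, meaningful if \<open>B\<close> is an integral basis of \<open>R\<close>.\<close>

definition basis_coeff :: "('a, 'm) ring_scheme \<Rightarrow> 'a set \<Rightarrow> 'a \<Rightarrow> 'a \<Rightarrow> int" where
  "basis_coeff R B x b =
     Poly_Mapping.lookup (THE n. Poly_Mapping.keys n \<subseteq> B \<and> int_comb R n = x) b"

definition transitive_wrt :: "('a, 'm) ring_scheme \<Rightarrow> 'a set \<Rightarrow> bool" where
  "transitive_wrt R B \<longleftrightarrow>
     (\<forall>x\<in>B. \<forall>z\<in>B. \<exists>y1\<in>B. \<exists>y2\<in>B.
        basis_coeff R B (x \<otimes>\<^bsub>R\<^esub> y1) z \<noteq> 0 \<and> basis_coeff R B (y2 \<otimes>\<^bsub>R\<^esub> x) z \<noteq> 0)"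

section \<open>Representation ideals and their quotients\<close>

text \<open>The unit of the Green ring is the class of the trivial module, so this is \<open>[x : \<one>]\<close>.\<close>

definition unit_coeff :: "('k::field, 'h::ring_1) hopf \<Rightarrow> ('k, 'h) green_elem \<Rightarrow> int" where
  "unit_coeff H x = basis_coeff (green_ring H) (green_basis H) x \<one>\<^bsub>green_ring H\<^esub>"

definition P_plus :: "('k::field, 'h::ring_1) hopf \<Rightarrow> ('k, 'h) green_elem set" where
  "P_plus H = int_span (green_ring H)
     {x \<in> green_basis H. unit_coeff H (x \<otimes>\<^bsub>green_ring H\<^esub> green_dual H x) = 0}"

definition P_minus :: "('k::field, 'h::ring_1) hopf \<Rightarrow> ('k, 'h) green_elem set" where
  "P_minus H = int_span (green_ring H)
     {x \<in> green_basis H. unit_coeff H (green_dual H x \<otimes>\<^bsub>green_ring H\<^esub> x) = 0}"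

definition spans_rep_ideal ::
  "('k::field, 'h::ring_1) hopf \<Rightarrow> ('k, 'h) green_elem set \<Rightarrow> bool" where
  "spans_rep_ideal H X \<longleftrightarrow>
     X \<subset> green_basis H \<and> ideal (int_span (green_ring H) X) (green_ring H) \<and>
     green_dual H ` int_span (green_ring H) X \<subseteq> int_span (green_ring H) X"

definition rep_ideal :: "('k::field, 'h::ring_1) hopf \<Rightarrow> ('k, 'h) green_elem set \<Rightarrow> bool" where
  "rep_ideal H I \<longleftrightarrow> (\<exists>X. spans_rep_ideal H X \<and> I = int_span (green_ring H) X)"

definition I_max :: "('k::field, 'h::ring_1) hopf \<Rightarrow> ('k, 'h) green_elem set" where
  "I_max H = (THE I. rep_ideal H I \<and> (\<forall>J. rep_ideal H J \<longrightarrow> J \<subseteq> I))"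

definition quot_ring ::
  "('k::field, 'h::ring_1) hopf \<Rightarrow> ('k, 'h) green_elem set \<Rightarrow> ('k, 'h) green_elem set ring" where
  "quot_ring H X = green_ring H Quot int_span (green_ring H) X"

definition quot_basis ::
  "('k::field, 'h::ring_1) hopf \<Rightarrow> ('k, 'h) green_elem set \<Rightarrow> ('k, 'h) green_elem set set" where
  "quot_basis H X =
     (\<lambda>x. int_span (green_ring H) X +>\<^bsub>green_ring H\<^esub> x) ` (green_basis H - X)"

text \<open>
  The form \<open>[x, y] = [x y : \<one>]\<close> on cosets; the value does not depend on the representatives.
\<close>

definition quot_form ::
  "('k::field, 'h::ring_1) hopf \<Rightarrow> ('k, 'h) green_elem set \<Rightarrow> ('k, 'h) green_elem set \<Rightarrow> int" where
  "quot_form H A C = (THE n. \<exists>x\<in>A. \<exists>y\<in>C. n = unit_coeff H (x \<otimes>\<^bsub>green_ring H\<^esub> y))"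

definition nondegenerate_form :: "('a, 'm) ring_scheme \<Rightarrow> ('a \<Rightarrow> 'a \<Rightarrow> int) \<Rightarrow> bool" where
  "nondegenerate_form R \<phi> \<longleftrightarrow>
     {x \<in> carrier R. \<forall>y\<in>carrier R. \<phi> x y = 0} = {\<zero>\<^bsub>R\<^esub>} \<and>
     {y \<in> carrier R. \<forall>x\<in>carrier R. \<phi> x y = 0} = {\<zero>\<^bsub>R\<^esub>}"

end

theory Submission
  imports
    Defs
    "Jordan_Normal_Form.Determinant"
    "HOL-Algebra.Free_Abelian_Groups"
begin

text \<open>
  For indecomposable \<open>V\<close> and \<open>W\<close>, a splitting of the trivial module off \<open>V \<otimes> W\<close> is a pair of
  homomorphisms \<open>V\<^sup>* \<rightarrow> W\<close> and \<open>V \<rightarrow> W\<^sup>*\<close> whose matrices pair to a nonzero trace. Such a pair can be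
  modified to a splitting off \<open>V \<otimes> V\<^sup>*\<close> and off \<open>W\<^sup>* \<otimes> W\<close>. Composing its members gives an
  endomorphism twisted by \<open>S\<^sup>2\<close>; since the antipode is surjective, Fitting's lemma still applies
  and makes it invertible, so \<open>W \<cong> V\<^sup>*\<close>. Thus \<open>[x y : \<one>] \<noteq> 0\<close> for basis elements forces
  \<open>y = x\<^sup>*\<close>, \<open>[x x\<^sup>* : \<one>] \<noteq> 0\<close> and \<open>[y\<^sup>* y : \<one>] \<noteq> 0\<close>.

  An ideal spanned by a proper subset of the basis does not contain \<open>\<one>\<close>, so it lies in
  \<open>P\<^sub>+\<close> and in \<open>P\<^sub>-\<close>. Pairing with \<open>x\<^sup>*\<close> singles out the coefficient of \<open>x\<close>, so non-degeneracy of
  the form on the quotient says that \<open>[x x\<^sup>* : \<one>]\<close> and \<open>[x\<^sup>* x : \<one>]\<close> are nonzero for all basis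
  elements outside \<open>X\<close>. Transitivity says the same: in one direction look for \<open>\<one>\<close> in \<open>x y\<close>, in
  the other look for \<open>z\<close> in \<open>x (x\<^sup>* z)\<close>, using that the structure constants are nonnegative.
\<close>

section \<open>Matrices\<close>

text \<open>What shapes the proof is the antipode. The canonical bijection from a module to its
  double dual respects the action only up to \<open>S^2\<close>, so multiplicities of the unit in
  \<open>x y\<close> and in \<open>y x\<close> have to be controlled separately, and locality of
  endomorphism rings does not apply to the composites of the two maps of a splitting. The Fitting
  decomposition is therefore carried out for a bare matrix over a field, and only its idempotent is
  shown to respect the action. Surjectivity of the antipode is not among the Hopf algebra axioms; it
  is extracted from finite dimension through a nonzero left integral. Coefficients
  \<open>[x : b]\<close> make sense only once the indecomposable classes are known to form a basis,
  which rests on the Krull-Schmidt theorem, proved here by the exchange argument. The ring axioms of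
  the Green ring are read off from the hypothesis that the span of \<open>X\<close> is an ideal,
  since an ideal carries its ambient ring. After these facts are packaged as a ring with a
  distinguished basis, only bookkeeping with coefficients remains.\<close>

lemma mat_assoc: "dim_col A = dim_row B \<Longrightarrow> dim_col B = dim_row C \<Longrightarrow> (A * B) * C = A * (B * C)"
  for A :: "'a::semiring_0 mat"
  by (rule assoc_mult_mat[of _ "dim_row A" "dim_row B" _ "dim_col B" _ "dim_col C"]) auto

text \<open>Padding both factors with zeros to size \<open>n\<close> does not change the product, so
  for \<open>m < n\<close> a one-sided inverse would become two-sided among square matrices. But row
  \<open>m\<close> of the padded \<open>B\<close> is zero, which contradicts the diagonal entry of
  the identity there.\<close>

lemma mat_two_sided_inverse_dim:
  fixes A :: "'a::field mat"
  assumes A: "A \<in> carrier_mat n m" and B: "B \<in> carrier_mat m n"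
    and AB: "A * B = 1\<^sub>m n"
  shows "n \<le> m"
proof (rule ccontr)
  assume "\<not> n \<le> m"
  then have mn: "m < n" by simp
  define A' where "A' = mat n n (\<lambda>(i, j). if j < m then A $$ (i, j) else 0)"
  define B' where "B' = mat n n (\<lambda>(i, j). if i < m then B $$ (i, j) else 0)"
  have c: "A' \<in> carrier_mat n n" "B' \<in> carrier_mat n n" by (auto simp: A'_def B'_def)
  have "A' * B' = A * B"
  proof (rule eq_matI)
    fix i j assume "i < dim_row (A * B)" "j < dim_col (A * B)"
    then have ij: "i < n" "j < n" using A B by auto
    have "(A' * B') $$ (i, j) = (\<Sum>k = 0..<n. A' $$ (i, k) * B' $$ (k, j))"
      using ij c by (simp add: scalar_prod_def)
    also have "\<dots> = (\<Sum>k = 0..<m. A' $$ (i, k) * B' $$ (k, j))"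
      using mn ij by (intro sum.mono_neutral_right) (auto simp: A'_def)
    also have "\<dots> = (A * B) $$ (i, j)"
      using ij A B mn by (auto simp: scalar_prod_def A'_def B'_def intro!: sum.cong)
    finally show "(A' * B') $$ (i, j) = (A * B) $$ (i, j)" .
  qed (use A B c in auto)
  then have "B' * A' = 1\<^sub>m n"
    using mat_mult_left_right_inverse[OF c] AB by simp
  moreover have "(B' * A') $$ (m, m) = 0"
    using mn c by (auto simp: scalar_prod_def B'_def intro!: sum.neutral)
  ultimately show False using mn by simp
qed

definition mat_trace :: "'a::comm_monoid_add mat \<Rightarrow> 'a" where
  "mat_trace A = (\<Sum>i<dim_row A. A $$ (i, i))"

lemma mat_trace_mult_comm:
  fixes A :: "'a::comm_semiring_0 mat"
  assumes "A \<in> carrier_mat n m" "B \<in> carrier_mat m n"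
  shows "mat_trace (A * B) = mat_trace (B * A)"
proof -
  have "mat_trace (A * B) = (\<Sum>i<n. \<Sum>j<m. A $$ (i, j) * B $$ (j, i))"
    using assms by (auto simp: mat_trace_def scalar_prod_def lessThan_atLeast0)
  also have "\<dots> = (\<Sum>j<m. \<Sum>i<n. B $$ (j, i) * A $$ (i, j))"
    by (subst sum.swap) (simp add: mult.commute)
  also have "\<dots> = mat_trace (B * A)"
    using assms by (auto simp: mat_trace_def scalar_prod_def lessThan_atLeast0)
  finally show ?thesis .
qed

lemma mat_trace_similar:
  fixes A :: "'a::comm_ring_1 mat"
  assumes "similar_mat A B"
  shows "mat_trace A = mat_trace B"
proof -
  from assms obtain P Q where w: "similar_mat_wit A B P Q" by (auto simp: similar_mat_def)
  obtain n where PQ: "Q * P = 1\<^sub>m n" and A: "A = P * B * Q"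
    and c: "B \<in> carrier_mat n n" "P \<in> carrier_mat n n" "Q \<in> carrier_mat n n"
    using similar_mat_witD[OF refl w] by blast
  have "mat_trace A = mat_trace (P * (B * Q))" unfolding A using c by (simp add: mat_assoc)
  also have "\<dots> = mat_trace ((B * Q) * P)" using c by (intro mat_trace_mult_comm) auto
  also have "\<dots> = mat_trace B" using c PQ by (simp add: mat_assoc)
  finally show ?thesis .
qed

section \<open>The Fitting decomposition of a square matrix\<close>

definition strictly_upper :: "'a::zero mat \<Rightarrow> bool" where
  "strictly_upper N \<longleftrightarrow> (\<forall>i<dim_row N. \<forall>j\<le>i. N $$ (i, j) = 0)"

lemma strictly_upper_trace: "strictly_upper N \<Longrightarrow> mat_trace N = 0"
  by (simp add: strictly_upper_def mat_trace_def)

text \<open>Every further factor pushes the possibly nonzero entries up by one superdiagonal. The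
  bound \<open>j < i + k\<close> is the entrywise form that survives the induction; for
  \<open>k = n\<close> it covers every entry.\<close>

lemma strictly_upper_pow_index:
  fixes N :: "'a::comm_semiring_1 mat"
  assumes N: "N \<in> carrier_mat n n" and s: "strictly_upper N"
  shows "i < n \<Longrightarrow> j < n \<Longrightarrow> j < i + k \<Longrightarrow> (N ^\<^sub>m k) $$ (i, j) = 0"
proof (induction k arbitrary: i j)
  case 0
  then show ?case using N by simp
next
  case (Suc k)
  have "(N ^\<^sub>m k) $$ (i, l) * N $$ (l, j) = 0" if "l < n" for l
  proof (cases "l < i + k")
    case True
    then show ?thesis using Suc that by simp
  next
    case False
    then have "j \<le> l" using Suc.prems by simp
    then show ?thesis using s N that by (simp add: strictly_upper_def)
  qed
  then show ?case using N Suc.prems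
    by (auto simp: scalar_prod_def intro!: sum.neutral)
qed

lemma strictly_upper_pow:
  fixes N :: "'a::comm_semiring_1 mat"
  assumes N: "N \<in> carrier_mat n n" and "strictly_upper N"
  shows "N ^\<^sub>m n = 0\<^sub>m n n"
  using strictly_upper_pow_index[OF assms] N by (intro eq_matI) auto

text \<open>The matrix is unitriangular. This supplies invertibility of \<open>1 - M\<close> in the
  nilpotent case of the Fitting alternative.\<close>

lemma strictly_upper_one_minus_det:
  fixes N :: "'a::idom mat"
  assumes N: "N \<in> carrier_mat n n" and s: "strictly_upper N"
  shows "det (1\<^sub>m n - N) = 1"
proof -
  have "upper_triangular (1\<^sub>m n - N)"
    using N s by (auto simp: upper_triangular_def strictly_upper_def)
  then have "det (1\<^sub>m n - N) = prod_list (diag_mat (1\<^sub>m n - N))"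
    using N by (intro det_upper_triangular) auto
  also have "\<dots> = 1" using N s
    by (auto simp: prod_list_diag_prod strictly_upper_def intro!: prod.neutral)
  finally show ?thesis .
qed

text \<open>Any nonzero vector extends to a basis by exchange: with \<open>v $ p \<noteq> 0\<close>,
  the vector \<open>v\<close> takes the place of the standard basis vector number \<open>0\<close>,
  which in turn takes the place of number \<open>p\<close>. For \<open>p = 0\<close> only the first
  column of the identity changes.\<close>

lemma ex_matrix_with_first_column:
  fixes v :: "'a::field vec"
  assumes v: "v \<in> carrier_vec n" "v \<noteq> 0\<^sub>v n"
  shows "\<exists>P\<in>carrier_mat n n. det P \<noteq> 0 \<and> col P 0 = v"
proof -
  from v obtain p where p: "p < n" "v $ p \<noteq> 0"
    by (metis carrier_vecD eq_vecI index_zero_vec)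
  define P where "P = mat n n (\<lambda>(i, j).
    if j = 0 then v $ i else if j = p then (if i = 0 then 1 else 0) else if i = j then 1 else 0)"
  have P: "P \<in> carrier_mat n n" by (simp add: P_def)
  have "det P \<noteq> 0"
  proof
    assume "det P = 0"
    then obtain x where x: "x \<in> carrier_vec n" "x \<noteq> 0\<^sub>v n" "P *\<^sub>v x = 0\<^sub>v n"
      using det_0_iff_vec_prod_zero_field[OF P] by auto
    have row: "(\<Sum>j = 0..<n. P $$ (i, j) * x $ j) = 0" if "i < n" for i
    proof -
      have "(P *\<^sub>v x) $ i = (\<Sum>j = 0..<n. P $$ (i, j) * x $ j)"
        using that P x(1) by (auto simp: scalar_prod_def)
      then show ?thesis using x(3) that by simp
    qed
    have n0: "0 < n" using p by simp
    \<comment> \<open>Row \<open>p\<close> isolates \<open>x $ 0\<close>; each row other than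
      \<open>0\<close> and \<open>p\<close> then isolates its own entry, and row \<open>0\<close>
      the remaining \<open>x $ p\<close>.\<close>
    have x0: "x $ 0 = 0"
    proof -
      have "(\<Sum>j = 0..<n. P $$ (p, j) * x $ j) = (\<Sum>j = 0..<n. if j = 0 then v $ p * x $ 0 else 0)"
        using p by (intro sum.cong) (auto simp: P_def)
      then show ?thesis using row[OF p(1)] p n0 by simp
    qed
    have xi: "x $ i = 0" if i: "i < n" for i
    proof (cases "i = 0 \<or> i = p")
      case False
      have "(\<Sum>j = 0..<n. P $$ (i, j) * x $ j) = (\<Sum>j = 0..<n. if j = i then x $ i else 0)"
        using i False x0 by (intro sum.cong) (auto simp: P_def)
      then show ?thesis using row[OF i] i by simp
    next
      case True
      have "(\<Sum>j = 0..<n. P $$ (0, j) * x $ j) = (\<Sum>j = 0..<n. if j = p then x $ p else 0)"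
        using p n0 x0 by (intro sum.cong) (auto simp: P_def)
      then show ?thesis using row[OF n0] p True x0 by auto
    qed
    show False using x(1,2) xi by (metis carrier_vecD eq_vecI index_zero_vec)
  qed
  moreover have "col P 0 = v" using v p by (intro eq_vecI) (auto simp: P_def)
  ultimately show ?thesis using P by blast
qed

lemma invertible_det_obtain:
  fixes A :: "'a::field mat"
  assumes A: "A \<in> carrier_mat n n" and "det A \<noteq> 0"
  obtains B where "B \<in> carrier_mat n n" "A * B = 1\<^sub>m n" "B * A = 1\<^sub>m n"
  using det_non_zero_imp_unit[OF assms, of "()"]
  unfolding Units_def ring_mat_def by auto

text \<open>A singular matrix has a kernel vector, and in a basis that starts with it the first
  column is zero.\<close>

lemma similar_mat_zero_first_column:
  fixes M :: "'a::field mat"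
  assumes M: "M \<in> carrier_mat (Suc n) (Suc n)" and d: "det M = 0"
  shows "\<exists>R M'. R \<in> carrier_mat 1 n \<and> M' \<in> carrier_mat n n \<and>
    similar_mat M (four_block_mat (0\<^sub>m 1 1) R (0\<^sub>m n 1) M')"
proof -
  obtain v where v: "v \<in> carrier_vec (Suc n)" "v \<noteq> 0\<^sub>v (Suc n)" "M *\<^sub>v v = 0\<^sub>v (Suc n)"
    using det_0_iff_vec_prod_zero_field[OF M] d by auto
  obtain P where P: "P \<in> carrier_mat (Suc n) (Suc n)" "det P \<noteq> 0" "col P 0 = v"
    using ex_matrix_with_first_column[OF v(1,2)] by auto
  obtain Q where Q: "Q \<in> carrier_mat (Suc n) (Suc n)" "P * Q = 1\<^sub>m (Suc n)" "Q * P = 1\<^sub>m (Suc n)"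
    using invertible_det_obtain[OF P(1,2)] .
  define T where "T = Q * (M * P)"
  have T: "T \<in> carrier_mat (Suc n) (Suc n)" using P Q M by (auto simp: T_def)
  have T0: "T $$ (i, 0) = 0" if i: "i < Suc n" for i
  proof -
    have "col (M * P) 0 = M *\<^sub>v v" using P(1,3) M
      by (metis col_mult2 zero_less_Suc)
    then have "col T 0 = Q *\<^sub>v 0\<^sub>v (Suc n)"
      unfolding T_def using v(3) col_mult2[OF Q(1) mult_carrier_mat[OF M P(1)]] by simp
    also have "\<dots> = 0\<^sub>v (Suc n)" using Q(1) by (intro eq_vecI) auto
    finally show ?thesis using T i by (metis carrier_matD index_col index_zero_vec(1) zero_less_Suc)
  qed
  define R where "R = mat 1 n (\<lambda>(i, j). T $$ (0, Suc j))"
  define M' where "M' = mat n n (\<lambda>(i, j). T $$ (Suc i, Suc j))"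
  have "T = four_block_mat (0\<^sub>m 1 1) R (0\<^sub>m n 1) M'"
    using T T0 by (intro eq_matI) (auto simp: R_def M'_def)
  moreover have "similar_mat M T"
  proof (rule similar_matI)
    show "M = P * T * Q"
    proof -
      have "P * T * Q = (P * Q) * (M * (P * Q))"
        unfolding T_def using P(1) Q(1) M by (simp add: mat_assoc)
      then show ?thesis using Q M by simp
    qed
  qed (use P Q M T in auto)
  ultimately show ?thesis by (intro exI[of _ R] exI[of _ M']) (auto simp: R_def M'_def)
qed

text \<open>Induction on the size. An invertible matrix is its own \<open>U\<close>. A singular one
  is brought to zero first column and the remaining block is decomposed by induction; then the new
  zero coordinate has to be carried past \<open>U\<close> into the nilpotent block. Only kernels are
  split off, so \<open>U\<close> stays an arbitrary invertible block.\<close>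

theorem fitting_similar:
  fixes M :: "'a::field mat"
  assumes "M \<in> carrier_mat n n"
  shows "\<exists>r s U N. n = r + s \<and> U \<in> carrier_mat r r \<and> N \<in> carrier_mat s s \<and> det U \<noteq> 0 \<and>
    strictly_upper N \<and> similar_mat M (four_block_mat U (0\<^sub>m r s) (0\<^sub>m s r) N)"
  using assms
proof (induction n arbitrary: M)
  case 0
  show ?case
    by (rule exI[of _ 0], rule exI[of _ 0], rule exI[of _ M], rule exI[of _ "0\<^sub>m 0 0"])
      (use 0 in \<open>auto simp: strictly_upper_def det_dim_zero intro!: similar_matI[of _ _ "1\<^sub>m 0" "1\<^sub>m 0" 0]\<close>)
next
  case (Suc n)
  show ?case
  proof (cases "det M = 0")
    case False
    have "four_block_mat M (0\<^sub>m (Suc n) 0) (0\<^sub>m 0 (Suc n)) (0\<^sub>m 0 0) = M"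
      using Suc.prems by (intro eq_matI) auto
    then show ?thesis
      by (intro exI[of _ "Suc n"] exI[of _ 0] exI[of _ M] exI[of _ "0\<^sub>m 0 0"])
        (use Suc.prems False in \<open>auto simp: strictly_upper_def intro: similar_mat_refl\<close>)
  next
    case True
    obtain R M' where R: "R \<in> carrier_mat 1 n" and M': "M' \<in> carrier_mat n n"
      and sim1: "similar_mat M (four_block_mat (0\<^sub>m 1 1) R (0\<^sub>m n 1) M')"
      using similar_mat_zero_first_column[OF Suc.prems True] by blast
    obtain r s U N where n: "n = r + s" and U: "U \<in> carrier_mat r r" and N: "N \<in> carrier_mat s s"
      and dU: "det U \<noteq> 0" and sN: "strictly_upper N"
      and sim2: "similar_mat M' (four_block_mat U (0\<^sub>m r s) (0\<^sub>m s r) N)" (is "similar_mat _ ?T")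
      using Suc.IH[OF M'] by blast
    obtain B where B: "B \<in> carrier_mat 1 n"
      and sim3: "similar_mat (four_block_mat (0\<^sub>m 1 1) R (0\<^sub>m n 1) M') (four_block_mat (0\<^sub>m 1 1) B (0\<^sub>m n 1) ?T)"
      using similar_mat_four_block_0_ex[OF similar_mat_refl[OF zero_carrier_mat] sim2 R zero_carrier_mat M']
      by blast
    \<comment> \<open>The row \<open>B\<close> is cut along the blocks \<open>U\<close> and
      \<open>N\<close>: \<open>b1\<close> has to be removed, while \<open>b2\<close> may stay
      because it lies above the diagonal of the enlarged nilpotent block.\<close>
    define b1 where "b1 = mat 1 r (\<lambda>(i, j). B $$ (0, j))"
    define b2 where "b2 = mat 1 s (\<lambda>(i, j). B $$ (0, r + j))"
    have b[simp]: "b1 \<in> carrier_mat 1 r" "b2 \<in> carrier_mat 1 s" by (auto simp: b1_def b2_def)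
    obtain U' where U': "U' \<in> carrier_mat r r" "U * U' = 1\<^sub>m r" "U' * U = 1\<^sub>m r"
      using invertible_det_obtain[OF U dU] .
    \<comment> \<open>The solution of \<open>c * U = b1\<close>. Conjugation by \<open>?P\<close>
      below uses it to clear \<open>b1\<close> and at the same time moves the zero coordinate from
      before \<open>U\<close> to behind it.\<close>
    define c where "c = b1 * U'"
    have c: "c \<in> carrier_mat 1 r" unfolding c_def by (rule mult_carrier_mat[OF b(1) U'(1)])
    have cc: "c + - c = 0\<^sub>m 1 r" "- c + c = 0\<^sub>m 1 r" using c by (auto intro!: eq_matI)
    note b' = b b[unfolded One_nat_def]
    note c' = c c[unfolded One_nat_def] cc cc[unfolded One_nat_def]
    have cU: "c * U = b1" using U U' b by (simp add: c_def mat_assoc)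
    let ?P = "four_block_mat c (1\<^sub>m 1) (1\<^sub>m r) (0\<^sub>m r 1)"
    let ?Q = "four_block_mat (0\<^sub>m r 1) (1\<^sub>m r) (1\<^sub>m 1) (- c)"
    let ?X = "four_block_mat (0\<^sub>m 1 1) b1 (0\<^sub>m r 1) U"
    let ?Y = "four_block_mat U (0\<^sub>m r 1) (0\<^sub>m 1 r) (0\<^sub>m 1 1)"
    have PQ: "?P * ?Q = 1\<^sub>m (Suc r)"
      by (subst mult_four_block_mat[of _ 1 r _ 1 _ r _ _ 1 _ r])
        (use c' in \<open>auto intro!: eq_matI\<close>)
    have QP: "?Q * ?P = 1\<^sub>m (Suc r)"
      by (subst mult_four_block_mat[of _ r 1 _ r _ 1 _ _ r _ 1])
        (use c' in auto)
    have "?P * ?Y = four_block_mat b1 (0\<^sub>m 1 1) U (0\<^sub>m r 1)"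
      by (subst mult_four_block_mat[of _ 1 r _ 1 _ r _ _ r _ 1])
        (use c' U cU in auto)
    then have "?P * ?Y * ?Q = four_block_mat b1 (0\<^sub>m 1 1) U (0\<^sub>m r 1) * ?Q" by simp
    also have "\<dots> = ?X"
      by (subst mult_four_block_mat[of _ 1 r _ 1 _ r _ _ 1 _ r])
        (use c' U cU in auto)
    finally have XY: "?X = ?P * ?Y * ?Q" by simp
    have w: "similar_mat_wit ?X ?Y ?P ?Q"
      by (rule similar_mat_witI[of _ _ "Suc r"])
        (use PQ QP XY U c in \<open>auto intro!: carrier_matI\<close>)
    \<comment> \<open>The block coupling the first \<open>Suc r\<close> coordinates to
      \<open>N\<close>. The change of basis \<open>?P\<close> moves the row \<open>b2\<close> from
      the top, in \<open>?URX\<close>, to the bottom, in \<open>?UR\<close>.\<close>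
    let ?UR = "four_block_mat (0\<^sub>m r s) (0\<^sub>m r 0) b2 (0\<^sub>m 1 0)"
    let ?URX = "four_block_mat b2 (0\<^sub>m 1 0) (0\<^sub>m r s) (0\<^sub>m r 0)"
    have UR: "?URX = ?P * ?UR * 1\<^sub>m s"
    proof -
      have "?P * ?UR = ?URX"
        by (subst mult_four_block_mat[of _ 1 r _ 1 _ r _ _ s _ 0]) (use b' c' in auto)
      moreover have "?URX \<in> carrier_mat (1 + r) (s + 0)"
        by (rule four_block_carrier_mat) (use b' in auto)
      ultimately show ?thesis using right_mult_one_mat[of ?URX "1 + r" s] by simp
    qed
    have w4: "similar_mat_wit (four_block_mat ?X ?URX (0\<^sub>m s (Suc r)) N) (four_block_mat ?Y ?UR (0\<^sub>m s (Suc r)) N)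
        (four_block_mat ?P (0\<^sub>m (Suc r) s) (0\<^sub>m s (Suc r)) (1\<^sub>m s))
        (four_block_mat ?Q (0\<^sub>m (Suc r) s) (0\<^sub>m s (Suc r)) (1\<^sub>m s))"
      by (rule similar_mat_wit_four_block[OF w similar_mat_wit_refl[OF N] UR])
        (use U N c in \<open>auto intro!: carrier_matI\<close>)
    \<comment> \<open>Pure regrouping: the sizes \<open>1 + (r + s)\<close> are read as
      \<open>(1 + r) + s\<close>, and in \<open>eq2\<close> the sizes \<open>(r + 1) + s\<close> as
      \<open>r + (1 + s)\<close>.\<close>
    have eq1: "four_block_mat (0\<^sub>m 1 1) B (0\<^sub>m n 1) ?T = four_block_mat ?X ?URX (0\<^sub>m s (Suc r)) N"
      by (rule eq_matI) (use U N n B in \<open>auto simp: b1_def b2_def\<close>)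
    let ?N = "four_block_mat (0\<^sub>m 1 1) b2 (0\<^sub>m s 1) N"
    have eq2: "four_block_mat ?Y ?UR (0\<^sub>m s (Suc r)) N = four_block_mat U (0\<^sub>m r (Suc s)) (0\<^sub>m (Suc s) r) ?N"
      by (rule eq_matI) (use U N in \<open>auto simp: b2_def Suc_diff_le\<close>)
    have "similar_mat (four_block_mat ?X ?URX (0\<^sub>m s (Suc r)) N) (four_block_mat ?Y ?UR (0\<^sub>m s (Suc r)) N)"
      using w4 unfolding similar_mat_def by blast
    then have "similar_mat M (four_block_mat U (0\<^sub>m r (Suc s)) (0\<^sub>m (Suc s) r) ?N)"
      using similar_mat_trans[OF sim1 sim3] unfolding eq1 eq2 by (rule similar_mat_trans[rotated])
    moreover have "strictly_upper ?N"
      using sN N unfolding strictly_upper_def by (auto simp: b2_def)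
    ultimately show ?thesis
      by (intro exI[of _ r] exI[of _ "Suc s"] exI[of _ U] exI[of _ ?N])
        (use n U N dU in \<open>auto intro!: carrier_matI\<close>)
  qed
qed

text \<open>These rules, like \<open>mat_assoc\<close>, replace carrier membership by equations
  between dimensions, which the simplifier can discharge without guessing the sizes.\<close>

lemma mat_add_mult: "dim_row A = dim_row B \<Longrightarrow> dim_col A = dim_col B \<Longrightarrow> dim_col B = dim_row C \<Longrightarrow>
    (A + B) * C = A * C + B * C" for A :: "'a::semiring_0 mat"
  by (rule add_mult_distrib_mat[of _ "dim_row B" "dim_row C" _ _ "dim_col C"]) auto

lemma mat_mult_add: "dim_row B = dim_row C \<Longrightarrow> dim_col B = dim_col C \<Longrightarrow> dim_col A = dim_row B \<Longrightarrow>
    A * (B + C) = A * B + A * C" for A :: "'a::semiring_0 mat"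
  by (rule mult_add_distrib_mat[of _ "dim_row A" "dim_row B" _ "dim_col C"]) auto

lemma mat_minus_mult: "dim_row A = dim_row B \<Longrightarrow> dim_col A = dim_col B \<Longrightarrow> dim_col B = dim_row C \<Longrightarrow>
    (A - B) * C = A * C - B * C" for A :: "'a::ring mat"
  by (rule minus_mult_distrib_mat[of _ "dim_row B" "dim_row C" _ _ "dim_col C"]) auto

lemma mat_mult_minus: "dim_row B = dim_row C \<Longrightarrow> dim_col B = dim_col C \<Longrightarrow> dim_col A = dim_row B \<Longrightarrow>
    A * (B - C) = A * B - A * C" for A :: "'a::ring mat"
  by (rule mult_minus_distrib_mat[of _ "dim_row A" "dim_row B" _ "dim_col C"]) auto

lemma mat_comm_pow:
  fixes M :: "'a::comm_ring_1 mat"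
  assumes M: "M \<in> carrier_mat n n" and V: "\<And>h. V h \<in> carrier_mat n n"
    and c: "\<And>h. V h * M = M * V (\<sigma> h)"
  shows "V h * (M ^\<^sub>m k) = (M ^\<^sub>m k) * V ((\<sigma> ^^ k) h)"
proof (induction k)
  case 0
  then show ?case using M V[of h] by simp
next
  case (Suc k)
  have Mk: "M ^\<^sub>m k \<in> carrier_mat n n" using M by simp
  have "V h * (M ^\<^sub>m Suc k) = (V h * (M ^\<^sub>m k)) * M"
    using M Mk V[of h] by (simp add: mat_assoc)
  also have "\<dots> = (M ^\<^sub>m k) * (V ((\<sigma> ^^ k) h) * M)"
    using Suc M Mk V[of "(\<sigma> ^^ k) h"] by (simp add: mat_assoc)
  also have "\<dots> = (M ^\<^sub>m Suc k) * V ((\<sigma> ^^ Suc k) h)"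
    using M Mk V[of "\<sigma> ((\<sigma> ^^ k) h)"] by (simp add: c mat_assoc)
  finally show ?case .
qed

text \<open>\<open>e\<close> is the projection onto the image of \<open>M^k\<close> along its
  kernel, and \<open>Y\<close> inverts \<open>M^k\<close> on that image. Both factorisations are
  recorded because, for a matrix that commutes with an action only up to a twist, they transfer
  invariance of image and kernel to \<open>e\<close>. The two final implications treat the cases
  \<open>e = 1\<close> and \<open>e = 0\<close> that an indecomposable module leaves.\<close>

lemma fitting_idempotent:
  fixes M :: "'a::field mat"
  assumes M: "M \<in> carrier_mat n n"
  shows "\<exists>k e Y. e \<in> carrier_mat n n \<and> Y \<in> carrier_mat n n \<and> e * e = e \<and>
    e = (M ^\<^sub>m k) * Y \<and> e = Y * (M ^\<^sub>m k) \<and> e * (M ^\<^sub>m k) = M ^\<^sub>m k \<and> (M ^\<^sub>m k) * e = M ^\<^sub>m k \<and>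
    (e = 1\<^sub>m n \<longrightarrow> det M \<noteq> 0) \<and> (e = 0\<^sub>m n n \<longrightarrow> mat_trace M = 0 \<and> det (1\<^sub>m n - M) \<noteq> 0)"
proof -
  obtain r s U N where n: "n = r + s" and U: "U \<in> carrier_mat r r" and N: "N \<in> carrier_mat s s"
    and dU: "det U \<noteq> 0" and sN: "strictly_upper N"
    and sim: "similar_mat M (four_block_mat U (0\<^sub>m r s) (0\<^sub>m s r) N)" (is "similar_mat _ ?T")
    using fitting_similar[OF M] by blast
  obtain P Q where w: "similar_mat_wit M ?T P Q" using sim by (auto simp: similar_mat_def)
  note D = similar_mat_witD2[OF M w]
  have T: "?T \<in> carrier_mat n n" using U N n by simp
  have Us: "U ^\<^sub>m s \<in> carrier_mat r r" using U by simp
  have "det (U ^\<^sub>m k) \<noteq> 0" for k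
    by (induction k) (use dU U in \<open>auto simp: det_mult[of _ r]\<close>)
  then obtain W where W: "W \<in> carrier_mat r r" "U ^\<^sub>m s * W = 1\<^sub>m r" "W * U ^\<^sub>m s = 1\<^sub>m r"
    using invertible_det_obtain[OF Us] by blast
  \<comment> \<open>The exponent is the size of the nilpotent block, which is enough to kill
    it.\<close>
  have Ts: "?T ^\<^sub>m s = four_block_mat (U ^\<^sub>m s) (0\<^sub>m r s) (0\<^sub>m s r) (0\<^sub>m s s)" (is "_ = ?Ts")
    using pow_four_block_mat[OF U N] strictly_upper_pow[OF N sN] by simp
  let ?X = "four_block_mat W (0\<^sub>m r s) (0\<^sub>m s r) (0\<^sub>m s s)"
  let ?e = "four_block_mat (1\<^sub>m r :: 'a mat) (0\<^sub>m r s) (0\<^sub>m s r) (0\<^sub>m s s)"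
  have c: "?X \<in> carrier_mat n n" "?e \<in> carrier_mat n n" "?Ts \<in> carrier_mat n n"
    using W Us n by auto
  have m: "four_block_mat A (0\<^sub>m r s) (0\<^sub>m s r) (0\<^sub>m s s) * four_block_mat B (0\<^sub>m r s) (0\<^sub>m s r) (0\<^sub>m s s) =
      four_block_mat (A * B) (0\<^sub>m r s) (0\<^sub>m s r) (0\<^sub>m s s)"
    if "A \<in> carrier_mat r r" "B \<in> carrier_mat r r" for A B :: "'a mat"
    by (subst mult_four_block_mat[of _ r r _ s _ s _ _ r _ s]) (use that in auto)
  have t: "?Ts * ?X = ?e" "?X * ?Ts = ?e" "?e * ?Ts = ?Ts" "?Ts * ?e = ?Ts" "?e * ?e = ?e"
    using m[OF Us W(1)] m[OF W(1) Us] m[OF one_carrier_mat Us] m[OF Us one_carrier_mat]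
      m[of "1\<^sub>m r" "1\<^sub>m r"] W(2,3) left_mult_one_mat[OF Us] right_mult_one_mat[OF Us] by auto
  have Ms: "M ^\<^sub>m s = P * ?Ts * Q"
    using similar_mat_wit_pow[OF w, of s] Ts
    by (metis similar_mat_witD(3))
  define e where "e = P * ?e * Q"
  define Y where "Y = P * ?X * Q"
  have pq: "(P * A * Q) * (P * B * Q) = P * (A * B) * Q" if "A \<in> carrier_mat n n" "B \<in> carrier_mat n n" for A B
  proof -
    have "(P * A * Q) * (P * B * Q) = P * A * (Q * P) * (B * Q)"
      using that D(6,7) by (simp add: mat_assoc)
    also have "\<dots> = P * (A * B) * Q" using that D by (simp add: mat_assoc)
    finally show ?thesis .
  qed
  have ec: "e \<in> carrier_mat n n" "Y \<in> carrier_mat n n" using D c by (auto simp: e_def Y_def)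
  have qp: "Q * (P * A * Q) * P = A" if "A \<in> carrier_mat n n" for A
  proof -
    have "Q * (P * A * Q) * P = (Q * P) * A * (Q * P)" using that D(6,7) by (simp add: mat_assoc)
    then show ?thesis using that D by simp
  qed
  have "det M \<noteq> 0" if "e = 1\<^sub>m n"
  proof -
    have "?e = Q * 1\<^sub>m n * P" using qp[OF c(2)] that by (simp add: e_def)
    then have e1: "?e = 1\<^sub>m n" using D by simp
    have "s = 0"
    proof (rule ccontr)
      assume "s \<noteq> 0"
      then have "?e $$ (r, r) = 0" "(1\<^sub>m n :: 'a mat) $$ (r, r) = 1" using n by auto
      then show False using e1 by simp
    qed
    then have "?T = U" using U N by (intro eq_matI) auto
    moreover have "det M = det ?T" using det_similar[OF sim] .
    ultimately show ?thesis using dU by simp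
  qed
  moreover have "mat_trace M = 0 \<and> det (1\<^sub>m n - M) \<noteq> 0" if "e = 0\<^sub>m n n"
  proof -
    have "?e = Q * 0\<^sub>m n n * P" using qp[OF c(2)] that by (simp add: e_def)
    then have e0: "?e = 0\<^sub>m n n" using D by simp
    have r0: "r = 0"
    proof (rule ccontr)
      assume "r \<noteq> 0"
      then have "?e $$ (0, 0) = 1" "(0\<^sub>m n n :: 'a mat) $$ (0, 0) = 0" using n by auto
      then show False using e0 by simp
    qed
    then have TN: "?T = N" using U N by (intro eq_matI) auto
    have sim': "similar_mat_wit M N P Q" using w TN by simp
    have "1\<^sub>m n - M = P * (1\<^sub>m n - N) * Q"
    proof -
      have "P * (1\<^sub>m n - N) * Q = P * 1\<^sub>m n * Q - P * N * Q"
        using D N n r0 by (simp add: mat_mult_minus mat_minus_mult)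
      then show ?thesis using D TN by simp
    qed
    then have "similar_mat (1\<^sub>m n - M) (1\<^sub>m n - N)"
      using D N n r0 by (intro similar_matI[of _ _ P Q n]) (auto intro!: minus_carrier_mat)
    from det_similar[OF this] have "det (1\<^sub>m n - M) = 1" using strictly_upper_one_minus_det[OF N sN] n r0 by simp
    then show ?thesis using mat_trace_similar[OF sim] TN strictly_upper_trace[OF sN] by simp
  qed
  ultimately show ?thesis
    using ec by (intro exI[of _ s] exI[of _ e] exI[of _ Y])
      (auto simp: Ms e_def Y_def pq c t)
qed

text \<open>A rank factorisation. The blocks in the Fitting form of an idempotent are again
  idempotent; an invertible idempotent is the identity and a nilpotent one is zero, so
  \<open>e\<close> is similar to a truncated identity.\<close>

lemma split_idempotent:
  fixes e :: "'a::field mat"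
  assumes e: "e \<in> carrier_mat n n" and ee: "e * e = e"
  obtains r C D where "C \<in> carrier_mat n r" "D \<in> carrier_mat r n" "D * C = 1\<^sub>m r" "C * D = e"
proof -
  obtain r s U N where n: "n = r + s" and U: "U \<in> carrier_mat r r" and N: "N \<in> carrier_mat s s"
    and dU: "det U \<noteq> 0" and sN: "strictly_upper N"
    and sim: "similar_mat e (four_block_mat U (0\<^sub>m r s) (0\<^sub>m s r) N)" (is "similar_mat _ ?T")
    using fitting_similar[OF e] by blast
  obtain P Q where w: "similar_mat_wit e ?T P Q" using sim by (auto simp: similar_mat_def)
  note D = similar_mat_witD2[OF e w]
  have T: "?T \<in> carrier_mat n n" using U N n by simp
  have "Q * (P * A * Q) * P = A" if "A \<in> carrier_mat n n" for A
  proof -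
    have "Q * (P * A * Q) * P = (Q * P) * A * (Q * P)" using that D(6,7) by (simp add: mat_assoc)
    then show ?thesis using that D by simp
  qed
  from this[OF T] have qp: "Q * e * P = ?T" by (simp flip: D(3))
  have "?T * ?T = Q * e * P * (Q * e * P)" unfolding qp ..
  also have "\<dots> = Q * e * (P * Q) * (e * P)" using D(6,7) e by (simp add: mat_assoc)
  also have "\<dots> = Q * (e * e) * P" using D(1,6,7) e by (simp add: mat_assoc)
  finally have TT: "?T * ?T = ?T" using ee qp by simp
  have fb: "?T * ?T = four_block_mat (U * U) (0\<^sub>m r s) (0\<^sub>m s r) (N * N)"
    by (subst mult_four_block_mat[of _ r r _ s _ s _ _ r _ s]) (use U N in auto)
  have UU: "U * U = U"
  proof (rule eq_matI)
    fix i j assume "i < dim_row U" "j < dim_col U"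
    then show "(U * U) $$ (i, j) = U $$ (i, j)"
      using arg_cong[OF TT[unfolded fb], of "\<lambda>A. A $$ (i, j)"] U N by simp
  qed (use U in auto)
  have NN: "N * N = N"
  proof (rule eq_matI)
    fix i j assume "i < dim_row N" "j < dim_col N"
    then show "(N * N) $$ (i, j) = N $$ (i, j)"
      using arg_cong[OF TT[unfolded fb], of "\<lambda>A. A $$ (r + i, r + j)"] U N by simp
  qed (use N in auto)
  obtain U' where U': "U' \<in> carrier_mat r r" "U * U' = 1\<^sub>m r" "U' * U = 1\<^sub>m r"
    using invertible_det_obtain[OF U dU] .
  have U1: "U = 1\<^sub>m r"
  proof -
    have "U = U' * (U * U)" using U U' by (simp flip: mat_assoc)
    then show ?thesis using UU U' by simp
  qed
  have "N ^\<^sub>m k = N" if "k > 0" for k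
    using that
  proof (induction k)
    case (Suc k)
    then show ?case using N NN by (cases "k = 0") auto
  qed simp
  moreover have "N ^\<^sub>m s = 0\<^sub>m s s" using strictly_upper_pow[OF N sN] .
  \<comment> \<open>For \<open>s = 0\<close> the power with exponent \<open>s\<close> need not be
    read as \<open>N\<close>, but then all matrices in question are empty.\<close>
  ultimately have N0: "N = 0\<^sub>m s s" using N by (cases "s = 0") auto
  define J where "J = mat n r (\<lambda>(i, j). if i = j then 1 else 0 :: 'a)"
  define K where "K = mat r n (\<lambda>(i, j). if i = j then 1 else 0 :: 'a)"
  have JK: "J \<in> carrier_mat n r" "K \<in> carrier_mat r n" by (auto simp: J_def K_def)
  have KJ: "K * J = 1\<^sub>m r"
  proof (rule eq_matI)
    fix i j assume "i < dim_row (1\<^sub>m r :: 'a mat)" "j < dim_col (1\<^sub>m r :: 'a mat)"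
    then have ij: "i < r" "j < r" by auto
    then have "(K * J) $$ (i, j) = (\<Sum>k = 0..<n. K $$ (i, k) * J $$ (k, j))"
      using JK by (simp add: scalar_prod_def)
    also have "\<dots> = (\<Sum>k = 0..<n. if k = i then (if i = j then 1 else 0) else 0)"
      using ij n by (intro sum.cong) (auto simp: J_def K_def)
    finally have "(K * J) $$ (i, j) = (\<Sum>k = 0..<n. if k = i then (if i = j then 1 else 0) else 0)" .
    then show "(K * J) $$ (i, j) = 1\<^sub>m r $$ (i, j)" using ij n by simp
  qed (use JK in auto)
  have JK1: "J * K = ?T" unfolding U1 N0
  proof (rule eq_matI)
    fix i j assume "i < dim_row (four_block_mat (1\<^sub>m r) (0\<^sub>m r s) (0\<^sub>m s r) (0\<^sub>m s s :: 'a mat))"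
      "j < dim_col (four_block_mat (1\<^sub>m r) (0\<^sub>m r s) (0\<^sub>m s r) (0\<^sub>m s s :: 'a mat))"
    then have ij: "i < n" "j < n" using n by auto
    then have "(J * K) $$ (i, j) = (\<Sum>k = 0..<r. J $$ (i, k) * K $$ (k, j))"
      using JK by (simp add: scalar_prod_def)
    also have "\<dots> = (\<Sum>k = 0..<r. if k = i then (if i = j then 1 else 0) else 0)"
      using ij n by (intro sum.cong) (auto simp: J_def K_def)
    finally have "(J * K) $$ (i, j) = (\<Sum>k = 0..<r. if k = i then (if i = j then 1 else 0) else 0)" .
    then show "(J * K) $$ (i, j) = four_block_mat (1\<^sub>m r) (0\<^sub>m r s) (0\<^sub>m s r) (0\<^sub>m s s) $$ (i, j)"
      using ij n by auto
  qed (use JK n in auto)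
  show ?thesis
  proof (rule that[of "P * J" r "K * Q"])
    have "K * Q * (P * J) = K * (Q * P) * J" using JK D(6,7) by (simp add: mat_assoc)
    then show "K * Q * (P * J) = 1\<^sub>m r" using JK D KJ by simp
    have "P * J * (K * Q) = P * (J * K) * Q" using JK D(6,7) by (simp add: mat_assoc)
    then show "P * J * (K * Q) = e" using JK1 D(3) by simp
  qed (use JK D in auto)
qed

section \<open>Modules\<close>

lemma hmod_carrier: "is_hmod H V \<Longrightarrow> V h \<in> carrier_mat (hdim V) (hdim V)"
  by (simp add: is_hmod_def)

lemma hmod_dim [simp]:
  assumes "is_hmod H V" shows "dim_row (V h) = hdim V" "dim_col (V h) = hdim V"
  using hmod_carrier[OF assms, of h] by auto

section \<open>Homomorphisms and isomorphisms of modules\<close>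

definition hmod_hom :: "('k::field, 'h::ring_1) hmod \<Rightarrow> ('k, 'h) hmod \<Rightarrow> 'k mat \<Rightarrow> bool" where
  "hmod_hom V W A \<longleftrightarrow> A \<in> carrier_mat (hdim W) (hdim V) \<and> (\<forall>h. A * V h = W h * A)"

lemma hmod_hom_carrier: "hmod_hom V W A \<Longrightarrow> A \<in> carrier_mat (hdim W) (hdim V)"
  by (simp add: hmod_hom_def)

lemma hmod_hom_dim:
  assumes "hmod_hom V W A" shows "dim_row A = hdim W" "dim_col A = hdim V"
  using hmod_hom_carrier[OF assms] by auto

lemma hmod_hom_commute: "hmod_hom V W A \<Longrightarrow> A * V h = W h * A"
  by (simp add: hmod_hom_def)

lemma hmod_hom_one: "is_hmod H V \<Longrightarrow> hmod_hom V V (1\<^sub>m (hdim V))"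
  unfolding hmod_hom_def by (metis hmod_carrier left_mult_one_mat one_carrier_mat right_mult_one_mat)

lemma hmod_hom_mult:
  assumes "is_hmod H U" "is_hmod H V" "is_hmod H W" and A: "hmod_hom U V A" and B: "hmod_hom V W B"
  shows "hmod_hom U W (B * A)"
proof -
  note [simp] = hmod_dim[OF assms(1)] hmod_dim[OF assms(2)] hmod_dim[OF assms(3)]
    hmod_hom_dim[OF A] hmod_hom_dim[OF B]
  have "B * A * U h = W h * (B * A)" for h
  proof -
    have "B * A * U h = B * (V h * A)" by (simp add: mat_assoc hmod_hom_commute[OF A])
    also have "\<dots> = (B * V h) * A" by (simp add: mat_assoc)
    also have "\<dots> = W h * (B * A)" by (simp add: mat_assoc hmod_hom_commute[OF B])
    finally show ?thesis .
  qed
  then show ?thesis by (auto simp: hmod_hom_def)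
qed

lemma hmod_hom_add:
  assumes "is_hmod H V" "is_hmod H W" "hmod_hom V W A" "hmod_hom V W B"
  shows "hmod_hom V W (A + B)"
  using assms hmod_hom_dim[OF assms(3)] hmod_hom_dim[OF assms(4)]
  unfolding hmod_hom_def by (auto simp: mat_add_mult mat_mult_add)

lemma hmod_hom_minus:
  assumes "is_hmod H V" "is_hmod H W" "hmod_hom V W A" "hmod_hom V W B"
  shows "hmod_hom V W (A - B)"
  using assms hmod_hom_dim[OF assms(3)] hmod_hom_dim[OF assms(4)]
  unfolding hmod_hom_def by (auto simp: mat_minus_mult mat_mult_minus intro!: carrier_matI)

lemma hmod_hom_inverse:
  assumes "is_hmod H V" "is_hmod H W" and A: "hmod_hom V W A" and B: "B \<in> carrier_mat (hdim V) (hdim W)"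
    and AB: "A * B = 1\<^sub>m (hdim W)" and BA: "B * A = 1\<^sub>m (hdim V)"
  shows "hmod_hom W V B"
proof -
  note [simp] = hmod_dim[OF assms(1)] hmod_dim[OF assms(2)] hmod_hom_dim[OF A] carrier_matD[OF B]
  have "B * W h = V h * B" for h
  proof -
    have "B * W h = B * W h * (A * B)" using AB by simp
    also have "\<dots> = B * (W h * A) * B" by (simp add: mat_assoc)
    also have "\<dots> = B * (A * V h) * B" by (simp add: hmod_hom_commute[OF A])
    also have "\<dots> = (B * A) * V h * B" by (simp add: mat_assoc)
    also have "\<dots> = V h * B" using BA hmod_carrier[OF assms(1)] by simp
    finally show ?thesis .
  qed
  then show ?thesis using B by (simp add: hmod_hom_def)
qed

text \<open>\<open>hmod_iso\<close> asks for an invertible matrix, which has to be square; the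
  equality of dimensions is won from the two one-sided identities.\<close>

lemma hmod_isoI:
  assumes "hmod_hom V W A" "B \<in> carrier_mat (hdim V) (hdim W)"
    "A * B = 1\<^sub>m (hdim W)" "B * A = 1\<^sub>m (hdim V)"
  shows "hmod_iso V W"
proof -
  have A: "A \<in> carrier_mat (hdim W) (hdim V)" using hmod_hom_carrier[OF assms(1)] .
  have "hdim W = hdim V"
    using mat_two_sided_inverse_dim[OF A assms(2,3)] mat_two_sided_inverse_dim[OF assms(2) A assms(4)] by simp
  then have "invertible_mat A" using A assms unfolding invertible_mat_def inverts_mat_def square_mat.simps
    by (auto intro!: exI[of _ B])
  then show ?thesis using assms(1) A unfolding hmod_iso_def hmod_hom_def by blast
qed

lemma hmod_isoE:
  assumes "is_hmod H V" "is_hmod H W" "hmod_iso V W"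
  obtains A B where "hmod_hom V W A" "hmod_hom W V B" "A * B = 1\<^sub>m (hdim W)" "B * A = 1\<^sub>m (hdim V)"
proof -
  obtain A where A: "A \<in> carrier_mat (hdim W) (hdim V)" "invertible_mat A" "\<forall>h. A * V h = W h * A"
    using assms(3) by (auto simp: hmod_iso_def)
  then have h: "hmod_hom V W A" by (simp add: hmod_hom_def)
  obtain B where B: "A * B = 1\<^sub>m (dim_row A)" "B * A = 1\<^sub>m (dim_row B)"
    using A(2) by (auto simp: invertible_mat_def inverts_mat_def)
  have dB: "dim_row B = hdim V" "dim_col B = hdim W"
    using A(1) arg_cong[OF B(1), of dim_col] arg_cong[OF B(2), of dim_col] by auto
  then have "B \<in> carrier_mat (hdim V) (hdim W)" by auto
  from hmod_hom_inverse[OF assms(1,2) h this] that[OF h, of B] B dB A(1) show ?thesis by auto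
qed

lemma hmod_iso_hdim: "hmod_iso V W \<Longrightarrow> hdim V = hdim W"
  unfolding hmod_iso_def invertible_mat_def square_mat.simps by auto

lemma hmod_iso_refl: "is_hmod H V \<Longrightarrow> hmod_iso V V"
  using hmod_isoI[OF hmod_hom_one[of H V], of "1\<^sub>m (hdim V)"] by simp

lemma hmod_iso_sym:
  assumes "is_hmod H V" "is_hmod H W" "hmod_iso V W" shows "hmod_iso W V"
  using hmod_isoE[OF assms] hmod_isoI hmod_hom_carrier by metis

lemma hmod_iso_trans:
  assumes m: "is_hmod H U" "is_hmod H V" "is_hmod H W" and "hmod_iso U V" "hmod_iso V W"
  shows "hmod_iso U W"
proof -
  obtain A B where AB: "hmod_hom U V A" "hmod_hom V U B" "A * B = 1\<^sub>m (hdim V)" "B * A = 1\<^sub>m (hdim U)"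
    using hmod_isoE[OF m(1,2) assms(4)] .
  obtain C D where CD: "hmod_hom V W C" "hmod_hom W V D" "C * D = 1\<^sub>m (hdim W)" "D * C = 1\<^sub>m (hdim V)"
    using hmod_isoE[OF m(2,3) assms(5)] .
  note [simp] = hmod_hom_dim[OF AB(1)] hmod_hom_dim[OF AB(2)] hmod_hom_dim[OF CD(1)] hmod_hom_dim[OF CD(2)]
  note [simp] = hmod_hom_carrier[OF AB(1)] hmod_hom_carrier[OF AB(2)] hmod_hom_carrier[OF CD(1)] hmod_hom_carrier[OF CD(2)]
  show ?thesis
  proof (rule hmod_isoI[OF hmod_hom_mult[OF m AB(1) CD(1)]])
    have "C * A * (B * D) = C * (A * B) * D" by (simp add: mat_assoc)
    then show "C * A * (B * D) = 1\<^sub>m (hdim W)" using AB CD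
      by (metis hmod_hom_carrier right_mult_one_mat)
    have "B * D * (C * A) = B * (D * C) * A" by (simp add: mat_assoc)
    then show "B * D * (C * A) = 1\<^sub>m (hdim U)" using AB CD
      by (metis hmod_hom_carrier right_mult_one_mat)
  qed auto
qed

text \<open>The identities \<open>p j = 0\<close> and \<open>q i = 0\<close> follow from the ones below.\<close>

definition biproduct ::
  "('k::field, 'h::ring_1) hmod \<Rightarrow> ('k, 'h) hmod \<Rightarrow> ('k, 'h) hmod \<Rightarrow>
    'k mat \<Rightarrow> 'k mat \<Rightarrow> 'k mat \<Rightarrow> 'k mat \<Rightarrow> bool" where
  "biproduct X Y Z i j p q \<longleftrightarrow>
     hmod_hom Y X i \<and> hmod_hom Z X j \<and> hmod_hom X Y p \<and> hmod_hom X Z q \<and>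
     p * i = 1\<^sub>m (hdim Y) \<and> q * j = 1\<^sub>m (hdim Z) \<and> i * p + j * q = 1\<^sub>m (hdim X)"

lemma biproduct_swap: "biproduct X Y Z i j p q \<Longrightarrow> biproduct X Z Y j i q p"
  unfolding biproduct_def using comm_add_mat[of "i * p" "hdim X" "hdim X" "j * q"]
  by (auto dest!: hmod_hom_carrier)

lemma mat_add_self_zero:
  fixes A :: "'a::field mat"
  assumes "A \<in> carrier_mat n m" "A + A = A" shows "A = 0\<^sub>m n m"
proof (rule eq_matI)
  fix i j assume "i < dim_row (0\<^sub>m n m :: 'a mat)" "j < dim_col (0\<^sub>m n m :: 'a mat)"
  then have ij: "i < n" "j < m" by auto
  then have "A $$ (i, j) + A $$ (i, j) = (A + A) $$ (i, j)" using assms(1) by (metis carrier_matD index_add_mat(1))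
  then have "A $$ (i, j) = 0" unfolding assms(2) by (metis add_cancel_right_right)
  then show "A $$ (i, j) = 0\<^sub>m n m $$ (i, j)" using ij by simp
qed (use assms in auto)

text \<open>Inserting \<open>1 = i p + j q\<close> between \<open>p\<close> and \<open>j\<close>
  gives \<open>p j = p j + p j\<close>.\<close>

lemma biproduct_zero1:
  assumes "biproduct X Y Z i j p q" shows "p * j = 0\<^sub>m (hdim Y) (hdim Z)"
proof -
  have h: "hmod_hom Y X i" "hmod_hom Z X j" "hmod_hom X Y p" "hmod_hom X Z q"
    and e: "p * i = 1\<^sub>m (hdim Y)" "q * j = 1\<^sub>m (hdim Z)" "i * p + j * q = 1\<^sub>m (hdim X)"
    using assms by (auto simp: biproduct_def)
  note [simp] = hmod_hom_dim[OF h(1)] hmod_hom_dim[OF h(2)] hmod_hom_dim[OF h(3)] hmod_hom_dim[OF h(4)]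
  have c: "p * j \<in> carrier_mat (hdim Y) (hdim Z)" by auto
  have "p * j = p * (i * p + j * q) * j" using e hmod_hom_carrier[OF h(3)] by simp
  also have "\<dots> = (p * i) * (p * j) + (p * j) * (q * j)" by (simp add: mat_assoc mat_mult_add mat_add_mult)
  also have "\<dots> = p * j + p * j" using e c by simp
  finally show ?thesis using mat_add_self_zero[OF c] by simp
qed

lemma biproduct_zero2:
  assumes "biproduct X Y Z i j p q" shows "q * i = 0\<^sub>m (hdim Z) (hdim Y)"
  using biproduct_zero1[OF biproduct_swap[OF assms]] .

lemma direct_sum_hdim: "is_hmod H V \<Longrightarrow> is_hmod H W \<Longrightarrow> hdim (direct_sum_hmod V W) = hdim V + hdim W"
  unfolding direct_sum_hmod_def hdim_def by simp

lemma direct_sum_hmod: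
  assumes V: "is_hmod H V" and W: "is_hmod H W"
  shows "is_hmod H (direct_sum_hmod V W)"
proof -
  have c: "V h \<in> carrier_mat (hdim V) (hdim V)" "W h \<in> carrier_mat (hdim W) (hdim W)" for h
    using V W by (auto simp: hmod_carrier)
  note d = direct_sum_hdim[OF V W]
  have "direct_sum_hmod V W h \<in> carrier_mat (hdim V + hdim W) (hdim V + hdim W)" for h
    using c by (auto simp: direct_sum_hmod_def)
  moreover have "direct_sum_hmod V W (g + h) = direct_sum_hmod V W g + direct_sum_hmod V W h" for g h
    using V W c unfolding direct_sum_hmod_def is_hmod_def
    by (subst add_four_block_mat[of _ "hdim V" "hdim V" _ "hdim W" _ "hdim W"]) auto
  moreover have "direct_sum_hmod V W (hscale H a h) = a \<cdot>\<^sub>m direct_sum_hmod V W h" for a h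
    using V W c[of h] unfolding direct_sum_hmod_def is_hmod_def
    by (subst smult_four_block_mat[of _ "hdim V" "hdim V" _ "hdim W" _ "hdim W"]) auto
  moreover have "direct_sum_hmod V W (g * h) = direct_sum_hmod V W g * direct_sum_hmod V W h" for g h
    using V W c[of g] c[of h] mult_carrier_mat[OF c(1)[of g] c(1)[of h]]
      mult_carrier_mat[OF c(2)[of g] c(2)[of h]] left_mult_zero_mat[OF c(1)[of h], of "hdim W"]
      left_mult_zero_mat[OF c(2)[of h], of "hdim V"] right_mult_zero_mat[OF c(1)[of g], of "hdim W"]
      right_mult_zero_mat[OF c(2)[of g], of "hdim V"]
    unfolding direct_sum_hmod_def is_hmod_def
    by (subst mult_four_block_mat[of _ "hdim V" "hdim V" _ "hdim W" _ "hdim W" _ _ "hdim V" _ "hdim W"]) auto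
  moreover have "direct_sum_hmod V W 1 = 1\<^sub>m (hdim V + hdim W)"
    using V W unfolding direct_sum_hmod_def is_hmod_def by auto
  ultimately show ?thesis unfolding is_hmod_def d by blast
qed

lemma direct_sum_assoc:
  assumes "is_hmod H U" "is_hmod H V" "is_hmod H W"
  shows "direct_sum_hmod U (direct_sum_hmod V W) = direct_sum_hmod (direct_sum_hmod U V) W"
proof
  fix h
  note [simp] = hmod_dim[OF assms(1)] hmod_dim[OF assms(2)] hmod_dim[OF assms(3)]
    hmod_dim[OF direct_sum_hmod[OF assms(1,2)]] hmod_dim[OF direct_sum_hmod[OF assms(2,3)]]
  show "direct_sum_hmod U (direct_sum_hmod V W) h = direct_sum_hmod (direct_sum_hmod U V) W h"
    using assoc_four_block_mat[of "U h" "V h" "W h"]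
    unfolding direct_sum_hmod_def[of U "direct_sum_hmod V W"] direct_sum_hmod_def[of "direct_sum_hmod U V" W]
    unfolding direct_sum_hdim[OF assms(1,2)] direct_sum_hdim[OF assms(2,3)]
    by (simp add: direct_sum_hmod_def)
qed

lemma direct_sum_biproduct:
  assumes V: "is_hmod H V" and W: "is_hmod H W"
  shows "\<exists>i j p q. biproduct (direct_sum_hmod V W) V W i j p q"
proof -
  let ?n = "hdim V" let ?m = "hdim W"
  let ?X = "direct_sum_hmod V W"
  define i where "i = mat (?n + ?m) ?n (\<lambda>(a, b). if a = b then 1 else 0 :: 'a)"
  define p where "p = mat ?n (?n + ?m) (\<lambda>(a, b). if a = b then 1 else 0 :: 'a)"
  define j where "j = mat (?n + ?m) ?m (\<lambda>(a, b). if a = ?n + b then 1 else 0 :: 'a)"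
  define q where "q = mat ?m (?n + ?m) (\<lambda>(a, b). if b = ?n + a then 1 else 0 :: 'a)"
  have c[simp]: "i \<in> carrier_mat (?n + ?m) ?n" "p \<in> carrier_mat ?n (?n + ?m)"
    "j \<in> carrier_mat (?n + ?m) ?m" "q \<in> carrier_mat ?m (?n + ?m)"
    by (auto simp: i_def p_def j_def q_def)
  note [simp] = carrier_matD[OF c(1)] carrier_matD[OF c(2)] carrier_matD[OF c(3)] carrier_matD[OF c(4)]
    hmod_dim[OF V] hmod_dim[OF W] direct_sum_hdim[OF V W]
  have dX[simp]: "dim_row (?X h) = ?n + ?m" "dim_col (?X h) = ?n + ?m" for h
    by (auto simp: direct_sum_hmod_def)
  have ent: "?X h $$ (a, b) = (if a < ?n then if b < ?n then V h $$ (a, b) else 0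
      else if b < ?n then 0 else W h $$ (a - ?n, b - ?n))" if "a < ?n + ?m" "b < ?n + ?m" for a b h
    using that by (auto simp: direct_sum_hmod_def)
  have sp: "(A * B) $$ (a, b) = (\<Sum>k = 0..<dim_row B. A $$ (a, k) * B $$ (k, b))"
    if "a < dim_row A" "b < dim_col B" "dim_col A = dim_row B" for A B :: "'a mat" and a b
    using that by (simp add: scalar_prod_def)
  \<comment> \<open>Multiplying by a coordinate matrix selects rows or columns, or extends by zero.
    The eight rules of this kind turn every identity of the biproduct into a comparison of
    entries.\<close>
  have Ai: "(A * i) $$ (a, b) = A $$ (a, b)" if "a < dim_row A" "b < ?n" "dim_col A = ?n + ?m" for A a b
  proof -
    have "(\<Sum>k = 0..<?n + ?m. A $$ (a, k) * i $$ (k, b)) = (\<Sum>k = 0..<?n + ?m. if k = b then A $$ (a, b) else 0)"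
      using that by (intro sum.cong) (auto simp: i_def)
    then show ?thesis using that by (simp add: sp del: index_mult_mat(1))
  qed
  have Aj: "(A * j) $$ (a, b) = A $$ (a, ?n + b)" if "a < dim_row A" "b < ?m" "dim_col A = ?n + ?m" for A a b
  proof -
    have "(\<Sum>k = 0..<?n + ?m. A $$ (a, k) * j $$ (k, b)) = (\<Sum>k = 0..<?n + ?m. if k = ?n + b then A $$ (a, ?n + b) else 0)"
      using that by (intro sum.cong) (auto simp: j_def)
    then show ?thesis using that by (simp add: sp del: index_mult_mat(1))
  qed
  have pA: "(p * A) $$ (a, b) = A $$ (a, b)" if "a < ?n" "b < dim_col A" "dim_row A = ?n + ?m" for A a b
  proof -
    have "(\<Sum>k = 0..<?n + ?m. p $$ (a, k) * A $$ (k, b)) = (\<Sum>k = 0..<?n + ?m. if k = a then A $$ (a, b) else 0)"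
      using that by (intro sum.cong) (auto simp: p_def)
    then show ?thesis using that by (simp add: sp del: index_mult_mat(1))
  qed
  have qA: "(q * A) $$ (a, b) = A $$ (?n + a, b)" if "a < ?m" "b < dim_col A" "dim_row A = ?n + ?m" for A a b
  proof -
    have "(\<Sum>k = 0..<?n + ?m. q $$ (a, k) * A $$ (k, b)) = (\<Sum>k = 0..<?n + ?m. if k = ?n + a then A $$ (?n + a, b) else 0)"
      using that by (intro sum.cong) (auto simp: q_def)
    then show ?thesis using that by (simp add: sp del: index_mult_mat(1))
  qed
  have iA: "(i * A) $$ (a, b) = (if a < ?n then A $$ (a, b) else 0)"
    if "a < ?n + ?m" "b < dim_col A" "dim_row A = ?n" for A a b
  proof -
    have "(\<Sum>k = 0..<?n. i $$ (a, k) * A $$ (k, b)) = (\<Sum>k = 0..<?n. if k = a then A $$ (a, b) else 0)"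
      using that by (intro sum.cong) (auto simp: i_def)
    then show ?thesis using that by (simp add: sp del: index_mult_mat(1))
  qed
  have jA: "(j * A) $$ (a, b) = (if a < ?n then 0 else A $$ (a - ?n, b))"
    if "a < ?n + ?m" "b < dim_col A" "dim_row A = ?m" for A a b
  proof -
    have "(\<Sum>k = 0..<?m. j $$ (a, k) * A $$ (k, b)) =
        (\<Sum>k = 0..<?m. if k = a - ?n then (if a < ?n then 0 else A $$ (a - ?n, b)) else 0)"
      using that by (intro sum.cong) (auto simp: j_def)
    then show ?thesis using that by (cases "a < ?n") (auto simp add: sp simp del: index_mult_mat(1))
  qed
  have Ap: "(A * p) $$ (a, b) = (if b < ?n then A $$ (a, b) else 0)"
    if "a < dim_row A" "b < ?n + ?m" "dim_col A = ?n" for A a b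
  proof -
    have "(\<Sum>k = 0..<?n. A $$ (a, k) * p $$ (k, b)) = (\<Sum>k = 0..<?n. if k = b then A $$ (a, b) else 0)"
      using that by (intro sum.cong) (auto simp: p_def)
    then show ?thesis using that by (simp add: sp del: index_mult_mat(1))
  qed
  have Aq: "(A * q) $$ (a, b) = (if b < ?n then 0 else A $$ (a, b - ?n))"
    if "a < dim_row A" "b < ?n + ?m" "dim_col A = ?m" for A a b
  proof -
    have "(\<Sum>k = 0..<?m. A $$ (a, k) * q $$ (k, b)) =
        (\<Sum>k = 0..<?m. if k = b - ?n then (if b < ?n then 0 else A $$ (a, b - ?n)) else 0)"
      using that by (intro sum.cong) (auto simp: q_def)
    then show ?thesis using that by (cases "b < ?n") (auto simp add: sp simp del: index_mult_mat(1))
  qed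
  note entries = Ai Aj pA qA iA jA Ap Aq ent
  have "hmod_hom V ?X i" unfolding hmod_hom_def
    by (auto simp del: index_mult_mat(1) simp: entries intro!: eq_matI)
  moreover have "hmod_hom W ?X j" unfolding hmod_hom_def
    by (auto simp del: index_mult_mat(1) simp: entries intro!: eq_matI)
  moreover have "hmod_hom ?X V p" unfolding hmod_hom_def
    by (auto simp del: index_mult_mat(1) simp: entries intro!: eq_matI)
  moreover have "hmod_hom ?X W q" unfolding hmod_hom_def
    by (auto simp del: index_mult_mat(1) simp: entries intro!: eq_matI)
  moreover have "p * i = 1\<^sub>m ?n"
    by (auto simp del: index_mult_mat(1) simp: entries intro!: eq_matI) (auto simp: p_def)
  moreover have "q * j = 1\<^sub>m ?m"
    by (auto simp del: index_mult_mat(1) simp: entries intro!: eq_matI) (auto simp: q_def)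
  moreover have "i * p + j * q = 1\<^sub>m (?n + ?m)"
    by (auto simp del: index_mult_mat(1) simp: entries intro!: eq_matI) (auto simp: i_def j_def)
  ultimately show ?thesis unfolding biproduct_def by auto
qed

text \<open>Uniqueness of biproducts: \<open>i' p + j' q\<close> and \<open>i p' + j q'\<close> are
  mutually inverse, because the mixed products vanish and the rest is the decomposition of the
  identity.\<close>

lemma biproduct_iso:
  assumes m: "is_hmod H X" "is_hmod H X'" "is_hmod H Y" "is_hmod H Z"
    and b: "biproduct X Y Z i j p q" and b': "biproduct X' Y Z i' j' p' q'"
  shows "hmod_iso X X'"
proof -
  have h: "hmod_hom Y X i" "hmod_hom Z X j" "hmod_hom X Y p" "hmod_hom X Z q"
    "hmod_hom Y X' i'" "hmod_hom Z X' j'" "hmod_hom X' Y p'" "hmod_hom X' Z q'"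
    and e: "p * i = 1\<^sub>m (hdim Y)" "q * j = 1\<^sub>m (hdim Z)" "i * p + j * q = 1\<^sub>m (hdim X)"
    "p' * i' = 1\<^sub>m (hdim Y)" "q' * j' = 1\<^sub>m (hdim Z)" "i' * p' + j' * q' = 1\<^sub>m (hdim X')"
    using b b' by (auto simp: biproduct_def)
  note c[simp] = h[THEN hmod_hom_carrier]
  note [simp] = c[THEN carrier_matD(1)] c[THEN carrier_matD(2)]
  \<comment> \<open>Stated for arbitrary matrices, since it serves both composites with the roles of
    \<open>X\<close> and \<open>X'\<close> exchanged.\<close>
  have main: "(i1 * p2 + j1 * q2) * (i2 * p1 + j2 * q1) = i1 * p1 + j1 * q1"
    if "p2 * i2 = 1\<^sub>m y" "q2 * j2 = 1\<^sub>m z" "p2 * j2 = 0\<^sub>m y z" "q2 * i2 = 0\<^sub>m z y"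
      and c: "i1 \<in> carrier_mat n y" "j1 \<in> carrier_mat n z" "p1 \<in> carrier_mat y n" "q1 \<in> carrier_mat z n"
      "i2 \<in> carrier_mat m y" "j2 \<in> carrier_mat m z" "p2 \<in> carrier_mat y m" "q2 \<in> carrier_mat z m"
    for i1 j1 p1 q1 i2 j2 p2 q2 :: "'a mat" and n m y z
  proof -
    note [simp] = c[THEN carrier_matD(1)] c[THEN carrier_matD(2)]
    have "(i1 * p2 + j1 * q2) * (i2 * p1 + j2 * q1) =
        (i1 * (p2 * i2) * p1 + j1 * (q2 * i2) * p1) + (i1 * (p2 * j2) * q1 + j1 * (q2 * j2) * q1)"
      by (simp add: mat_assoc mat_add_mult mat_mult_add)
    also have "\<dots> = i1 * p1 + j1 * q1"
      using c unfolding that by (simp add: left_add_zero_mat[of _ n n] right_add_zero_mat[of _ n n])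
    finally show ?thesis .
  qed
  show ?thesis
  proof (rule hmod_isoI)
    show "hmod_hom X X' (i' * p + j' * q)"
      using h m by (blast intro: hmod_hom_add hmod_hom_mult)
    show "i * p' + j * q' \<in> carrier_mat (hdim X) (hdim X')" by auto
    show "(i' * p + j' * q) * (i * p' + j * q') = 1\<^sub>m (hdim X')"
      using main[OF e(1,2) biproduct_zero1[OF b] biproduct_zero2[OF b] c(5-8) c(1-4)] e by simp
    show "(i * p' + j * q') * (i' * p + j' * q) = 1\<^sub>m (hdim X)"
      using main[OF e(4,5) biproduct_zero1[OF b'] biproduct_zero2[OF b'] c(1-4) c(5-8)] e by simp
  qed
qed

lemma biproduct_iso_direct_sum:
  assumes "is_hmod H X" "is_hmod H Y" "is_hmod H Z" "biproduct X Y Z i j p q"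
  shows "hmod_iso X (direct_sum_hmod Y Z)"
  using direct_sum_biproduct[OF assms(2,3)] biproduct_iso[OF assms(1) _ assms(2,3,4)]
    direct_sum_hmod[OF assms(2,3)] by blast

lemma biproduct_transport:
  assumes m: "is_hmod H X" "is_hmod H X'" "is_hmod H Y" "is_hmod H Z"
    and b: "biproduct X Y Z i j p q" and A: "hmod_hom X X' A" "hmod_hom X' X B"
      "A * B = 1\<^sub>m (hdim X')" "B * A = 1\<^sub>m (hdim X)"
  shows "biproduct X' Y Z (A * i) (A * j) (p * B) (q * B)"
proof -
  have h: "hmod_hom Y X i" "hmod_hom Z X j" "hmod_hom X Y p" "hmod_hom X Z q"
    and e: "p * i = 1\<^sub>m (hdim Y)" "q * j = 1\<^sub>m (hdim Z)" "i * p + j * q = 1\<^sub>m (hdim X)"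
    using b by (auto simp: biproduct_def)
  note c[simp] = h[THEN hmod_hom_carrier] A(1,2)[THEN hmod_hom_carrier]
  note [simp] = c[THEN carrier_matD(1)] c[THEN carrier_matD(2)]
  have "p * B * (A * i) = p * (B * A) * i" "q * B * (A * j) = q * (B * A) * j"
    by (simp_all add: mat_assoc)
  moreover have "A * i * (p * B) + A * j * (q * B) = A * (i * p + j * q) * B"
    by (simp add: mat_assoc mat_add_mult mat_mult_add)
  ultimately show ?thesis
    unfolding biproduct_def using h A m e right_mult_one_mat[OF c(3)] right_mult_one_mat[OF c(4)]
      right_mult_one_mat[OF c(5)]
    by (auto intro: hmod_hom_mult)
qed

lemma iso_direct_sum_biproduct:
  assumes "is_hmod H X" "is_hmod H Y" "is_hmod H Z" "hmod_iso X (direct_sum_hmod Y Z)"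
  shows "\<exists>i j p q. biproduct X Y Z i j p q"
proof -
  have S: "is_hmod H (direct_sum_hmod Y Z)" using assms by (auto intro: direct_sum_hmod)
  obtain A B where "hmod_hom X (direct_sum_hmod Y Z) A" "hmod_hom (direct_sum_hmod Y Z) X B"
    "A * B = 1\<^sub>m (hdim (direct_sum_hmod Y Z))" "B * A = 1\<^sub>m (hdim X)"
    using hmod_isoE[OF assms(1) S assms(4)] .
  then show ?thesis
    using direct_sum_biproduct[OF assms(2,3)] biproduct_transport[OF S assms(1-3)] by blast
qed

text \<open>The sum of \<open>U\<close> and \<open>V\<close> is itself made a biproduct of
  \<open>U'\<close> and \<open>V'\<close> by composing its maps with the isomorphisms; uniqueness of
  biproducts does the rest.\<close>

lemma direct_sum_cong:
  assumes m: "is_hmod H U" "is_hmod H U'" "is_hmod H V" "is_hmod H V'"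
    and "hmod_iso U U'" "hmod_iso V V'"
  shows "hmod_iso (direct_sum_hmod U V) (direct_sum_hmod U' V')"
proof -
  obtain A B where A: "hmod_hom U U' A" "hmod_hom U' U B" "A * B = 1\<^sub>m (hdim U')" "B * A = 1\<^sub>m (hdim U)"
    using hmod_isoE[OF m(1,2) assms(5)] .
  obtain C D where C: "hmod_hom V V' C" "hmod_hom V' V D" "C * D = 1\<^sub>m (hdim V')" "D * C = 1\<^sub>m (hdim V)"
    using hmod_isoE[OF m(3,4) assms(6)] .
  let ?X = "direct_sum_hmod U V"
  have X: "is_hmod H ?X" using m by (auto intro: direct_sum_hmod)
  obtain i j p q where b: "biproduct ?X U V i j p q" using direct_sum_biproduct[OF m(1,3)] by blast
  then have h: "hmod_hom U ?X i" "hmod_hom V ?X j" "hmod_hom ?X U p" "hmod_hom ?X V q"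
    and e: "p * i = 1\<^sub>m (hdim U)" "q * j = 1\<^sub>m (hdim V)" "i * p + j * q = 1\<^sub>m (hdim ?X)"
    by (auto simp: biproduct_def)
  note c[simp] = h[THEN hmod_hom_carrier] A(1,2)[THEN hmod_hom_carrier] C(1,2)[THEN hmod_hom_carrier]
  note [simp] = c[THEN carrier_matD(1)] c[THEN carrier_matD(2)]
  have "A * p * (i * B) = A * (p * i) * B" "C * q * (j * D) = C * (q * j) * D"
    by (simp_all add: mat_assoc)
  moreover have "i * B * (A * p) + j * D * (C * q) = i * (B * A) * p + j * (D * C) * q"
    by (simp add: mat_assoc)
  ultimately have "biproduct ?X U' V' (i * B) (j * D) (A * p) (C * q)"
    unfolding biproduct_def using h A C m X e right_mult_one_mat[OF c(1)] right_mult_one_mat[OF c(2)]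
      right_mult_one_mat[OF c(5)] right_mult_one_mat[OF c(7)]
    by (auto intro: hmod_hom_mult)
  then show ?thesis using biproduct_iso_direct_sum[OF X m(2,4)] by blast
qed

lemma direct_sum_comm:
  assumes "is_hmod H U" "is_hmod H V"
  shows "hmod_iso (direct_sum_hmod U V) (direct_sum_hmod V U)"
  using direct_sum_biproduct[OF assms] biproduct_swap
    biproduct_iso_direct_sum[OF direct_sum_hmod[OF assms] assms(2,1)] by blast

section \<open>Idempotent endomorphisms and direct summands\<close>

text \<open>The image of the idempotent endomorphism \<open>e = C D\<close> as a module in its own
  right. The action is compressed to \<open>D V(h) C\<close>, and this stays multiplicative because
  \<open>C D\<close> commutes with the action.\<close>

lemma hmod_cut:
  assumes V: "is_hmod H V" and e: "hmod_hom V V e"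
    and C: "C \<in> carrier_mat (hdim V) r" and D: "D \<in> carrier_mat r (hdim V)"
    and DC: "D * C = 1\<^sub>m r" and CD: "C * D = e"
  shows "is_hmod H (\<lambda>h. D * V h * C)" "hdim (\<lambda>h. D * V h * C) = r"
    "hmod_hom (\<lambda>h. D * V h * C) V C" "hmod_hom V (\<lambda>h. D * V h * C) D"
proof -
  note [simp] = carrier_matD[OF C] carrier_matD[OF D] hmod_dim[OF V]
  have c: "V h \<in> carrier_mat (hdim V) (hdim V)" for h using hmod_carrier[OF V] .
  have eV: "e * V h = V h * e" for h using hmod_hom_commute[OF e] .
  let ?U = "\<lambda>h. D * V h * C"
  have U1: "?U 1 = 1\<^sub>m r" using V DC D by (simp add: is_hmod_def)
  show d: "hdim ?U = r" unfolding hdim_def by simp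
  have eC: "e * C = C"
  proof -
    have "e * C = C * (D * C)" unfolding CD[symmetric] by (simp add: mat_assoc)
    then show ?thesis using DC C by simp
  qed
  have De: "D * e = D"
  proof -
    have "D * e = (D * C) * D" unfolding CD[symmetric] by (simp add: mat_assoc)
    then show ?thesis using DC D by simp
  qed
  have CU: "C * ?U h = V h * C" for h
  proof -
    have "C * ?U h = (C * D) * V h * C" by (simp add: mat_assoc)
    also have "\<dots> = V h * (e * C)" using hmod_hom_dim[OF e] unfolding CD eV by (simp add: mat_assoc)
    finally show ?thesis using eC by simp
  qed
  have UD: "D * V h = ?U h * D" for h
  proof -
    have "?U h * D = D * V h * (C * D)" by (simp add: mat_assoc)
    also have "\<dots> = D * (V h * e)" using hmod_hom_dim[OF e] unfolding CD by (simp add: mat_assoc)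
    also have "\<dots> = (D * e) * V h" using hmod_hom_dim[OF e] by (simp add: mat_assoc eV)
    finally show ?thesis using De by simp
  qed
  show "hmod_hom ?U V C" using C CU d by (simp add: hmod_hom_def)
  show "hmod_hom V ?U D" using D UD d by (simp add: hmod_hom_def)
  show "is_hmod H ?U"
    unfolding is_hmod_def d
  proof (intro conjI allI)
    fix g h a
    show "?U h \<in> carrier_mat r r" by auto
    show "?U (g + h) = ?U g + ?U h"
      using V by (simp add: is_hmod_def mat_mult_add mat_add_mult)
    show "?U (hscale H a h) = a \<cdot>\<^sub>m ?U h"
      using V c[of h] C D
      by (simp add: is_hmod_def mult_smult_distrib[of _ r "hdim V" _ "hdim V"]
        mult_smult_assoc_mat[of _ r "hdim V" _ r])
    have "?U (g * h) = D * V g * (V h * C)" using V by (simp add: is_hmod_def mat_assoc)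
    also have "\<dots> = D * V g * C * ?U h" unfolding CU[symmetric] by (simp add: mat_assoc)
    finally show "?U (g * h) = ?U g * ?U h" .
    show "?U 1 = 1\<^sub>m r" using U1 .
  qed
qed

text \<open>The complement is the image of the idempotent \<open>1 - A B\<close>.\<close>

lemma hmod_split:
  assumes U: "is_hmod H U" and V: "is_hmod H V" and A: "hmod_hom U V A" and B: "hmod_hom V U B"
    and BA: "B * A = 1\<^sub>m (hdim U)"
  shows "\<exists>M C D. is_hmod H M \<and> biproduct V U M A C B D"
proof -
  note c[simp] = hmod_hom_carrier[OF A] hmod_hom_carrier[OF B]
  note [simp] = c[THEN carrier_matD(1)] c[THEN carrier_matD(2)]
  let ?e = "1\<^sub>m (hdim V) - A * B"
  have e: "hmod_hom V V ?e" using hmod_hom_minus[OF V V hmod_hom_one[OF V] hmod_hom_mult[OF V U V B A]] .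
  have "(A * B) * (A * B) = A * (B * A) * B" by (simp add: mat_assoc)
  then have ee0: "(A * B) * (A * B) = A * B" using BA right_mult_one_mat[OF c(1)] by simp
  have AB: "A * B \<in> carrier_mat (hdim V) (hdim V)" using c by (metis mult_carrier_mat)
  have "?e * ?e = ?e - (A * B - (A * B) * (A * B))"
    using AB left_mult_one_mat[OF AB] right_mult_one_mat[OF AB] by (simp add: mat_minus_mult mat_mult_minus)
  then have ee: "?e * ?e = ?e" using AB ee0 by (intro eq_matI) auto
  obtain r C D where CD: "C \<in> carrier_mat (hdim V) r" "D \<in> carrier_mat r (hdim V)" "D * C = 1\<^sub>m r" "C * D = ?e"
    using split_idempotent[OF hmod_hom_carrier[OF e] ee] .
  note M = hmod_cut[OF V e CD]
  have "A * B + C * D = 1\<^sub>m (hdim V)" unfolding CD(4) using AB by (intro eq_matI) auto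
  then show ?thesis using M A B BA CD
    by (intro exI[of _ "\<lambda>h. D * V h * C"] exI[of _ C] exI[of _ D]) (auto simp: biproduct_def)
qed

text \<open>The image of \<open>e\<close> is a direct summand. If it is zero then
  \<open>e = 0\<close>, and if its complement is zero then \<open>e = 1\<close>.\<close>

lemma indecomposable_idempotent:
  assumes V: "indecomposable_hmod H V" and e: "hmod_hom V V e" and ee: "e * e = e"
  shows "e = 0\<^sub>m (hdim V) (hdim V) \<or> e = 1\<^sub>m (hdim V)"
proof -
  have m: "is_hmod H V" using V by (simp add: indecomposable_hmod_def)
  note ec = hmod_hom_carrier[OF e]
  obtain r C D where CD: "C \<in> carrier_mat (hdim V) r" "D \<in> carrier_mat r (hdim V)" "D * C = 1\<^sub>m r" "C * D = e"
    using split_idempotent[OF ec ee] .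
  note U = hmod_cut[OF m e CD]
  obtain M C' D' where M: "is_hmod H M" and b: "biproduct V (\<lambda>h. D * V h * C) M C C' D D'"
    using hmod_split[OF U(1) m U(3,4)] CD U(2) by auto
  have iso: "hmod_iso V (direct_sum_hmod (\<lambda>h. D * V h * C) M)"
    using biproduct_iso_direct_sum[OF m U(1) M b] .
  then have "r = 0 \<or> hdim M = 0"
    using V U(1,2) M unfolding indecomposable_hmod_def by metis
  then show ?thesis
  proof
    assume "r = 0"
    then have "e = 0\<^sub>m (hdim V) (hdim V)"
      using CD by (intro eq_matI) (auto simp: scalar_prod_def simp flip: CD(4))
    then show ?thesis ..
  next
    assume M0: "hdim M = 0"
    have "hmod_hom M V C'" "hmod_hom V M D'" "C * D + C' * D' = 1\<^sub>m (hdim V)"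
      using b by (auto simp: biproduct_def)
    note z = this(1,2)[THEN hmod_hom_carrier] this(3)
    have "C' * D' = 0\<^sub>m (hdim V) (hdim V)"
      using z M0 by (intro eq_matI) (auto simp: scalar_prod_def)
    then have "e = 1\<^sub>m (hdim V)" using z(3) CD(4) ec by simp
    then show ?thesis ..
  qed
qed

section \<open>The Krull--Schmidt theorem\<close>

lemma indecomposable_hmod_is_hmod: "indecomposable_hmod H V \<Longrightarrow> is_hmod H V"
  by (simp add: indecomposable_hmod_def)

lemma indecomposable_summand:
  "indecomposable_hmod H V \<Longrightarrow> is_hmod H U \<Longrightarrow> is_hmod H W \<Longrightarrow> hmod_iso V (direct_sum_hmod U W) \<Longrightarrow>
    hdim U = 0 \<or> hdim W = 0"
  unfolding indecomposable_hmod_def by metis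

text \<open>Although \<open>M\<close> commutes with the action only up to the twist \<open>\<sigma>\<close>, the image of a high power of \<open>M\<close>
  is a submodule, and so is its kernel, because \<open>\<sigma>\<close> is surjective. Hence the Fitting decomposition
  of the matrix \<open>M\<close> is a decomposition of \<open>V\<close>.\<close>

lemma indecomposable_twisted_fitting:
  assumes V: "indecomposable_hmod H V" and M: "M \<in> carrier_mat (hdim V) (hdim V)"
    and \<sigma>: "surj \<sigma>" and c: "\<And>h. V h * M = M * V (\<sigma> h)"
  shows "det M \<noteq> 0 \<or> (mat_trace M = 0 \<and> det (1\<^sub>m (hdim V) - M) \<noteq> 0)"
proof -
  let ?n = "hdim V"
  have m: "is_hmod H V" using V by (rule indecomposable_hmod_is_hmod)
  have Vc: "V h \<in> carrier_mat ?n ?n" for h using hmod_carrier[OF m] .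
  obtain k e Y where eY: "e \<in> carrier_mat ?n ?n" "Y \<in> carrier_mat ?n ?n" "e * e = e"
    "e = (M ^\<^sub>m k) * Y" "e = Y * (M ^\<^sub>m k)" "e * (M ^\<^sub>m k) = M ^\<^sub>m k" "(M ^\<^sub>m k) * e = M ^\<^sub>m k"
    and one: "e = 1\<^sub>m ?n \<Longrightarrow> det M \<noteq> 0"
    and zero: "e = 0\<^sub>m ?n ?n \<Longrightarrow> mat_trace M = 0 \<and> det (1\<^sub>m ?n - M) \<noteq> 0"
    using fitting_idempotent[OF M] by blast
  define P where "P = M ^\<^sub>m k"
  note eP = eY(3-7)[folded P_def]
  have P: "P \<in> carrier_mat ?n ?n" unfolding P_def using M by simp
  have VP: "V h * P = P * V ((\<sigma> ^^ k) h)" for h unfolding P_def by (rule mat_comm_pow[OF M, of V \<sigma>]) (fact Vc, fact c)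
  note [simp] = carrier_matD[OF eY(1)] carrier_matD[OF eY(2)] carrier_matD[OF P] hmod_dim[OF m]
  have 1: "e * (V h * e) = V h * e" for h
  proof -
    have "V h * e = P * V ((\<sigma> ^^ k) h) * Y" unfolding eP(2) by (simp add: VP flip: mat_assoc)
    moreover have "e * (P * V ((\<sigma> ^^ k) h) * Y) = (e * P) * V ((\<sigma> ^^ k) h) * Y" by (simp add: mat_assoc)
    ultimately show ?thesis using eP(4) by simp
  qed
  have 2: "e * (V h * e) = e * V h" for h
  proof -
    obtain g where g: "h = (\<sigma> ^^ k) g" using surj_fn[OF \<sigma>, of k] by (metis surjD)
    have "e * V h = Y * (P * V h)" unfolding eP(3) by (simp add: mat_assoc)
    then have a: "e * V h = Y * (V g * P)" using VP g by simp
    have "e * (V h * e) = (e * V h) * e" by (simp add: mat_assoc)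
    also have "\<dots> = Y * (V g * (P * e))" unfolding a by (simp add: mat_assoc)
    finally show ?thesis using a eP(5) by simp
  qed
  have "hmod_hom V V e" unfolding hmod_hom_def using eY(1) 1 2 by metis
  then show ?thesis using indecomposable_idempotent[OF V _ eP(1)] one zero by blast
qed

text \<open>The untwisted instance of the preceding alternative: the endomorphism ring of an
  indecomposable module is local. This is the form that the exchange argument uses.\<close>

lemma indecomposable_local:
  assumes V: "indecomposable_hmod H V" and a: "hmod_hom V V a" and b: "hmod_hom V V b"
    and ab: "a + b = 1\<^sub>m (hdim V)"
  shows "det a \<noteq> 0 \<or> det b \<noteq> 0"
proof -
  note c = hmod_hom_carrier[OF a] hmod_hom_carrier[OF b]
  have "b = 1\<^sub>m (hdim V) - a" using c unfolding ab[symmetric] by (intro eq_matI) auto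
  then show ?thesis
    using indecomposable_twisted_fitting[OF V c(1) surj_id] hmod_hom_commute[OF a] by auto
qed

text \<open>Cancels an inverse pair inside a product bracketed to the right, which is the normal
  form produced by \<open>mat_assoc\<close>.\<close>

lemma mat_mult_one_cancel:
  fixes A :: "'a::semiring_1 mat"
  assumes "A * B = 1\<^sub>m n" "dim_col A = dim_row B" "dim_col B = dim_row C"
  shows "A * (B * C) = C"
proof -
  have "dim_row C = n" using assms by (metis index_mult_mat(3) index_one_mat(3))
  then have C: "C \<in> carrier_mat n (dim_col C)" by auto
  have "A * (B * C) = (A * B) * C" using assms(2,3) by (simp add: mat_assoc)
  then show ?thesis using assms(1) left_mult_one_mat[OF C] by simp
qed

lemma mat_mult_zero_cancel:
  fixes A :: "'a::semiring_0 mat"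
  assumes "A * B = 0\<^sub>m n m" "dim_col A = dim_row B" "dim_col B = dim_row C"
  shows "A * (B * C) = 0\<^sub>m n (dim_col C)"
proof -
  have "dim_row C = m" using assms by (metis index_mult_mat(3) index_zero_mat(3))
  then have C: "C \<in> carrier_mat m (dim_col C)" by auto
  have "A * (B * C) = (A * B) * C" using assms(2,3) by (simp add: mat_assoc)
  then show ?thesis using assms(1) left_mult_zero_mat[OF C] by simp
qed

lemma mat_mult_zero_right: "dim_col A = n \<Longrightarrow> A * 0\<^sub>m n m = 0\<^sub>m (dim_row A) m"
  for A :: "'a::semiring_0 mat"
  by (rule right_mult_zero_mat) auto

lemma mat_zero_add: "dim_row A = n \<Longrightarrow> dim_col A = m \<Longrightarrow> 0\<^sub>m n m + A = A"
  "dim_row A = n \<Longrightarrow> dim_col A = m \<Longrightarrow> A + 0\<^sub>m n m = A"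
  for A :: "'a::monoid_add mat"
  by (auto intro!: eq_matI)

section \<open>The exchange property of indecomposable summands\<close>

text \<open>Rebrackets a sum of \<open>E\<close>, \<open>W\<close> and \<open>U\<close>, where
  \<open>Z\<close> may be any biproduct of \<open>W\<close> and \<open>U\<close>. The maps are kept
  explicit because the exchange argument has to know that the projection onto \<open>E\<close> is
  \<open>B * pV\<close>.\<close>

lemma biproduct_assoc:
  assumes m: "is_hmod H X" "is_hmod H V" "is_hmod H U" "is_hmod H E" "is_hmod H W" "is_hmod H Z"
    and b1: "biproduct X V U iV iU pV pU" and b2: "biproduct V E W A C B D"
    and b3: "biproduct Z W U k l r s"
  shows "biproduct X E Z (iV * A) (iV * C * r + iU * s) (B * pV) (k * D * pV + l * pU)"
proof -
  have h: "hmod_hom V X iV" "hmod_hom U X iU" "hmod_hom X V pV" "hmod_hom X U pU"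
    "hmod_hom E V A" "hmod_hom W V C" "hmod_hom V E B" "hmod_hom V W D"
    "hmod_hom W Z k" "hmod_hom U Z l" "hmod_hom Z W r" "hmod_hom Z U s"
    and e: "pV * iV = 1\<^sub>m (hdim V)" "pU * iU = 1\<^sub>m (hdim U)" "iV * pV + iU * pU = 1\<^sub>m (hdim X)"
    "B * A = 1\<^sub>m (hdim E)" "D * C = 1\<^sub>m (hdim W)" "A * B + C * D = 1\<^sub>m (hdim V)"
    "r * k = 1\<^sub>m (hdim W)" "s * l = 1\<^sub>m (hdim U)" "k * r + l * s = 1\<^sub>m (hdim Z)"
    using b1 b2 b3 by (auto simp: biproduct_def)
  note c = h[THEN hmod_hom_carrier]
  note [simp] = h[THEN hmod_hom_dim(1)] h[THEN hmod_hom_dim(2)]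
  note ones = e(1,2,4,5,7,8)
  note zeros = biproduct_zero1[OF b1] biproduct_zero2[OF b1] biproduct_zero1[OF b3] biproduct_zero2[OF b3]
  note [simp] = ones zeros ones[THEN mat_mult_one_cancel] zeros[THEN mat_mult_zero_cancel]
    mat_mult_zero_right mat_zero_add
  have H: "hmod_hom E X (iV * A)" "hmod_hom X E (B * pV)"
    "hmod_hom Z X (iV * C * r + iU * s)" "hmod_hom X Z (k * D * pV + l * pU)"
    using h m by (blast intro: hmod_hom_mult hmod_hom_add)+
  have 1: "B * pV * (iV * A) = 1\<^sub>m (hdim E)" by (simp add: mat_assoc)
  have "(k * D * pV + l * pU) * (iV * C * r + iU * s) = k * r + l * s"
    by (simp add: mat_assoc mat_add_mult mat_mult_add)
  then have 2: "(k * D * pV + l * pU) * (iV * C * r + iU * s) = 1\<^sub>m (hdim Z)" using e by simp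
  have "(iV * C * r + iU * s) * (k * D * pV + l * pU) = iV * (C * (D * pV)) + iU * pU"
    by (simp add: mat_assoc mat_add_mult mat_mult_add)
  then have "iV * A * (B * pV) + (iV * C * r + iU * s) * (k * D * pV + l * pU)
      = iV * (A * (B * pV)) + (iV * (C * (D * pV)) + iU * pU)"
    by (simp add: mat_assoc)
  also have "\<dots> = (iV * (A * (B * pV)) + iV * (C * (D * pV))) + iU * pU"
    by (rule assoc_add_mat[symmetric, of _ "hdim X" "hdim X"]) auto
  also have "iV * (A * (B * pV)) + iV * (C * (D * pV)) = iV * ((A * B + C * D) * pV)"
    by (simp add: mat_assoc mat_add_mult mat_mult_add)
  also have "\<dots> = iV * pV" using e(6) left_mult_one_mat[OF c(3)] by simp
  also have "iV * pV + iU * pU = 1\<^sub>m (hdim X)" by (fact e(3))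
  finally show ?thesis unfolding biproduct_def using H 1 2 by blast
qed

text \<open>By \<open>p' i = 1\<close> the kernel of \<open>p'\<close>, which is the copy of
  \<open>Z\<close>, is a complement of the image of \<open>i\<close>, and so is the copy of
  \<open>Y\<close>. Two complements of one submodule are isomorphic by projecting along it.\<close>

lemma biproduct_cancel:
  assumes m: "is_hmod H X" "is_hmod H E" "is_hmod H Y" "is_hmod H Z"
    and b: "biproduct X E Y i j p q" and b': "biproduct X E Z i' j' p' q'"
    and p'i: "p' * i = 1\<^sub>m (hdim E)"
  shows "hmod_iso Y Z"
proof -
  have h: "hmod_hom E X i" "hmod_hom Y X j" "hmod_hom X E p" "hmod_hom X Y q"
    "hmod_hom E X i'" "hmod_hom Z X j'" "hmod_hom X E p'" "hmod_hom X Z q'"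
    and e: "p * i = 1\<^sub>m (hdim E)" "q * j = 1\<^sub>m (hdim Y)" "i * p + j * q = 1\<^sub>m (hdim X)"
    "p' * i' = 1\<^sub>m (hdim E)" "q' * j' = 1\<^sub>m (hdim Z)" "i' * p' + j' * q' = 1\<^sub>m (hdim X)"
    using b b' by (auto simp: biproduct_def)
  note c = h[THEN hmod_hom_carrier]
  note [simp] = h[THEN hmod_hom_dim(1)] h[THEN hmod_hom_dim(2)]
  note ones = e(1,2,4,5) p'i
  note zeros = biproduct_zero1[OF b] biproduct_zero2[OF b] biproduct_zero1[OF b'] biproduct_zero2[OF b']
  note [simp] = ones zeros ones[THEN mat_mult_one_cancel] zeros[THEN mat_mult_zero_cancel]
    mat_mult_zero_right mat_zero_add
  \<comment> \<open>The projection onto the kernel of \<open>p'\<close> along the image of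
    \<open>i\<close>.\<close>
  let ?K = "1\<^sub>m (hdim X) - i * p'"
  have K: "?K \<in> carrier_mat (hdim X) (hdim X)" by (intro minus_carrier_mat) auto
  have jq: "j * q = 1\<^sub>m (hdim X) - i * p"
    unfolding e(3)[symmetric] by (intro eq_matI) auto
  have jq': "j' * q' = 1\<^sub>m (hdim X) - i' * p'"
    unfolding e(6)[symmetric] by (intro eq_matI) auto
  have sub0: "A - A = 0\<^sub>m a b" "A - 0\<^sub>m a b = A" if "A \<in> carrier_mat a b" for A :: "'a mat" and a b
    using that by (auto intro!: eq_matI)
  have Ki: "?K * i = 0\<^sub>m (hdim X) (hdim E)"
    using left_mult_one_mat[OF c(1)] right_mult_one_mat[OF c(1)] sub0[OF c(1)]
    by (simp add: mat_minus_mult mat_assoc)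
  have pK: "p' * ?K = 0\<^sub>m (hdim E) (hdim X)"
    using right_mult_one_mat[OF c(7)] sub0[OF c(7)] left_mult_one_mat[OF c(7)]
    by (simp add: mat_mult_minus flip: mat_assoc)
  have Kj: "?K * j' = j'"
    using left_mult_one_mat[OF c(6)] sub0[OF c(6)] right_mult_zero_mat[OF c(1), of "hdim Z"]
    by (simp add: mat_minus_mult mat_assoc)
  have qK: "q * ?K = q"
    using right_mult_one_mat[OF c(4)] sub0[OF c(4)] left_mult_zero_mat[OF c(7), of "hdim Y"]
    by (simp add: mat_mult_minus flip: mat_assoc)
  have Kjq: "?K * (j * q) = ?K"
  proof -
    have "?K * (j * q) = ?K * 1\<^sub>m (hdim X) - (?K * i) * p"
      unfolding jq using K by (simp add: mat_mult_minus mat_assoc)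
    also have "\<dots> = ?K" unfolding Ki using K left_mult_zero_mat[OF c(3), of "hdim X"] sub0[OF K] by simp
    finally show ?thesis .
  qed
  have jqK: "j' * q' * ?K = ?K"
  proof -
    have "j' * q' * ?K = 1\<^sub>m (hdim X) * ?K - i' * (p' * ?K)"
      unfolding jq' using K by (simp add: mat_minus_mult mat_assoc)
    also have "\<dots> = ?K" unfolding pK using K sub0[OF K] by simp
    finally show ?thesis .
  qed
  show ?thesis
  proof (rule hmod_isoI)
    have "hmod_hom X X ?K"
      using h m by (blast intro: hmod_hom_mult hmod_hom_minus hmod_hom_one)
    then show "hmod_hom Y Z (q' * ?K * j)"
      using h m by (blast intro: hmod_hom_mult)
    show "q * j' \<in> carrier_mat (hdim Y) (hdim Z)" by auto
    have "q' * ?K * j * (q * j') = q' * (?K * (j * q)) * j'" by (simp add: mat_assoc)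
    also have "\<dots> = q' * (?K * j')" unfolding Kjq by (simp add: mat_assoc)
    finally show "q' * ?K * j * (q * j') = 1\<^sub>m (hdim Z)" unfolding Kj by simp
    have "q * j' * (q' * ?K * j) = q * (j' * q' * ?K) * j" by (simp add: mat_assoc)
    also have "\<dots> = q * ?K * j" unfolding jqK ..
    finally show "q * j' * (q' * ?K * j) = 1\<^sub>m (hdim Y)" unfolding qK by simp
  qed
qed

text \<open>An invertible composite \<open>E -> V -> E\<close> makes \<open>E\<close> a summand of
  \<open>V\<close>. Normalising by its inverse yields a projection \<open>B * pV\<close> of
  \<open>X\<close> onto \<open>E\<close> that restricts to the identity on the given copy of
  \<open>E\<close>, which is the hypothesis of \<open>biproduct_cancel\<close>.\<close>

lemma exchange_one_side:
  assumes m: "is_hmod H X" "is_hmod H Y" "is_hmod H V" "is_hmod H U" "is_hmod H E"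
    and b: "biproduct X E Y iE iY pE pY" and b': "biproduct X V U iV iU pV pU"
    and d: "det (pE * iV * (pV * iE)) \<noteq> 0"
  shows "\<exists>V'. is_hmod H V' \<and> hmod_iso V (direct_sum_hmod E V') \<and> hmod_iso Y (direct_sum_hmod V' U)"
proof -
  have h: "hmod_hom E X iE" "hmod_hom X E pE" "hmod_hom V X iV" "hmod_hom X V pV"
    using b b' by (auto simp: biproduct_def)
  note c = h[THEN hmod_hom_carrier]
  note [simp] = h[THEN hmod_hom_dim(1)] h[THEN hmod_hom_dim(2)]
  let ?g = "pE * iV * (pV * iE)"
  have g: "hmod_hom E E ?g" using h m by (blast intro: hmod_hom_mult)
  obtain g' where g': "g' \<in> carrier_mat (hdim E) (hdim E)" "?g * g' = 1\<^sub>m (hdim E)" "g' * ?g = 1\<^sub>m (hdim E)"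
    using invertible_det_obtain[OF hmod_hom_carrier[OF g] d] .
  have hg': "hmod_hom E E g'" using hmod_hom_inverse[OF m(5) m(5) g g'] .
  note [simp] = carrier_matD[OF g'(1)]
  define A where "A = pV * iE"
  define B where "B = g' * (pE * iV)"
  have A: "hmod_hom E V A" unfolding A_def using h m by (blast intro: hmod_hom_mult)
  have B: "hmod_hom V E B" unfolding B_def using h hg' m by (blast intro: hmod_hom_mult)
  have BA: "B * A = 1\<^sub>m (hdim E)" using g'(3) unfolding A_def B_def by (simp add: mat_assoc)
  obtain V' C D where V': "is_hmod H V'" and bV: "biproduct V E V' A C B D"
    using hmod_split[OF m(5) m(3) A B BA] by blast
  have Z: "is_hmod H (direct_sum_hmod V' U)" using V' m by (auto intro: direct_sum_hmod)
  obtain k l r s where bZ: "biproduct (direct_sum_hmod V' U) V' U k l r s"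
    using direct_sum_biproduct[OF V' m(4)] by blast
  have "B * pV * iE = B * A" unfolding A_def B_def by (simp add: mat_assoc)
  then have "hmod_iso Y (direct_sum_hmod V' U)"
    using biproduct_cancel[OF m(1,5,2) Z b biproduct_assoc[OF m(1,3,4,5) V' Z b' bV bZ]] BA by simp
  moreover have "hmod_iso V (direct_sum_hmod E V')"
    using biproduct_iso_direct_sum[OF m(3,5) V' bV] .
  ultimately show ?thesis using V' by blast
qed

text \<open>The identity of \<open>E\<close> is the sum of its passages through \<open>V\<close> and
  through \<open>U\<close>; as the endomorphism ring is local, one of them is invertible.\<close>

lemma exchange:
  assumes E: "indecomposable_hmod H E" and m: "is_hmod H Y" "is_hmod H V" "is_hmod H U"
    and iso: "hmod_iso (direct_sum_hmod E Y) (direct_sum_hmod V U)"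
  shows "(\<exists>V'. is_hmod H V' \<and> hmod_iso V (direct_sum_hmod E V') \<and> hmod_iso Y (direct_sum_hmod V' U)) \<or>
    (\<exists>U'. is_hmod H U' \<and> hmod_iso U (direct_sum_hmod E U') \<and> hmod_iso Y (direct_sum_hmod U' V))"
proof -
  note mE = indecomposable_hmod_is_hmod[OF E]
  let ?X = "direct_sum_hmod E Y"
  have X: "is_hmod H ?X" using mE m by (auto intro: direct_sum_hmod)
  obtain iE iY pE pY where b: "biproduct ?X E Y iE iY pE pY" using direct_sum_biproduct[OF mE m(1)] by blast
  obtain iV iU pV pU where b': "biproduct ?X V U iV iU pV pU"
    using iso_direct_sum_biproduct[OF X m(2,3) iso] by blast
  have h: "hmod_hom E ?X iE" "hmod_hom ?X E pE" "hmod_hom V ?X iV" "hmod_hom ?X V pV"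
     "hmod_hom U ?X iU" "hmod_hom ?X U pU" and e: "pE * iE = 1\<^sub>m (hdim E)" "iV * pV + iU * pU = 1\<^sub>m (hdim ?X)"
    using b b' by (auto simp: biproduct_def)
  note [simp] = h[THEN hmod_hom_dim(1)] h[THEN hmod_hom_dim(2)]
  have "pE * iV * (pV * iE) + pE * iU * (pU * iE) = pE * ((iV * pV + iU * pU) * iE)"
    by (simp add: mat_assoc mat_add_mult mat_mult_add)
  also have "\<dots> = 1\<^sub>m (hdim E)" using e left_mult_one_mat[OF hmod_hom_carrier[OF h(1)]] by simp
  finally have sum: "pE * iV * (pV * iE) + pE * iU * (pU * iE) = 1\<^sub>m (hdim E)" .
  have "hmod_hom E E (pE * iV * (pV * iE))" "hmod_hom E E (pE * iU * (pU * iE))"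
    using h mE X m by (blast intro: hmod_hom_mult)+
  from indecomposable_local[OF E this sum] show ?thesis
    using exchange_one_side[OF X m(1,2,3) mE b b'] exchange_one_side[OF X m(1,3,2) mE b biproduct_swap[OF b']]
    by blast
qed

section \<open>Existence and uniqueness of decompositions into indecomposables\<close>

definition zero_hmod :: "('k::field, 'h::ring_1) hmod" where
  "zero_hmod = (\<lambda>h. 0\<^sub>m 0 0)"

definition direct_sum_list :: "('k::field, 'h::ring_1) hmod list \<Rightarrow> ('k, 'h) hmod" where
  "direct_sum_list Vs = foldr direct_sum_hmod Vs zero_hmod"

lemma direct_sum_list_simps [simp]:
  "direct_sum_list [] = zero_hmod"
  "direct_sum_list (V # Vs) = direct_sum_hmod V (direct_sum_list Vs)"
  by (simp_all add: direct_sum_list_def)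

lemma zero_hmod: "is_hmod H zero_hmod" "hdim zero_hmod = 0"
  by (auto simp: is_hmod_def zero_hmod_def hdim_def intro!: eq_matI)

lemma hdim_0_iso_zero:
  assumes "is_hmod H V" "hdim V = 0" shows "hmod_iso V zero_hmod"
  by (rule hmod_isoI[of _ _ "0\<^sub>m 0 0" "0\<^sub>m 0 0"])
    (use assms in \<open>auto simp: hmod_hom_def zero_hmod(2) hmod_dim[OF zero_hmod(1)] intro!: eq_matI\<close>)

lemma direct_sum_zero_left:
  assumes "is_hmod H V" shows "direct_sum_hmod zero_hmod V = V"
proof
  fix h
  show "direct_sum_hmod zero_hmod V h = V h"
    unfolding direct_sum_hmod_def zero_hmod(2) unfolding zero_hmod_def
    by (rule eq_matI) (use hmod_dim[OF assms] in simp_all)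
qed

lemma direct_sum_zero_right:
  assumes "is_hmod H V" shows "direct_sum_hmod V zero_hmod = V"
proof
  fix h
  show "direct_sum_hmod V zero_hmod h = V h"
    unfolding direct_sum_hmod_def zero_hmod(2) unfolding zero_hmod_def
    by (rule eq_matI) (use hmod_dim[OF assms] in simp_all)
qed

lemma direct_sum_list_hmod:
  "(\<And>V. V \<in> set Vs \<Longrightarrow> is_hmod H V) \<Longrightarrow> is_hmod H (direct_sum_list Vs)"
  by (induction Vs) (auto simp: zero_hmod intro: direct_sum_hmod)

lemma direct_sum_list_append:
  assumes "\<And>V. V \<in> set Vs \<union> set Ws \<Longrightarrow> is_hmod H V"
  shows "direct_sum_list (Vs @ Ws) = direct_sum_hmod (direct_sum_list Vs) (direct_sum_list Ws)"
  using assms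
proof (induction Vs)
  case Nil
  then show ?case using direct_sum_zero_left[OF direct_sum_list_hmod[of Ws H]] by auto
next
  case (Cons V Vs)
  then show ?case
    using direct_sum_assoc[of H V "direct_sum_list Vs" "direct_sum_list Ws"]
      direct_sum_list_hmod[of Vs H] direct_sum_list_hmod[of Ws H] by auto
qed

theorem krull_schmidt_existence:
  assumes "is_hmod H V"
  shows "\<exists>Es. (\<forall>E\<in>set Es. indecomposable_hmod H E) \<and> hmod_iso V (direct_sum_list Es)"
  using assms
proof (induction "hdim V" arbitrary: V rule: less_induct)
  case less
  consider "hdim V = 0" | "indecomposable_hmod H V" | U W where "is_hmod H U" "is_hmod H W"
    "hmod_iso V (direct_sum_hmod U W)" "hdim U \<noteq> 0" "hdim W \<noteq> 0"
    using less.prems by (auto simp: indecomposable_hmod_def)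
  then show ?case
  proof cases
    case 1
    then show ?thesis using hdim_0_iso_zero[OF less.prems] by (intro exI[of _ "[]"]) simp
  next
    case 2
    then show ?thesis using hmod_iso_refl[OF less.prems] direct_sum_zero_right[OF less.prems]
      by (intro exI[of _ "[V]"]) simp
  next
    case 3
    have "hdim V = hdim U + hdim W"
      using hmod_iso_hdim[OF 3(3)] direct_sum_hdim[OF 3(1,2)] by simp
    then obtain Es Fs where *: "\<forall>E\<in>set Es. indecomposable_hmod H E" "hmod_iso U (direct_sum_list Es)"
      "\<forall>E\<in>set Fs. indecomposable_hmod H E" "hmod_iso W (direct_sum_list Fs)"
      using less.hyps[OF _ 3(1)] less.hyps[OF _ 3(2)] 3(4,5) by auto
    have mods: "is_hmod H (direct_sum_list Es)" "is_hmod H (direct_sum_list Fs)"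
      using * by (auto intro!: direct_sum_list_hmod dest: indecomposable_hmod_is_hmod)
    have app: "direct_sum_list (Es @ Fs) = direct_sum_hmod (direct_sum_list Es) (direct_sum_list Fs)"
      by (rule direct_sum_list_append[of Es Fs H]) (use * in \<open>auto dest: indecomposable_hmod_is_hmod\<close>)
    have "hmod_iso (direct_sum_hmod U W) (direct_sum_list (Es @ Fs))"
      unfolding app by (rule direct_sum_cong[OF 3(1) mods(1) 3(2) mods(2) *(2,4)])
    then have "hmod_iso V (direct_sum_list (Es @ Fs))"
      using hmod_iso_trans[OF less.prems direct_sum_hmod[OF 3(1,2)] _ 3(3)] direct_sum_hmod[OF mods]
      unfolding app by blast
    then show ?thesis using * by (intro exI[of _ "Es @ Fs"]) auto
  qed
qed

lemma indecomposable_not_zero_sum: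
  assumes "indecomposable_hmod H E" "is_hmod H Y"
  shows "\<not> hmod_iso (direct_sum_hmod E Y) zero_hmod"
proof
  assume "hmod_iso (direct_sum_hmod E Y) zero_hmod"
  from hmod_iso_hdim[OF this] have "hdim E + hdim Y = 0"
    unfolding direct_sum_hdim[OF indecomposable_hmod_is_hmod[OF assms(1)] assms(2)] zero_hmod(2) .
  then show False using assms(1) by (simp add: indecomposable_hmod_def)
qed

text \<open>\<open>E\<close> is exchanged either against the head \<open>F\<close> or inside the
  rest of the list. In the first case indecomposability of \<open>F\<close> forces the leftover
  \<open>V'\<close> to vanish, so \<open>F\<close> and \<open>E\<close> are isomorphic. Carrying the
  complement \<open>Y\<close> along is what makes the uniqueness proof a plain induction.\<close>

lemma summand_of_direct_sum_list:
  assumes E: "indecomposable_hmod H E" and Y: "is_hmod H Y"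
    and Fs: "\<forall>F\<in>set Fs. indecomposable_hmod H F"
    and iso: "hmod_iso (direct_sum_hmod E Y) (direct_sum_list Fs)"
  shows "\<exists>As F Bs. Fs = As @ F # Bs \<and> hmod_iso F E \<and> hmod_iso Y (direct_sum_list (As @ Bs))"
  using Y Fs iso
proof (induction Fs arbitrary: Y)
  case Nil
  then show ?case using indecomposable_not_zero_sum[OF E] by auto
next
  case (Cons F Fs)
  note mE = indecomposable_hmod_is_hmod[OF E]
  have F: "is_hmod H F" and mFs: "\<And>F. F \<in> set Fs \<Longrightarrow> is_hmod H F" and iF: "indecomposable_hmod H F"
    using Cons.prems by (auto dest: indecomposable_hmod_is_hmod)
  let ?U = "direct_sum_list Fs"
  have U: "is_hmod H ?U" using mFs by (rule direct_sum_list_hmod)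
  have "hmod_iso (direct_sum_hmod E Y) (direct_sum_hmod F ?U)" using Cons.prems by simp
  from exchange[OF E Cons.prems(1) F U this] show ?case
  proof (elim disjE exE conjE)
    fix V' assume V': "is_hmod H V'" and i1: "hmod_iso F (direct_sum_hmod E V')"
      and i2: "hmod_iso Y (direct_sum_hmod V' ?U)"
    have "hdim V' = 0" using indecomposable_summand[OF iF mE V' i1] E by (simp add: indecomposable_hmod_def)
    note z = hdim_0_iso_zero[OF V' this]
    have "hmod_iso (direct_sum_hmod E V') E"
      using direct_sum_cong[OF mE mE V' zero_hmod(1) hmod_iso_refl[OF mE] z] direct_sum_zero_right[OF mE] by simp
    then have "hmod_iso F E" using hmod_iso_trans[OF F direct_sum_hmod[OF mE V'] mE i1] by blast
    moreover have "hmod_iso (direct_sum_hmod V' ?U) ?U"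
      using direct_sum_cong[OF V' zero_hmod(1) U U z hmod_iso_refl[OF U]] direct_sum_zero_left[OF U] by simp
    then have "hmod_iso Y ?U" using hmod_iso_trans[OF Cons.prems(1) direct_sum_hmod[OF V' U] U i2] by blast
    ultimately show ?thesis by (intro exI[of _ "[]"] exI[of _ F] exI[of _ Fs]) simp
  next
    fix U' assume U': "is_hmod H U'" and i1: "hmod_iso ?U (direct_sum_hmod E U')"
      and i2: "hmod_iso Y (direct_sum_hmod U' F)"
    have "hmod_iso (direct_sum_hmod E U') ?U" using hmod_iso_sym[OF U direct_sum_hmod[OF mE U'] i1] .
    with Cons.IH[OF U'] Cons.prems(2) obtain As G Bs where
      *: "Fs = As @ G # Bs" "hmod_iso G E" "hmod_iso U' (direct_sum_list (As @ Bs))" by auto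
    have mAB: "is_hmod H (direct_sum_list (As @ Bs))" using mFs *(1) by (intro direct_sum_list_hmod) auto
    have "hmod_iso (direct_sum_hmod U' F) (direct_sum_hmod F U')" using direct_sum_comm[OF U' F] .
    moreover have "hmod_iso (direct_sum_hmod F U') (direct_sum_list (F # As @ Bs))"
      using direct_sum_cong[OF F F U' mAB hmod_iso_refl[OF F] *(3)] by simp
    ultimately have "hmod_iso Y (direct_sum_list (F # As @ Bs))"
      using i2 Cons.prems(1) F U' mAB direct_sum_hmod
      by (metis direct_sum_list_simps(2) hmod_iso_trans)
    then show ?thesis using * by (intro exI[of _ "F # As"] exI[of _ G] exI[of _ Bs]) simp
  qed
qed

lemma iso_class_eq_iff:
  assumes "is_hmod H V" "is_hmod H W"
  shows "iso_class H V = iso_class H W \<longleftrightarrow> hmod_iso V W"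
proof
  assume "iso_class H V = iso_class H W"
  then have "W \<in> iso_class H V" using assms hmod_iso_refl[OF assms(2)] by (auto simp: iso_class_def)
  then show "hmod_iso V W" by (simp add: iso_class_def)
next
  assume "hmod_iso V W"
  then show "iso_class H V = iso_class H W"
    using assms hmod_iso_sym hmod_iso_trans unfolding iso_class_def by blast
qed

text \<open>A summand and its match are removed from the two lists; the complements remain
  isomorphic, so the induction hypothesis applies. Comparing multisets of classes absorbs the
  reordering.\<close>

theorem krull_schmidt_uniqueness:
  assumes "\<forall>E\<in>set Es. indecomposable_hmod H E" "\<forall>F\<in>set Fs. indecomposable_hmod H F"
    and "hmod_iso (direct_sum_list Es) (direct_sum_list Fs)"
  shows "image_mset (iso_class H) (mset Es) = image_mset (iso_class H) (mset Fs)"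
  using assms
proof (induction Es arbitrary: Fs)
  case Nil
  show ?case
  proof (cases Fs)
    case (Cons F Fs')
    then have "is_hmod H (direct_sum_list Fs')"
      using Nil by (auto intro!: direct_sum_list_hmod dest: indecomposable_hmod_is_hmod)
    moreover have "hmod_iso (direct_sum_hmod F (direct_sum_list Fs')) zero_hmod"
      using Nil Cons hmod_iso_sym[of H zero_hmod "direct_sum_hmod F (direct_sum_list Fs')"] calculation
      by (auto simp: zero_hmod intro: direct_sum_hmod dest: indecomposable_hmod_is_hmod)
    ultimately show ?thesis using indecomposable_not_zero_sum Nil Cons by auto
  qed simp
next
  case (Cons E Es)
  have E: "indecomposable_hmod H E" using Cons.prems by simp
  have "is_hmod H (direct_sum_list Es)"
    using Cons.prems by (auto intro!: direct_sum_list_hmod dest: indecomposable_hmod_is_hmod)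
  from summand_of_direct_sum_list[OF E this Cons.prems(2)] Cons.prems(3)
  obtain As F Bs where *: "Fs = As @ F # Bs" "hmod_iso F E" "hmod_iso (direct_sum_list Es) (direct_sum_list (As @ Bs))"
    by auto
  have "image_mset (iso_class H) (mset Es) = image_mset (iso_class H) (mset (As @ Bs))"
    by (rule Cons.IH) (use Cons.prems * in auto)
  moreover have "iso_class H F = iso_class H E"
    using iso_class_eq_iff[of H F E] *(1,2) Cons.prems E by (auto dest: indecomposable_hmod_is_hmod)
  ultimately show ?case using *(1) by simp
qed

section \<open>Sweedler calculus\<close>

text \<open>Sweedler notation for the sum of \<open>\<beta> x_1 x_2\<close>. The list
  \<open>comult H x\<close> represents a tensor only up to \<open>tensor2_eq\<close>, so the value
  has an invariant meaning for bilinear \<open>\<beta>\<close>, and Hopf algebra identities are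
  tested against such forms.\<close>

definition cosum :: "('k::field, 'h::ring_1) hopf \<Rightarrow> 'h \<Rightarrow> ('h \<Rightarrow> 'h \<Rightarrow> 'k) \<Rightarrow> 'k" where
  "cosum H x \<beta> = (\<Sum>(a, b)\<leftarrow>comult H x. \<beta> a b)"

lemma cosum_add: "cosum H x (\<lambda>a b. \<beta> a b + \<gamma> a b) = cosum H x \<beta> + cosum H x \<gamma>"
  by (simp add: cosum_def case_prod_unfold sum_list_addf)

lemma cosum_mult_left: "cosum H x (\<lambda>a b. c * \<beta> a b) = c * cosum H x \<beta>"
  by (simp add: cosum_def case_prod_unfold sum_list_const_mult)

lemma cosum_mult_right: "cosum H x (\<lambda>a b. \<beta> a b * c) = cosum H x \<beta> * c"
  by (simp add: cosum_def case_prod_unfold sum_list_mult_const)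

lemma cosum_zero: "cosum H x (\<lambda>a b. 0) = 0"
  by (simp add: cosum_def case_prod_unfold)

lemma cosum_sum: "cosum H x (\<lambda>a b. \<Sum>i\<in>I. \<beta> i a b) = (\<Sum>i\<in>I. cosum H x (\<beta> i))"
  by (induction I rule: infinite_finite_induct) (simp_all add: cosum_zero cosum_add)

lemma cosum_swap:
  "cosum H x (\<lambda>a b. cosum H y (\<lambda>c d. \<beta> a b c d)) = cosum H y (\<lambda>c d. cosum H x (\<lambda>a b. \<beta> a b c d))"
proof -
  have "(\<Sum>p\<leftarrow>xs. \<Sum>q\<leftarrow>ys. f p q) = (\<Sum>q\<leftarrow>ys. \<Sum>p\<leftarrow>xs. f p q)"
    for xs ys :: "('b \<times> 'b) list" and f :: "'b \<times> 'b \<Rightarrow> 'b \<times> 'b \<Rightarrow> 'a"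
    by (induction xs) (simp_all add: sum_list_addf)
  then show ?thesis by (simp add: cosum_def case_prod_unfold)
qed

lemma sum_list_concat_map:
  "(\<Sum>y\<leftarrow>concat (map g xs). f y) = (\<Sum>x\<leftarrow>xs. \<Sum>y\<leftarrow>g x. f y)"
  for f :: "'a \<Rightarrow> 'b::comm_monoid_add"
  by (induction xs) simp_all

context fin_dim_hopf_algebra
begin

abbreviation ant where "ant \<equiv> antipode H"
abbreviation eps where "eps \<equiv> counit H"
abbreviation scl (infixr \<open>*\<^sub>H\<close> 75) where "c *\<^sub>H x \<equiv> hscale H c x"

lemma hopf_vector_space: "vector_space (hscale H)"
  using fin_dim by (auto simp: finite_dimensional_vector_space_def)

interpretation vs: vector_space "hscale H"
  by (rule hopf_vector_space)

lemma field_vector_space: "vector_space ((*) :: 'k \<Rightarrow> 'k \<Rightarrow> 'k)"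
  by unfold_locales (simp_all add: algebra_simps)

lemma linear_form_iff:
  "linear_form H f \<longleftrightarrow> (\<forall>x y. f (x + y) = f x + f y) \<and> (\<forall>c x. f (c *\<^sub>H x) = c * f x)"
proof -
  interpret f: vector_space "(*) :: 'k \<Rightarrow> 'k \<Rightarrow> 'k" by (rule field_vector_space)
  interpret p: vector_space_pair "hscale H" "(*) :: 'k \<Rightarrow> 'k \<Rightarrow> 'k" by unfold_locales
  show ?thesis
    unfolding linear_form_def Vector_Spaces.linear_def module_hom_def module_hom_axioms_def
    using vs.vector_space_axioms f.vector_space_axioms vs.module_axioms f.module_axioms by blast
qed

lemma linear_form_add: "linear_form H f \<Longrightarrow> f (x + y) = f x + f y"
  and linear_form_scale: "linear_form H f \<Longrightarrow> f (c *\<^sub>H x) = c * f x"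
  by (simp_all add: linear_form_iff)

lemma linear_form_zero: "linear_form H f \<Longrightarrow> f 0 = 0"
  using linear_form_scale[of f 0 0] by simp

lemma linear_form_sum: "linear_form H f \<Longrightarrow> f (\<Sum>i\<in>I. g i) = (\<Sum>i\<in>I. f (g i))"
  by (induction I rule: infinite_finite_induct) (simp_all add: linear_form_zero linear_form_add)

lemma linear_form_sum_list: "linear_form H f \<Longrightarrow> f (\<Sum>i\<leftarrow>xs. g i) = (\<Sum>i\<leftarrow>xs. f (g i))"
  by (induction xs) (simp_all add: linear_form_zero linear_form_add)

lemma ant_add: "ant (x + y) = ant x + ant y"
  and ant_scale: "ant (c *\<^sub>H x) = c *\<^sub>H ant x"
proof -
  have "module_hom (hscale H) (hscale H) ant"
    using antipode_linear by (simp add: Vector_Spaces.linear_def)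
  then show "ant (x + y) = ant x + ant y" "ant (c *\<^sub>H x) = c *\<^sub>H ant x"
    by (simp_all add: module_hom.add module_hom.scale)
qed

lemma eps_add: "eps (x + y) = eps x + eps y"
  and eps_scale: "eps (c *\<^sub>H x) = c * eps x"
  using counit_linear by (simp_all add: linear_form_iff)

lemmas linear_simps = linear_form_iff bilinear_form_def trilinear_form_def
  ant_add ant_scale eps_add eps_scale distrib_left distrib_right scale_mult_left scale_mult_right
  cosum_add cosum_mult_left

text \<open>The coproduct is not linear as a function to lists; linearity appears only after pairing
  with a bilinear form.\<close>

lemma cosum_linear: "bilinear_form H \<beta> \<Longrightarrow> linear_form H (\<lambda>x. cosum H x \<beta>)"
proof -
  assume \<beta>: "bilinear_form H \<beta>"
  have "cosum H (x + y) \<beta> = cosum H x \<beta> + cosum H y \<beta>" for x y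
    using comult_add[of x y] \<beta> by (simp add: tensor2_eq_def cosum_def)
  moreover have "cosum H (c *\<^sub>H x) \<beta> = c * cosum H x \<beta>" for c x
  proof -
    have "cosum H (c *\<^sub>H x) \<beta> = (\<Sum>(a, b)\<leftarrow>comult H x. \<beta> (c *\<^sub>H a) b)"
      using comult_scale[of c x] \<beta> by (simp add: tensor2_eq_def cosum_def case_prod_unfold comp_def)
    also have "\<dots> = c * cosum H x \<beta>"
      using \<beta> by (simp add: linear_simps cosum_def case_prod_unfold sum_list_const_mult)
    finally show ?thesis .
  qed
  ultimately show ?thesis by (simp add: linear_form_iff)
qed

lemmas cosum_arg_add = linear_form_add[OF cosum_linear]
lemmas cosum_arg_scale = linear_form_scale[OF cosum_linear]

lemma cosum_coassoc:
  assumes "trilinear_form H \<tau>"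
  shows "cosum H x (\<lambda>a b. cosum H a (\<lambda>u v. \<tau> u v b)) = cosum H x (\<lambda>a b. cosum H b (\<lambda>u v. \<tau> a u v))"
  using coassoc[of x] assms
  by (simp add: tensor3_eq_def cosum_def case_prod_unfold sum_list_concat_map comp_def)

lemma cosum_counit_left: "linear_form H \<phi> \<Longrightarrow> cosum H x (\<lambda>a b. eps a * \<phi> b) = \<phi> x"
proof -
  assume \<phi>: "linear_form H \<phi>"
  have "cosum H x (\<lambda>a b. eps a * \<phi> b) = \<phi> (\<Sum>(a, b)\<leftarrow>comult H x. eps a *\<^sub>H b)"
    by (simp add: cosum_def case_prod_unfold linear_form_sum_list[OF \<phi>] linear_form_scale[OF \<phi>])
  then show ?thesis by (simp add: counit_left)
qed

lemma cosum_counit_right: "linear_form H \<phi> \<Longrightarrow> cosum H x (\<lambda>a b. eps b * \<phi> a) = \<phi> x"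
proof -
  assume \<phi>: "linear_form H \<phi>"
  have "cosum H x (\<lambda>a b. eps b * \<phi> a) = \<phi> (\<Sum>(a, b)\<leftarrow>comult H x. eps b *\<^sub>H a)"
    by (simp add: cosum_def case_prod_unfold linear_form_sum_list[OF \<phi>] linear_form_scale[OF \<phi>])
  then show ?thesis by (simp add: counit_right)
qed

lemma cosum_mult:
  "bilinear_form H \<beta> \<Longrightarrow> cosum H (x * y) \<beta> = cosum H x (\<lambda>a b. cosum H y (\<lambda>c d. \<beta> (a * c) (b * d)))"
  using comult_mult[of x y]
  by (simp add: tensor2_eq_def cosum_def case_prod_unfold sum_list_concat_map comp_def)

lemma cosum_one: "bilinear_form H \<beta> \<Longrightarrow> cosum H 1 \<beta> = \<beta> 1 1"
  using comult_one by (simp add: tensor2_eq_def cosum_def)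

lemma cosum_antipode_left: "linear_form H \<phi> \<Longrightarrow> cosum H x (\<lambda>a b. \<phi> (ant a * b)) = eps x * \<phi> 1"
proof -
  assume \<phi>: "linear_form H \<phi>"
  have "cosum H x (\<lambda>a b. \<phi> (ant a * b)) = \<phi> (\<Sum>(a, b)\<leftarrow>comult H x. ant a * b)"
    by (simp add: cosum_def case_prod_unfold linear_form_sum_list[OF \<phi>])
  then show ?thesis by (simp add: antipode_left linear_form_scale[OF \<phi>])
qed

lemma cosum_antipode_right: "linear_form H \<phi> \<Longrightarrow> cosum H x (\<lambda>a b. \<phi> (a * ant b)) = eps x * \<phi> 1"
proof -
  assume \<phi>: "linear_form H \<phi>"
  have "cosum H x (\<lambda>a b. \<phi> (a * ant b)) = \<phi> (\<Sum>(a, b)\<leftarrow>comult H x. a * ant b)"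
    by (simp add: cosum_def case_prod_unfold linear_form_sum_list[OF \<phi>])
  then show ?thesis by (simp add: antipode_right linear_form_scale[OF \<phi>])
qed

section \<open>Separation of points by linear forms, and the antipode as an
  anti-homomorphism\<close>

lemma linear_form_extend:
  assumes "vs.independent C"
  shows "\<exists>f. linear_form H f \<and> (\<forall>x\<in>C. f x = g x)"
proof -
  interpret f: vector_space "(*) :: 'k \<Rightarrow> 'k \<Rightarrow> 'k" by (rule field_vector_space)
  interpret p: vector_space_pair "hscale H" "(*) :: 'k \<Rightarrow> 'k \<Rightarrow> 'k" by unfold_locales
  show ?thesis using p.linear_independent_extend[OF assms, of g] unfolding linear_form_def by blast
qed

text \<open>A basis of \<open>V\<close> together with \<open>x\<close> is independent, so a form can
  be prescribed to be \<open>1\<close> at \<open>x\<close> and \<open>0\<close> on that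
  basis.\<close>

lemma linear_form_separates:
  assumes V: "vs.subspace V" and x: "x \<notin> V"
  shows "\<exists>f. linear_form H f \<and> f x \<noteq> 0 \<and> (\<forall>y\<in>V. f y = 0)"
proof -
  obtain C where C: "C \<subseteq> V" "vs.independent C" "V \<subseteq> vs.span C"
    using vs.maximal_independent_subset[of V] by blast
  have xC: "x \<notin> vs.span C" using C(1) V x vs.span_minimal by blast
  then have "vs.independent (insert x C)" using C(2) by (simp add: vs.independent_insertI)
  then obtain f where f: "linear_form H f" "\<forall>y\<in>insert x C. f y = (if y = x then 1 else 0)"
    using linear_form_extend[of "insert x C" "\<lambda>y. if y = x then 1 else 0"] by blast
  have "f y = 0" if "y \<in> vs.span C" for y
    using that
  proof (induction rule: vs.span_induct_alt)
    case (step c y z)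
    have "y \<noteq> x" using step(1) xC vs.span_base by blast
    then show ?case using step f(2) by (simp add: linear_form_add[OF f(1)] linear_form_scale[OF f(1)])
  qed (simp add: linear_form_zero[OF f(1)])
  then show ?thesis using f C(3) by (intro exI[of _ f]) auto
qed

text \<open>Reduces identities in \<open>H\<close> to scalar ones, to which the rules for
  \<open>cosum\<close> apply.\<close>

lemma linear_form_eqI:
  assumes "\<And>f. linear_form H f \<Longrightarrow> f x = f y"
  shows "x = y"
proof (rule ccontr)
  assume "x \<noteq> y"
  then have "x - y \<notin> {0}" by simp
  then obtain f where f: "linear_form H f" "f (x - y) \<noteq> 0"
    using linear_form_separates[OF vs.subspace_single_0] by blast
  have "f x = f ((x - y) + y)" by simp
  then show False using assms[OF f(1)] f by (simp only: linear_form_add[OF f(1)]) simp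
qed

lemma ant_one: "ant 1 = 1"
proof (rule linear_form_eqI)
  fix \<phi> assume \<phi>: "linear_form H \<phi>"
  have "cosum H 1 (\<lambda>a b. \<phi> (ant a * b)) = \<phi> (ant 1)"
    using cosum_one[of "\<lambda>a b. \<phi> (ant a * b)"] \<phi> by (simp add: linear_simps)
  then show "\<phi> (ant 1) = \<phi> 1" using cosum_antipode_left[OF \<phi>, of 1] by (simp add: counit_one)
qed

text \<open>Both sides equal \<open>\<Sum> S(x\<^sub>1 y\<^sub>1) x\<^sub>2 y\<^sub>2 S(y\<^sub>3) S(x\<^sub>3)\<close>.\<close>

lemma ant_mult: "ant (x * y) = ant y * ant x"
proof (rule linear_form_eqI)
  fix \<phi> assume \<phi>: "linear_form H \<phi>"
  note [simp] = linear_simps \<phi>[unfolded linear_form_iff]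
  let ?F = "\<lambda>a a' c c' d b. \<phi> (ant (a * c) * a' * c' * ant d * ant b)"
  have "\<phi> (ant y * ant x) = cosum H x (\<lambda>a b. eps a * \<phi> (ant y * ant b))"
    by (rule cosum_counit_left[symmetric]) simp
  also have "\<dots> = cosum H x (\<lambda>a b. eps a * cosum H y (\<lambda>c d. eps c * \<phi> (ant d * ant b)))"
    by (subst cosum_counit_left) simp_all
  also have "\<dots> = cosum H x (\<lambda>a b. cosum H y (\<lambda>c d. cosum H (a * c) (\<lambda>u v. \<phi> (ant u * v * (ant d * ant b)))))"
  proof -
    have "cosum H (a * c) (\<lambda>u v. \<phi> (ant u * v * (ant d * ant b))) = eps a * (eps c * \<phi> (ant d * ant b))" for a b c d
      using cosum_antipode_left[of "\<lambda>z. \<phi> (z * (ant d * ant b))" "a * c"] by (simp add: counit_mult)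
    then show ?thesis by simp
  qed
  also have "\<dots> = cosum H x (\<lambda>a b. cosum H y (\<lambda>c d. cosum H a (\<lambda>a a'. cosum H c (\<lambda>c c'. ?F a a' c c' d b))))"
    by (subst cosum_mult) (simp_all add: mult.assoc)
  also have "\<dots> = cosum H x (\<lambda>a b. cosum H a (\<lambda>a a'. cosum H y (\<lambda>c d. cosum H c (\<lambda>c c'. ?F a a' c c' d b))))"
    by (subst cosum_swap) simp
  also have "\<dots> = cosum H x (\<lambda>a b. cosum H a (\<lambda>a a'. cosum H y (\<lambda>c d. cosum H d (\<lambda>c' d. ?F a a' c c' d b))))"
    by (subst cosum_coassoc) (simp_all add: trilinear_form_def)
  also have "\<dots> = cosum H x (\<lambda>a b. cosum H a (\<lambda>a a'. cosum H y (\<lambda>c d. eps d * \<phi> (ant (a * c) * a' * ant b))))"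
  proof -
    have "cosum H d (\<lambda>c' d. ?F a a' c c' d b) = eps d * \<phi> (ant (a * c) * a' * ant b)" for a a' c d b
      using cosum_antipode_right[of "\<lambda>z. \<phi> (ant (a * c) * a' * z * ant b)" d] by (simp add: mult.assoc)
    then show ?thesis by simp
  qed
  also have "\<dots> = cosum H x (\<lambda>a b. cosum H a (\<lambda>a a'. \<phi> (ant (a * y) * a' * ant b)))"
    by (subst cosum_counit_right) simp_all
  also have "\<dots> = cosum H x (\<lambda>a b. cosum H b (\<lambda>a' b. \<phi> (ant (a * y) * a' * ant b)))"
    by (subst cosum_coassoc) simp_all
  also have "\<dots> = cosum H x (\<lambda>a b. eps b * \<phi> (ant (a * y)))"
  proof -
    have "cosum H b (\<lambda>a' b. \<phi> (ant (a * y) * a' * ant b)) = eps b * \<phi> (ant (a * y))" for a b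
      using cosum_antipode_right[of "\<lambda>z. \<phi> (ant (a * y) * z)" b] by (simp add: mult.assoc)
    then show ?thesis by simp
  qed
  also have "\<dots> = \<phi> (ant (x * y))"
    by (subst cosum_counit_right) simp_all
  finally show "\<phi> (ant (x * y)) = \<phi> (ant y * ant x)" by simp
qed

end

section \<open>Integrals and surjectivity of the antipode\<close>

context fin_dim_hopf_algebra
begin

interpretation vs: vector_space "hscale H"
  by (rule hopf_vector_space)

text \<open>The scalars \<open>r x b\<close> are the coordinates of \<open>x\<close>. With them the
  trace of an endomorphism \<open>f\<close> of \<open>H\<close> is the sum of
  \<open>r (f b) b\<close>, the form in which traces enter the construction of an integral.\<close>

lemma ex_dual_bases:
  obtains B :: "'h set" and r :: "'h \<Rightarrow> 'h \<Rightarrow> 'k"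
  where "finite B" "\<And>b. linear_form H (\<lambda>x. r x b)" "\<And>x. x = (\<Sum>b\<in>B. r x b *\<^sub>H b)"
proof -
  obtain B where "finite_dimensional_vector_space (hscale H) B" using fin_dim by blast
  then interpret fd: finite_dimensional_vector_space "hscale H" B .
  have x: "x \<in> vs.span B" for x using fd.span_Basis by simp
  show ?thesis
  proof (rule that[of B "\<lambda>x. vs.representation B x"])
    show "finite B" by (rule fd.finite_Basis)
    show "linear_form H (\<lambda>x. vs.representation B x b)" for b
      using x fd.independent_Basis
      by (auto simp: linear_form_iff vs.representation_add vs.representation_scale)
    show "x = (\<Sum>b\<in>B. vs.representation B x b *\<^sub>H b)" for x
      using vs.sum_representation_eq[OF fd.independent_Basis x fd.finite_Basis] by simp
  qed
qed

text \<open>The element \<open>t\<close> is the partial trace of \<open>y \<mapsto> \<Sum> y\<^sub>1 \<otimes> S\<^sup>2(y\<^sub>2) h\<close> for a suitable \<open>h\<close>.\<close>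

theorem ex_left_integral: "\<exists>t. t \<noteq> 0 \<and> (\<forall>x. x * t = eps x *\<^sub>H t)"
proof -
  obtain B and r :: "'h \<Rightarrow> 'h \<Rightarrow> 'k" where B: "finite B" and r: "\<And>b. linear_form H (\<lambda>x. r x b)"
    and exp: "\<And>x. x = (\<Sum>b\<in>B. r x b *\<^sub>H b)"
    using ex_dual_bases by blast
  have exp_form: "\<phi> x = (\<Sum>b\<in>B. r x b * \<phi> b)" if \<phi>: "linear_form H \<phi>" for \<phi> x
  proof -
    have "\<phi> x = \<phi> (\<Sum>b\<in>B. r x b *\<^sub>H b)" using exp by simp
    then show ?thesis by (simp add: linear_form_sum[OF \<phi>] linear_form_scale[OF \<phi>])
  qed
  note r' = r[unfolded linear_form_iff, THEN conjunct1, rule_format]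
    r[unfolded linear_form_iff, THEN conjunct2, rule_format]
  define T where "T h = (\<Sum>b\<in>B. \<Sum>(u, v)\<leftarrow>comult H b. r (ant (ant v) * h) b *\<^sub>H u)" for h
  have T: "\<phi> (T h) = (\<Sum>b\<in>B. cosum H b (\<lambda>u v. \<phi> u * r (ant (ant v) * h) b))"
    if \<phi>: "linear_form H \<phi>" for \<phi> h
    by (simp add: T_def cosum_def linear_form_sum[OF \<phi>] linear_form_sum_list[OF \<phi>] case_prod_unfold
        linear_form_scale[OF \<phi>] mult.commute)
  have T_left: "x * T h = eps x *\<^sub>H T h" for x h
  proof (rule linear_form_eqI)
    fix \<phi> assume \<phi>: "linear_form H \<phi>"
    note [simp] = linear_simps \<phi>[unfolded linear_form_iff] r'
    \<comment> \<open>The sum of \<open>f(y_1) S^2(y_2) h\<close>. As an endomorphism in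
      \<open>y\<close> it has the trace \<open>f (T h)\<close>, by the formula \<open>T\<close>,
      whenever \<open>f\<close> is linear.\<close>
    define G where "G f y = (\<Sum>(u, v)\<leftarrow>comult H y. f u *\<^sub>H (ant (ant v) * h))" for f y
    have G: "\<psi> (G f y) = cosum H y (\<lambda>u v. f u * \<psi> (ant (ant v) * h))" if \<psi>: "linear_form H \<psi>" for \<psi> f y
      by (simp add: G_def cosum_def linear_form_sum_list[OF \<psi>] case_prod_unfold linear_form_scale[OF \<psi>])
    \<comment> \<open>Multiplication by \<open>x\<close> is taken out of the form: on the right-hand
      side the factors \<open>S(x_3) S^2(x_2) = S(S(x_2) x_3)\<close> collapse to the counit and
      leave \<open>\<phi>(x y_1)\<close>.\<close>
    have shift: "\<psi> (G (\<lambda>u. \<phi> (x * u)) y) = cosum H x (\<lambda>p q. \<psi> (ant q * G \<phi> (p * y)))"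
      if \<psi>: "linear_form H \<psi>" for \<psi> y
    proof -
      note [simp] = \<psi>[unfolded linear_form_iff]
      have "cosum H x (\<lambda>p q. \<psi> (ant q * G \<phi> (p * y)))
          = cosum H x (\<lambda>p q. cosum H (p * y) (\<lambda>u v. \<phi> u * \<psi> (ant q * (ant (ant v) * h))))"
        by (subst G) simp_all
      also have "\<dots> = cosum H x (\<lambda>p q. cosum H p (\<lambda>p q'. cosum H y (\<lambda>u v.
          \<phi> (p * u) * \<psi> (ant q * (ant (ant q') * (ant (ant v) * h))))))"
        by (subst cosum_mult) (simp_all add: ant_mult mult.assoc algebra_simps)
      also have "\<dots> = cosum H x (\<lambda>p q. cosum H q (\<lambda>q' q. cosum H y (\<lambda>u v.
          \<phi> (p * u) * \<psi> (ant q * (ant (ant q') * (ant (ant v) * h))))))"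
        by (subst cosum_coassoc) (simp_all add: algebra_simps)
      also have "\<dots> = cosum H x (\<lambda>p q. eps q * cosum H y (\<lambda>u v. \<phi> (p * u) * \<psi> (ant (ant v) * h)))"
      proof -
        have "cosum H q (\<lambda>q' q. cosum H y (\<lambda>u v. \<phi> (p * u) * \<psi> (ant q * (ant (ant q') * (ant (ant v) * h)))))
            = eps q * cosum H y (\<lambda>u v. \<phi> (p * u) * \<psi> (ant (ant v) * h))" for p q
          using cosum_antipode_left[of "\<lambda>z. cosum H y (\<lambda>u v. \<phi> (p * u) * \<psi> (ant z * (ant (ant v) * h)))" q]
          by (simp add: ant_mult ant_one mult.assoc algebra_simps)
        then show ?thesis by simp
      qed
      also have "\<dots> = cosum H y (\<lambda>u v. \<phi> (x * u) * \<psi> (ant (ant v) * h))"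
        by (subst cosum_counit_right) (simp_all add: algebra_simps)
      finally show ?thesis by (simp add: G[OF \<psi>])
    qed
    have Gadd: "G \<phi> (y + z) = G \<phi> y + G \<phi> z" for y z
    proof (rule linear_form_eqI)
      fix \<psi> assume \<psi>: "linear_form H \<psi>"
      note [simp] = \<psi>[unfolded linear_form_iff]
      have "bilinear_form H (\<lambda>u v. \<phi> u * \<psi> (ant (ant v) * h))" by (simp add: algebra_simps)
      from cosum_arg_add[OF this] show "\<psi> (G \<phi> (y + z)) = \<psi> (G \<phi> y + G \<phi> z)"
        by (simp add: G[OF \<psi>])
    qed
    have Gscale: "G \<phi> (c *\<^sub>H y) = c *\<^sub>H G \<phi> y" for c y
    proof (rule linear_form_eqI)
      fix \<psi> assume \<psi>: "linear_form H \<psi>"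
      note [simp] = \<psi>[unfolded linear_form_iff]
      have "bilinear_form H (\<lambda>u v. \<phi> u * \<psi> (ant (ant v) * h))" by (simp add: algebra_simps)
      from cosum_arg_scale[OF this] show "\<psi> (G \<phi> (c *\<^sub>H y)) = \<psi> (c *\<^sub>H G \<phi> y)"
        by (simp add: G[OF \<psi>])
    qed
    \<comment> \<open>Cyclicity of the trace, written in coordinates. Together with a second
      rotation below it turns \<open>S(x_2) G(x_1 y)\<close> into \<open>G(x_1 S(x_2) y)\<close>,
      where the antipode axiom produces \<open>eps x\<close>.\<close>
    have trace: "(\<Sum>b\<in>B. r (z * G \<phi> b) b) = (\<Sum>b\<in>B. r (G \<phi> (z * b)) b)" for z
    proof -
      have "(\<Sum>b\<in>B. r (z * G \<phi> b) b) = (\<Sum>b\<in>B. \<Sum>c\<in>B. r (G \<phi> b) c * r (z * c) b)"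
        by (intro sum.cong refl exp_form) simp
      also have "\<dots> = (\<Sum>c\<in>B. \<Sum>b\<in>B. r (z * c) b * r (G \<phi> b) c)"
        by (subst sum.swap) (simp add: mult.commute)
      also have "\<dots> = (\<Sum>c\<in>B. r (G \<phi> (z * c)) c)"
        by (intro sum.cong refl exp_form[symmetric]) (simp add: Gadd Gscale)
      finally show ?thesis .
    qed
    have \<phi>x: "linear_form H (\<lambda>u. \<phi> (x * u))" by simp
    have "\<phi> (x * T h) = (\<Sum>b\<in>B. r (G (\<lambda>u. \<phi> (x * u)) b) b)"
      by (simp only: T[OF \<phi>x] G[OF r])
    also have "\<dots> = (\<Sum>b\<in>B. cosum H x (\<lambda>p q. r (ant q * G \<phi> (p * b)) b))"
      by (simp only: shift[OF r])
    also have "\<dots> = cosum H x (\<lambda>p q. \<Sum>b\<in>B. r (ant q * G \<phi> (p * b)) b)"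
      by (simp add: cosum_sum)
    also have "\<dots> = cosum H x (\<lambda>p q. \<Sum>b\<in>B. r (G \<phi> ((p * ant q) * b)) b)"
    proof -
      have "(\<Sum>b\<in>B. r (ant q * G \<phi> (p * b)) b) = (\<Sum>b\<in>B. r (G \<phi> ((p * ant q) * b)) b)" for p q
      proof -
        have "(\<Sum>b\<in>B. r (ant q * G \<phi> (p * b)) b) = (\<Sum>b\<in>B. \<Sum>c\<in>B. r (p * b) c * r (ant q * G \<phi> c) b)"
          by (intro sum.cong refl exp_form) (simp add: Gadd Gscale)
        also have "\<dots> = (\<Sum>c\<in>B. \<Sum>b\<in>B. r (ant q * G \<phi> c) b * r (p * b) c)"
          by (subst sum.swap) (simp add: mult.commute)
        also have "\<dots> = (\<Sum>c\<in>B. r ((p * ant q) * G \<phi> c) c)"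
        proof (intro sum.cong refl)
          fix c
          have "linear_form H (\<lambda>z. r (p * z) c)" by simp
          from exp_form[OF this, of "ant q * G \<phi> c"]
          show "(\<Sum>b\<in>B. r (ant q * G \<phi> c) b * r (p * b) c) = r ((p * ant q) * G \<phi> c) c"
            by (simp add: mult.assoc)
        qed
        finally show ?thesis using trace by simp
      qed
      then show ?thesis by simp
    qed
    also have "\<dots> = eps x * (\<Sum>b\<in>B. r (G \<phi> (1 * b)) b)"
      by (rule cosum_antipode_right[of "\<lambda>z. \<Sum>b\<in>B. r (G \<phi> (z * b)) b"])
        (simp add: Gadd Gscale sum.distrib sum_distrib_left)
    also have "\<dots> = eps x * \<phi> (T h)"
      by (simp only: T[OF \<phi>] G[OF r] mult_1_left)
    finally show "\<phi> (x * T h) = \<phi> (eps x *\<^sub>H T h)" by simp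
  qed
  \<comment> \<open>If all \<open>T h\<close> vanished, \<open>h\<close> could be replaced by
    \<open>S(b_2)\<close> inside the trace, after expanding it in the basis. Then
    \<open>S^2(b_3) S(b_2) = S(b_2 S(b_3))\<close> collapses, and what remains is the counit at
    \<open>1\<close>.\<close>
  have "\<exists>h. T h \<noteq> 0"
  proof (rule ccontr)
    assume "\<not> ?thesis"
    then have T0: "T h = 0" for h by simp
    have z: "(\<Sum>b\<in>B. cosum H b (\<lambda>u v. \<phi> u * r (ant (ant v) * h) b)) = 0" if "linear_form H \<phi>" for \<phi> h
      using T[OF that, of h] linear_form_zero[OF that] by (simp add: T0)
    have eps_lin: "linear_form H eps" by (rule counit_linear)
    note [simp] = linear_simps r'
    have "(\<Sum>b\<in>B. cosum H b (\<lambda>u v. cosum H u (\<lambda>u w. eps u * r (ant (ant v) * ant w) b)))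
        = (\<Sum>b\<in>B. cosum H b (\<lambda>u v. \<Sum>c\<in>B. cosum H u (\<lambda>u w. eps u * r (ant w) c) * r (ant (ant v) * c) b))"
    proof (intro sum.cong refl arg_cong[where f = "cosum H _"] ext)
      fix b u v
      have "cosum H u (\<lambda>u w. eps u * r (ant (ant v) * ant w) b)
          = cosum H u (\<lambda>u w. \<Sum>c\<in>B. eps u * r (ant w) c * r (ant (ant v) * c) b)"
        by (subst exp_form[of "\<lambda>z. r (ant (ant v) * z) b"]) (simp_all add: sum_distrib_left mult.assoc)
      then show "cosum H u (\<lambda>u w. eps u * r (ant (ant v) * ant w) b) =
          (\<Sum>c\<in>B. cosum H u (\<lambda>u w. eps u * r (ant w) c) * r (ant (ant v) * c) b)"
        by (simp add: cosum_sum cosum_mult_right)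
    qed
    also have "\<dots> = (\<Sum>c\<in>B. \<Sum>b\<in>B. cosum H b (\<lambda>u v. cosum H u (\<lambda>u w. eps u * r (ant w) c) * r (ant (ant v) * c) b))"
      unfolding cosum_sum by (rule sum.swap)
    also have "\<dots> = 0"
    proof (rule sum.neutral, rule ballI)
      fix c
      have "linear_form H (\<lambda>u. cosum H u (\<lambda>u w. eps u * r (ant w) c))"
        by (rule cosum_linear) (simp add: algebra_simps)
      from z[OF this, of c]
      show "(\<Sum>b\<in>B. cosum H b (\<lambda>u v. cosum H u (\<lambda>u w. eps u * r (ant w) c) * r (ant (ant v) * c) b)) = 0"
        by simp
    qed
    finally have 0: "(\<Sum>b\<in>B. cosum H b (\<lambda>u v. cosum H u (\<lambda>u w. eps u * r (ant (ant v) * ant w) b))) = 0" .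
    have "cosum H b (\<lambda>u v. cosum H u (\<lambda>u w. eps u * r (ant (ant v) * ant w) b)) = eps b * r 1 b" for b
    proof -
      have "cosum H b (\<lambda>u v. cosum H u (\<lambda>u w. eps u * r (ant (ant v) * ant w) b))
          = cosum H b (\<lambda>u v. cosum H v (\<lambda>w v. eps u * r (ant (w * ant v)) b))"
        by (subst cosum_coassoc) (simp_all add: ant_mult algebra_simps)
      also have "\<dots> = cosum H b (\<lambda>u v. eps v * (eps u * r 1 b))"
      proof -
        have "cosum H v (\<lambda>w v. eps u * r (ant (w * ant v)) b) = eps v * (eps u * r 1 b)" for u v
          using cosum_antipode_right[of "\<lambda>z. eps u * r (ant z) b" v] by (simp add: ant_one algebra_simps)
        then show ?thesis by (simp only:)
      qed
      also have "\<dots> = eps b * r 1 b" by (subst cosum_counit_right) (simp_all add: algebra_simps)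
      finally show ?thesis .
    qed
    then have "(\<Sum>b\<in>B. r 1 b * eps b) = 0" using 0 by (simp add: mult.commute)
    then have "eps 1 = 0" using exp_form[OF eps_lin, of 1] by simp
    then show False by (simp add: counit_one)
  qed
  then show ?thesis using T_left by blast
qed

text \<open>A left integral satisfies \<open>\<Sum> x t\<^sub>1 \<otimes> S(t\<^sub>2) = \<Sum> t\<^sub>1 \<otimes> S(t\<^sub>2) x\<close>. If a linear form \<open>a\<close> vanishes on
  the image of \<open>S\<close>, then \<open>\<Sum> t\<^sub>1 a(S(t\<^sub>2) x) = 0\<close> for all \<open>x\<close>, and choosing \<open>x\<close> to contain \<open>S\<^sup>2\<close> of the
  second component of \<open>\<Delta>(t\<^sub>1)\<close> collapses this to \<open>t a(z) = 0\<close>.\<close>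

theorem surj_antipode: "surj ant"
proof (rule ccontr)
  assume "\<not> surj ant"
  then obtain z where z: "z \<notin> range ant" by blast
  have "vs.subspace (range ant)"
  proof (rule vs.subspaceI)
    show "0 \<in> range ant" using ant_add[of 0 0] by (intro image_eqI[of _ _ 0]) auto
    show "x + y \<in> range ant" if "x \<in> range ant" "y \<in> range ant" for x y
      using that by (auto simp flip: ant_add)
    show "c *\<^sub>H x \<in> range ant" if "x \<in> range ant" for c x
      using that by (auto simp flip: ant_scale)
  qed
  from linear_form_separates[OF this z] obtain a where a: "linear_form H a" "a z \<noteq> 0" "\<And>y. a (ant y) = 0"
    by auto
  obtain t where t: "t \<noteq> 0" "\<And>x. x * t = eps x *\<^sub>H t" using ex_left_integral by blast
  obtain \<phi> where \<phi>: "linear_form H \<phi>" "\<phi> t \<noteq> 0"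
    using linear_form_separates[OF vs.subspace_single_0, of t] t(1) by auto
  note [simp] = linear_simps
  have shift: "cosum H t (\<lambda>p q. \<beta> (x * p) (ant q)) = cosum H t (\<lambda>p q. \<beta> p (ant q * x))"
    if \<beta>: "bilinear_form H \<beta>" for \<beta> x
  proof -
    note [simp] = \<beta>[unfolded bilinear_form_def linear_form_iff, THEN conjunct1, rule_format, THEN conjunct1, rule_format]
      \<beta>[unfolded bilinear_form_def linear_form_iff, THEN conjunct1, rule_format, THEN conjunct2, rule_format]
      \<beta>[unfolded bilinear_form_def linear_form_iff, THEN conjunct2, rule_format, THEN conjunct1, rule_format]
      \<beta>[unfolded bilinear_form_def linear_form_iff, THEN conjunct2, rule_format, THEN conjunct2, rule_format]
    have "cosum H t (\<lambda>p q. \<beta> p (ant q * x)) = cosum H x (\<lambda>u v. eps u * cosum H t (\<lambda>p q. \<beta> p (ant q * v)))"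
      by (subst cosum_counit_left) simp_all
    also have "\<dots> = cosum H x (\<lambda>u v. cosum H (u * t) (\<lambda>p q. \<beta> p (ant q * v)))"
      unfolding t(2) by (subst cosum_arg_scale) simp_all
    also have "\<dots> = cosum H x (\<lambda>u v. cosum H u (\<lambda>u w. cosum H t (\<lambda>p q. \<beta> (u * p) (ant q * (ant w * v)))))"
      by (subst cosum_mult) (simp_all add: ant_mult mult.assoc)
    also have "\<dots> = cosum H x (\<lambda>u v. cosum H v (\<lambda>w v. cosum H t (\<lambda>p q. \<beta> (u * p) (ant q * (ant w * v)))))"
      by (subst cosum_coassoc) simp_all
    also have "\<dots> = cosum H x (\<lambda>u v. eps v * cosum H t (\<lambda>p q. \<beta> (u * p) (ant q)))"
    proof -
      have "cosum H v (\<lambda>w v. cosum H t (\<lambda>p q. \<beta> (u * p) (ant q * (ant w * v)))) =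
          eps v * cosum H t (\<lambda>p q. \<beta> (u * p) (ant q))" for u v
        using cosum_antipode_left[of "\<lambda>z. cosum H t (\<lambda>p q. \<beta> (u * p) (ant q * z))" v] by simp
      then show ?thesis by simp
    qed
    also have "\<dots> = cosum H t (\<lambda>p q. \<beta> (x * p) (ant q))"
      by (subst cosum_counit_right) simp_all
    finally show ?thesis by simp
  qed
  have star: "cosum H t (\<lambda>p q. \<psi> p * a (ant q * x)) = 0" if \<psi>: "linear_form H \<psi>" for \<psi> x
    using shift[of "\<lambda>p s. \<psi> p * a s" x] \<psi> a(1)
    by (simp add: a(3) cosum_zero algebra_simps)
  obtain B and r :: "'h \<Rightarrow> 'h \<Rightarrow> 'k" where B: "finite B" and r: "\<And>b. linear_form H (\<lambda>x. r x b)"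
    and exp: "\<And>x. x = (\<Sum>b\<in>B. r x b *\<^sub>H b)"
    using ex_dual_bases by blast
  note [simp] = r[unfolded linear_form_iff, THEN conjunct1, rule_format]
    r[unfolded linear_form_iff, THEN conjunct2, rule_format]
    \<phi>(1)[unfolded linear_form_iff] a(1)[unfolded linear_form_iff]
  \<comment> \<open>\<open>star\<close> holds for a fixed \<open>x\<close>, whereas
    \<open>S^2(w) z\<close> depends on a component of the coproduct; expanding it in a basis reduces
    to fixed arguments.\<close>
  have exp_form: "a (y * x) = (\<Sum>b\<in>B. r x b * a (y * b))" for x y
  proof -
    have l: "linear_form H (\<lambda>x. a (y * x))" by simp
    have "a (y * x) = a (y * (\<Sum>b\<in>B. r x b *\<^sub>H b))" using exp by simp
    also have "\<dots> = (\<Sum>b\<in>B. r x b * a (y * b))"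
      using linear_form_sum[OF l, of "\<lambda>b. r x b *\<^sub>H b" B] by simp
    finally show ?thesis .
  qed
  have "cosum H t (\<lambda>p q. cosum H p (\<lambda>p w. \<phi> p * a (ant q * (ant (ant w) * z))))
      = cosum H t (\<lambda>p q. \<Sum>b\<in>B. cosum H p (\<lambda>p w. \<phi> p * r (ant (ant w) * z) b) * a (ant q * b))"
  proof (intro arg_cong[where f = "cosum H _"] ext)
    fix p q
    have "cosum H p (\<lambda>p w. \<phi> p * a (ant q * (ant (ant w) * z)))
        = cosum H p (\<lambda>p w. \<Sum>b\<in>B. \<phi> p * r (ant (ant w) * z) b * a (ant q * b))"
      by (subst exp_form) (simp add: sum_distrib_left mult.assoc)
    then show "cosum H p (\<lambda>p w. \<phi> p * a (ant q * (ant (ant w) * z))) =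
        (\<Sum>b\<in>B. cosum H p (\<lambda>p w. \<phi> p * r (ant (ant w) * z) b) * a (ant q * b))"
      by (simp add: cosum_sum cosum_mult_right)
  qed
  also have "\<dots> = 0"
    unfolding cosum_sum
  proof (intro sum.neutral ballI)
    fix b
    have "linear_form H (\<lambda>p. cosum H p (\<lambda>p w. \<phi> p * r (ant (ant w) * z) b))"
      by (rule cosum_linear) (simp add: algebra_simps)
    from star[OF this]
    show "cosum H t (\<lambda>p q. cosum H p (\<lambda>p w. \<phi> p * r (ant (ant w) * z) b) * a (ant q * b)) = 0" .
  qed
  finally have 0: "cosum H t (\<lambda>p q. cosum H q (\<lambda>w q. \<phi> p * a (ant q * (ant (ant w) * z)))) = 0"
    by (subst (asm) cosum_coassoc) (simp_all add: algebra_simps)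
  have "cosum H q (\<lambda>w q. \<phi> p * a (ant q * (ant (ant w) * z))) = eps q * (\<phi> p * a z)" for p q
    using cosum_antipode_left[of "\<lambda>s. \<phi> p * a (ant s * z)" q]
    by (simp add: ant_mult ant_one mult.assoc algebra_simps)
  with 0 have "cosum H t (\<lambda>p q. eps q * (\<phi> p * a z)) = 0" by (simp only:)
  moreover have "cosum H t (\<lambda>p q. eps q * (\<phi> p * a z)) = \<phi> t * a z"
    by (rule cosum_counit_right) (simp add: algebra_simps)
  ultimately show False using \<phi>(2) a(2) by simp
qed

end

section \<open>Dual modules and tensor products\<close>

lemma mat_transpose_mult: "dim_col A = dim_row B \<Longrightarrow> transpose_mat (A * B) = transpose_mat B * transpose_mat A"
  for A :: "'a::comm_semiring_0 mat"
  by (rule transpose_mult[of _ "dim_row A" "dim_row B" _ "dim_col B"]) auto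

lemma mat_smult_mult: "dim_col A = dim_row B \<Longrightarrow> (c \<cdot>\<^sub>m A) * B = c \<cdot>\<^sub>m (A * B)" for A :: "'a::comm_semiring_0 mat"
  by (rule mult_smult_assoc_mat[of _ "dim_row A" "dim_row B" _ "dim_col B"]) auto

lemma mat_mult_smult: "dim_col A = dim_row B \<Longrightarrow> A * (c \<cdot>\<^sub>m B) = c \<cdot>\<^sub>m (A * B)" for A :: "'a::comm_semiring_0 mat"
  by (rule mult_smult_distrib[of _ "dim_row A" "dim_row B" _ "dim_col B"]) auto

lemma mat_transpose_add: "dim_row A = dim_row B \<Longrightarrow> dim_col A = dim_col B \<Longrightarrow>
    transpose_mat (A + B) = transpose_mat A + transpose_mat B"
  by (intro eq_matI) auto

lemma mat_transpose_smult: "transpose_mat (c \<cdot>\<^sub>m A) = c \<cdot>\<^sub>m transpose_mat A"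
  by (intro eq_matI) auto

lemma cosum_product:
  "cosum H x \<beta> * cosum H y \<gamma> = cosum H x (\<lambda>a b. cosum H y (\<lambda>c d. \<beta> a b * \<gamma> c d))"
  by (simp add: cosum_mult_left cosum_mult_right)

lemma sum_div_mod:
  fixes f :: "nat \<Rightarrow> nat \<Rightarrow> 'a::comm_monoid_add"
  shows "(\<Sum>r = 0..<n * m. f (r div m) (r mod m)) = (\<Sum>i = 0..<n. \<Sum>j = 0..<m. f i j)"
proof (cases "m = 0")
  case False
  have "(\<Sum>i = 0..<n. \<Sum>j = 0..<m. f i j) = (\<Sum>(i, j)\<in>{0..<n} \<times> {0..<m}. f i j)"
    by (simp add: sum.cartesian_product)
  also have "\<dots> = (\<Sum>r = 0..<n * m. f (r div m) (r mod m))"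
  proof (rule sum.reindex_bij_witness[of _ "\<lambda>r. (r div m, r mod m)" "\<lambda>(i, j). i * m + j"])
    fix p assume "p \<in> {0..<n} \<times> {0..<m}"
    then obtain i j where p: "p = (i, j)" "i < n" "j < m" by auto
    then have "i * m + j < Suc i * m" by simp
    also have "\<dots> \<le> n * m" using p by (intro mult_le_mono1) simp
    finally show "(case p of (i, j) \<Rightarrow> i * m + j) \<in> {0..<n * m}" using p by simp
  qed (use False in \<open>auto simp: less_mult_imp_div_less mult.commute\<close>)
  finally show ?thesis by simp
qed simp

lemma kronecker_carrier:
  "A \<in> carrier_mat n n' \<Longrightarrow> B \<in> carrier_mat m m' \<Longrightarrow> kronecker A B \<in> carrier_mat (n * m) (n' * m')"
  by (auto simp: kronecker_def)

lemma div_mod_bounds: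
  assumes "p < n * (m::nat)" shows "p div m < n" "p mod m < m"
proof -
  have "m > 0" using assms by (cases "m = 0") auto
  then show "p div m < n" "p mod m < m" using assms by (auto simp: less_mult_imp_div_less)
qed

lemma kronecker_index:
  assumes "A \<in> carrier_mat n n'" "B \<in> carrier_mat m m'" "p < n * m" "q < n' * m'"
  shows "kronecker A B $$ (p, q) = A $$ (p div m, q div m') * B $$ (p mod m, q mod m')"
  using assms by (auto simp: kronecker_def)

text \<open>The summation index of the large product encodes a pair by quotient and remainder, so
  the sum factors into the two small products.\<close>

lemma kronecker_mult:
  fixes A :: "'a::field mat"
  assumes A: "A \<in> carrier_mat a b" and B: "B \<in> carrier_mat a' b'"
    and C: "C \<in> carrier_mat b c" and D: "D \<in> carrier_mat b' c'"
  shows "kronecker A B * kronecker C D = kronecker (A * C) (B * D)"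
proof (rule eq_matI)
  note k = kronecker_carrier[OF A B] kronecker_carrier[OF C D]
  have AC: "A * C \<in> carrier_mat a c" "B * D \<in> carrier_mat a' c'" using A B C D by auto
  fix p q assume "p < dim_row (kronecker (A * C) (B * D))" "q < dim_col (kronecker (A * C) (B * D))"
  then have pq: "p < a * a'" "q < c * c'" using kronecker_carrier[OF AC] by auto
  note d = div_mod_bounds[OF pq(1)] div_mod_bounds[OF pq(2)]
  have "(kronecker A B * kronecker C D) $$ (p, q) =
      (\<Sum>r = 0..<b * b'. kronecker A B $$ (p, r) * kronecker C D $$ (r, q))"
    using k pq by (simp add: scalar_prod_def)
  also have "\<dots> = (\<Sum>r = 0..<b * b'. (A $$ (p div a', r div b') * C $$ (r div b', q div c')) *
      (B $$ (p mod a', r mod b') * D $$ (r mod b', q mod c')))"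
    using pq by (intro sum.cong refl) (simp add: kronecker_index[OF A B] kronecker_index[OF C D])
  also have "\<dots> = (\<Sum>i = 0..<b. A $$ (p div a', i) * C $$ (i, q div c')) *
      (\<Sum>j = 0..<b'. B $$ (p mod a', j) * D $$ (j, q mod c'))"
    by (subst sum_div_mod[where f = "\<lambda>i j. (A $$ (p div a', i) * C $$ (i, q div c')) *
      (B $$ (p mod a', j) * D $$ (j, q mod c'))"]) (simp add: sum_product)
  also have "\<dots> = kronecker (A * C) (B * D) $$ (p, q)"
    using pq d A B C D by (simp add: kronecker_index[OF AC] scalar_prod_def)
  finally show "(kronecker A B * kronecker C D) $$ (p, q) = kronecker (A * C) (B * D) $$ (p, q)" .
qed (use assms in \<open>auto simp: kronecker_def\<close>)

lemma kronecker_one: "kronecker (1\<^sub>m n) (1\<^sub>m m) = (1\<^sub>m (n * m) :: 'a::field mat)"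
proof (rule eq_matI)
  fix p q assume "p < dim_row (1\<^sub>m (n * m) :: 'a mat)" "q < dim_col (1\<^sub>m (n * m) :: 'a mat)"
  then have pq: "p < n * m" "q < n * m" by auto
  have "p = q" if "p div m = q div m" "p mod m = q mod m" using that by (metis div_mult_mod_eq)
  then show "kronecker (1\<^sub>m n) (1\<^sub>m m) $$ (p, q) = (1\<^sub>m (n * m) :: 'a mat) $$ (p, q)"
    using pq div_mod_bounds[OF pq(1)] div_mod_bounds[OF pq(2)]
    by (auto simp: kronecker_index[OF one_carrier_mat one_carrier_mat])
qed (auto simp: kronecker_def)

context fin_dim_hopf_algebra
begin

lemma dual_hdim: "is_hmod H V \<Longrightarrow> hdim (dual_hmod H V) = hdim V"
  unfolding hdim_def[of "dual_hmod H V"] by (simp add: dual_hmod_def)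

lemma hmod_simps:
  assumes "is_hmod H V"
  shows "V (g + h) = V g + V h" "V (c *\<^sub>H h) = c \<cdot>\<^sub>m V h" "V (g * h) = V g * V h" "V 1 = 1\<^sub>m (hdim V)"
  using assms by (auto simp: is_hmod_def)

lemma dual_hmod:
  assumes V: "is_hmod H V" shows "is_hmod H (dual_hmod H V)"
  unfolding is_hmod_def dual_hdim[OF V]
  using V by (auto simp: dual_hmod_def hmod_simps[OF V] ant_add ant_scale ant_mult ant_one
      mat_transpose_mult mat_transpose_add mat_transpose_smult hmod_carrier)

lemma hmod_hom_dual:
  assumes V: "is_hmod H V" and W: "is_hmod H W" and A: "hmod_hom V W A"
  shows "hmod_hom (dual_hmod H W) (dual_hmod H V) (transpose_mat A)"
proof -
  note [simp] = hmod_dim[OF V] hmod_dim[OF W] hmod_hom_dim[OF A]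
  have "transpose_mat A * dual_hmod H W h = dual_hmod H V h * transpose_mat A" for h
    using arg_cong[OF hmod_hom_commute[OF A, of "ant h"], of transpose_mat]
    by (simp add: dual_hmod_def mat_transpose_mult)
  then show ?thesis using hmod_hom_carrier[OF A] by (simp add: hmod_hom_def dual_hdim[OF V] dual_hdim[OF W])
qed

text \<open>Transposing a homomorphism of duals gives commutation only with elements of the form
  \<open>S(g)\<close>; surjectivity of the antipode makes these all elements.\<close>

lemma hmod_hom_dual_iff:
  assumes V: "is_hmod H V" and W: "is_hmod H W"
  shows "hmod_hom (dual_hmod H W) (dual_hmod H V) A \<longleftrightarrow> hmod_hom V W (transpose_mat A)"
proof
  assume A: "hmod_hom (dual_hmod H W) (dual_hmod H V) A"
  note [simp] = hmod_dim[OF V] hmod_dim[OF W] hmod_hom_dim[OF A, unfolded dual_hdim[OF V] dual_hdim[OF W]]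
  have "transpose_mat A * V h = W h * transpose_mat A" for h
  proof -
    obtain g where g: "h = ant g" using surj_antipode by (metis surjD)
    have "A * transpose_mat (W (ant g)) = transpose_mat (V (ant g)) * A"
      using hmod_hom_commute[OF A, of g] by (simp add: dual_hmod_def)
    from arg_cong[OF this, of transpose_mat] show ?thesis
      unfolding g by (simp add: mat_transpose_mult)
  qed
  then show "hmod_hom V W (transpose_mat A)"
    using hmod_hom_carrier[OF A] by (simp add: hmod_hom_def dual_hdim[OF V] dual_hdim[OF W])
qed (use hmod_hom_dual[OF V W, of "transpose_mat A"] in simp)

text \<open>The implication from duals back to modules is the source of injectivity of the duality
  on basis elements.\<close>

lemma dual_iso_iff:
  assumes V: "is_hmod H V" and W: "is_hmod H W"
  shows "hmod_iso (dual_hmod H V) (dual_hmod H W) \<longleftrightarrow> hmod_iso V W"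
proof
  assume "hmod_iso V W"
  then obtain A B where AB: "hmod_hom V W A" "hmod_hom W V B" "A * B = 1\<^sub>m (hdim W)" "B * A = 1\<^sub>m (hdim V)"
    using hmod_isoE[OF V W] by blast
  show "hmod_iso (dual_hmod H V) (dual_hmod H W)"
    by (rule hmod_isoI[OF hmod_hom_dual[OF W V AB(2)], of "transpose_mat A"])
      (use hmod_hom_carrier[OF AB(1)] hmod_hom_carrier[OF AB(2)] AB(3,4)
       in \<open>auto simp: dual_hdim[OF V] dual_hdim[OF W] simp flip: mat_transpose_mult\<close>)
next
  assume "hmod_iso (dual_hmod H V) (dual_hmod H W)"
  then obtain A B where AB: "hmod_hom (dual_hmod H V) (dual_hmod H W) A" "hmod_hom (dual_hmod H W) (dual_hmod H V) B"
    "A * B = 1\<^sub>m (hdim W)" "B * A = 1\<^sub>m (hdim V)"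
    using hmod_isoE[OF dual_hmod[OF V] dual_hmod[OF W]] by (metis dual_hdim V W)
  show "hmod_iso V W"
    by (rule hmod_isoI[of _ _ "transpose_mat B" "transpose_mat A"])
      (use AB hmod_hom_carrier[OF AB(1)] hmod_hom_carrier[OF AB(2)]
       in \<open>auto simp: hmod_hom_dual_iff[OF V W] dual_hdim[OF V] dual_hdim[OF W] simp flip: mat_transpose_mult\<close>)
qed

lemma dual_direct_sum:
  assumes V: "is_hmod H V" and W: "is_hmod H W"
  shows "dual_hmod H (direct_sum_hmod V W) = direct_sum_hmod (dual_hmod H V) (dual_hmod H W)"
proof
  fix h
  show "dual_hmod H (direct_sum_hmod V W) h = direct_sum_hmod (dual_hmod H V) (dual_hmod H W) h"
    unfolding dual_hmod_def[of H "direct_sum_hmod V W"] direct_sum_hmod_def dual_hdim[OF V] dual_hdim[OF W]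
    unfolding dual_hmod_def
    by (subst transpose_four_block_mat[OF hmod_carrier[OF V] zero_carrier_mat zero_carrier_mat hmod_carrier[OF W]])
      simp
qed

text \<open>A decomposition of the dual yields an idempotent endomorphism of it, whose transpose is
  an idempotent endomorphism of \<open>V\<close>. Dualising the decomposition itself would instead
  decompose the twist of \<open>V\<close> by \<open>S^2\<close>.\<close>

lemma dual_indecomposable:
  assumes V: "indecomposable_hmod H V"
  shows "indecomposable_hmod H (dual_hmod H V)"
  unfolding indecomposable_hmod_def
proof (intro conjI allI impI)
  have m: "is_hmod H V" using V by (rule indecomposable_hmod_is_hmod)
  note mD = dual_hmod[OF m]
  show "is_hmod H (dual_hmod H V)" by (rule mD)
  show "hdim (dual_hmod H V) \<noteq> 0" using V by (simp add: dual_hdim[OF m] indecomposable_hmod_def)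
  fix U W assume *: "is_hmod H U \<and> is_hmod H W \<and> hmod_iso (dual_hmod H V) (direct_sum_hmod U W)"
  then obtain i j p q where b: "biproduct (dual_hmod H V) U W i j p q"
    using iso_direct_sum_biproduct[OF mD] by blast
  have h: "hmod_hom U (dual_hmod H V) i" "hmod_hom W (dual_hmod H V) j" "hmod_hom (dual_hmod H V) U p"
    "hmod_hom (dual_hmod H V) W q"
    and e: "p * i = 1\<^sub>m (hdim U)" "q * j = 1\<^sub>m (hdim W)" "i * p + j * q = 1\<^sub>m (hdim (dual_hmod H V))"
    using b by (auto simp: biproduct_def)
  note [simp] = h[THEN hmod_hom_dim(1), unfolded dual_hdim[OF m]] h[THEN hmod_hom_dim(2), unfolded dual_hdim[OF m]]
  have "hmod_hom (dual_hmod H V) (dual_hmod H V) (i * p)"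
    using hmod_hom_mult[OF mD _ mD h(3,1)] * by blast
  then have t: "hmod_hom V V (transpose_mat (i * p))" using hmod_hom_dual_iff[OF m m] by blast
  have "(i * p) * (i * p) = i * (p * i) * p" by (simp add: mat_assoc)
  also have "\<dots> = i * p" using e right_mult_one_mat[OF hmod_hom_carrier[OF h(1)]] by simp
  finally have "transpose_mat (i * p) * transpose_mat (i * p) = transpose_mat (i * p)"
    by (metis mat_transpose_mult h(1,3) hmod_hom_dim index_mult_mat(2,3))
  from indecomposable_idempotent[OF V t this] show "hdim U = 0 \<or> hdim W = 0"
  proof
    assume "transpose_mat (i * p) = 0\<^sub>m (hdim V) (hdim V)"
    from arg_cong[OF this, of transpose_mat] have ip: "i * p = 0\<^sub>m (hdim V) (hdim V)"
      by (simp del: transpose_mult)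
    have "1\<^sub>m (hdim U) = p * (i * p) * i" unfolding e(1)[symmetric]
      by (simp add: mat_assoc mat_mult_one_cancel[OF e(1)])
    also have "\<dots> = 0\<^sub>m (hdim U) (hdim U)"
    proof -
      have "p * 0\<^sub>m (hdim V) (hdim V) * i = 0\<^sub>m (hdim U) (hdim V) * i"
        by (simp add: mat_mult_zero_right)
      also have "\<dots> = 0\<^sub>m (hdim U) (hdim U)"
        using hmod_hom_carrier[OF h(1)] by (simp add: dual_hdim[OF m])
      finally show ?thesis unfolding ip .
    qed
    finally have "1\<^sub>m (hdim U) $$ (0, 0) = (0\<^sub>m (hdim U) (hdim U) :: 'k mat) $$ (0, 0)" by simp
    then show ?thesis by (cases "hdim U = 0") auto
  next
    assume "transpose_mat (i * p) = 1\<^sub>m (hdim V)"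
    from arg_cong[OF this, of transpose_mat] have ip: "i * p = 1\<^sub>m (hdim V)"
      by (simp del: transpose_mult)
    have "1\<^sub>m (hdim W) = q * j" using e by simp
    also have "\<dots> = q * (i * p) * j" unfolding ip using hmod_hom_carrier[OF h(4)]
      by (simp add: dual_hdim[OF m])
    also have "\<dots> = q * i * (p * j)" by (simp add: mat_assoc)
    also have "\<dots> = 0\<^sub>m (hdim W) (hdim W)"
      unfolding biproduct_zero1[OF b] biproduct_zero2[OF b] by simp
    finally have "1\<^sub>m (hdim W) $$ (0, 0) = (0\<^sub>m (hdim W) (hdim W) :: 'k mat) $$ (0, 0)" by simp
    then show ?thesis by (cases "hdim W = 0") auto
  qed
qed

lemma hmod_entry_linear:
  assumes V: "is_hmod H V" and "i < hdim V" "j < hdim V"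
  shows "linear_form H (\<lambda>h. V h $$ (i, j))"
  using assms(2,3) hmod_dim[OF V] by (simp add: linear_form_iff hmod_simps[OF V])

lemma tensor_hdim: "hdim (tensor_hmod H V W) = hdim V * hdim W"
  unfolding hdim_def[of "tensor_hmod H V W"] by (simp add: tensor_hmod_def)

lemma tensor_carrier: "tensor_hmod H V W h \<in> carrier_mat (hdim V * hdim W) (hdim V * hdim W)"
  by (simp add: tensor_hmod_def)

lemma tensor_index:
  assumes V: "is_hmod H V" and W: "is_hmod H W" and pq: "p < hdim V * hdim W" "q < hdim V * hdim W"
  shows "tensor_hmod H V W h $$ (p, q) =
    cosum H h (\<lambda>a b. V a $$ (p div hdim W, q div hdim W) * W b $$ (p mod hdim W, q mod hdim W))"
  using pq by (simp add: tensor_hmod_def cosum_def kronecker_index[OF hmod_carrier[OF V] hmod_carrier[OF W]])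

lemma tensor_entry_bilinear:
  assumes V: "is_hmod H V" and W: "is_hmod H W" and pq: "p < hdim V * hdim W" "q < hdim V * hdim W"
  shows "bilinear_form H (\<lambda>a b. V a $$ (p div hdim W, q div hdim W) * W b $$ (p mod hdim W, q mod hdim W))"
  using hmod_entry_linear[OF V div_mod_bounds(1)[OF pq(1)] div_mod_bounds(1)[OF pq(2)]]
    hmod_entry_linear[OF W div_mod_bounds(2)[OF pq(1)] div_mod_bounds(2)[OF pq(2)]]
  by (simp add: bilinear_form_def linear_form_iff algebra_simps)

text \<open>Every entry of the action is the \<open>cosum\<close> of a bilinear form, so the module
  axioms reduce to the coproduct axioms, which are available exactly on such forms.\<close>

lemma tensor_hmod:
  assumes V: "is_hmod H V" and W: "is_hmod H W"
  shows "is_hmod H (tensor_hmod H V W)"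
proof -
  let ?T = "tensor_hmod H V W" and ?n = "hdim V" and ?m = "hdim W"
  note c = tensor_carrier[of V W]
  note [simp] = c[THEN carrier_matD(1)] c[THEN carrier_matD(2)]
  have "?T (g + h) = ?T g + ?T h" for g h
    by (rule eq_matI) (simp_all add: tensor_index[OF V W] cosum_arg_add[OF tensor_entry_bilinear[OF V W]])
  moreover have "?T (a *\<^sub>H h) = a \<cdot>\<^sub>m ?T h" for a h
    by (rule eq_matI) (simp_all add: tensor_index[OF V W] cosum_arg_scale[OF tensor_entry_bilinear[OF V W]])
  moreover have "?T 1 = 1\<^sub>m (?n * ?m)"
  proof (rule eq_matI)
    fix p q assume "p < dim_row (1\<^sub>m (?n * ?m) :: 'k mat)" "q < dim_col (1\<^sub>m (?n * ?m) :: 'k mat)"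
    then have pq: "p < ?n * ?m" "q < ?n * ?m" by auto
    have "p = q" if "p div ?m = q div ?m" "p mod ?m = q mod ?m" using that by (metis div_mult_mod_eq)
    then show "?T 1 $$ (p, q) = 1\<^sub>m (?n * ?m) $$ (p, q)"
      using pq div_mod_bounds[OF pq(1)] div_mod_bounds[OF pq(2)]
      by (auto simp: tensor_index[OF V W pq] cosum_one[OF tensor_entry_bilinear[OF V W pq]]
          hmod_simps(4)[OF V] hmod_simps(4)[OF W])
  qed auto
  moreover have "?T (g * h) = ?T g * ?T h" for g h
  proof (rule eq_matI)
    fix p q assume "p < dim_row (?T g * ?T h)" "q < dim_col (?T g * ?T h)"
    then have pq: "p < ?n * ?m" "q < ?n * ?m" by auto
    note d = div_mod_bounds[OF pq(1)] div_mod_bounds[OF pq(2)]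
    have "(?T g * ?T h) $$ (p, q) = (\<Sum>r = 0..<?n * ?m. ?T g $$ (p, r) * ?T h $$ (r, q))"
      using pq by (simp add: scalar_prod_def)
    also have "\<dots> = (\<Sum>r = 0..<?n * ?m. cosum H g (\<lambda>a b. cosum H h (\<lambda>a' b'.
        (V a $$ (p div ?m, r div ?m) * V a' $$ (r div ?m, q div ?m)) *
        (W b $$ (p mod ?m, r mod ?m) * W b' $$ (r mod ?m, q mod ?m)))))"
    proof (intro sum.cong refl)
      fix r assume "r \<in> {0..<?n * ?m}"
      then have r: "r < ?n * ?m" by simp
      show "?T g $$ (p, r) * ?T h $$ (r, q) = cosum H g (\<lambda>a b. cosum H h (\<lambda>a' b'.
        (V a $$ (p div ?m, r div ?m) * V a' $$ (r div ?m, q div ?m)) *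
        (W b $$ (p mod ?m, r mod ?m) * W b' $$ (r mod ?m, q mod ?m))))"
        unfolding tensor_index[OF V W pq(1) r] tensor_index[OF V W r pq(2)] cosum_product
        by (simp add: mult.assoc mult.left_commute)
    qed
    also have "\<dots> = cosum H g (\<lambda>a b. cosum H h (\<lambda>a' b'. \<Sum>r = 0..<?n * ?m.
        (V a $$ (p div ?m, r div ?m) * V a' $$ (r div ?m, q div ?m)) *
        (W b $$ (p mod ?m, r mod ?m) * W b' $$ (r mod ?m, q mod ?m))))"
      by (simp add: cosum_sum)
    also have "\<dots> = cosum H g (\<lambda>a b. cosum H h (\<lambda>a' b'.
        V (a * a') $$ (p div ?m, q div ?m) * W (b * b') $$ (p mod ?m, q mod ?m)))"
    proof -
      have "(\<Sum>r = 0..<?n * ?m. (V a $$ (p div ?m, r div ?m) * V a' $$ (r div ?m, q div ?m)) *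
        (W b $$ (p mod ?m, r mod ?m) * W b' $$ (r mod ?m, q mod ?m))) =
        V (a * a') $$ (p div ?m, q div ?m) * W (b * b') $$ (p mod ?m, q mod ?m)" for a b a' b'
        using d V W hmod_carrier[OF V] hmod_carrier[OF W]
        by (subst sum_div_mod[where f = "\<lambda>i j. (V a $$ (p div ?m, i) * V a' $$ (i, q div ?m)) *
          (W b $$ (p mod ?m, j) * W b' $$ (j, q mod ?m))"])
          (simp add: hmod_simps(3)[OF V] hmod_simps(3)[OF W] scalar_prod_def sum_product)
      then show ?thesis by simp
    qed
    also have "\<dots> = ?T (g * h) $$ (p, q)"
      unfolding tensor_index[OF V W pq] by (rule cosum_mult[OF tensor_entry_bilinear[OF V W pq], symmetric])
    finally show "?T (g * h) $$ (p, q) = (?T g * ?T h) $$ (p, q)" by simp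
  qed auto
  ultimately show ?thesis unfolding is_hmod_def tensor_hdim using c by blast
qed

lemma tensor_hom:
  assumes m: "is_hmod H V" "is_hmod H V'" "is_hmod H W" "is_hmod H W'"
    and A: "hmod_hom V V' A" and B: "hmod_hom W W' B"
  shows "hmod_hom (tensor_hmod H V W) (tensor_hmod H V' W') (kronecker A B)"
  unfolding hmod_hom_def tensor_hdim
proof (intro conjI allI)
  note cA = hmod_hom_carrier[OF A] and cB = hmod_hom_carrier[OF B]
  let ?n = "hdim V" let ?m = "hdim W" let ?n' = "hdim V'" let ?m' = "hdim W'"
  show k: "kronecker A B \<in> carrier_mat (?n' * ?m') (?n * ?m)" using kronecker_carrier[OF cA cB] .
  fix h
  have kc: "kronecker (V a) (W b) \<in> carrier_mat (?n * ?m) (?n * ?m)"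
    "kronecker (V' a) (W' b) \<in> carrier_mat (?n' * ?m') (?n' * ?m')" for a b
    using m hmod_carrier kronecker_carrier by metis+
  have T: "tensor_hmod H V W h $$ (p, q) = cosum H h (\<lambda>a b. kronecker (V a) (W b) $$ (p, q))"
    if "p < ?n * ?m" "q < ?n * ?m" for p q
    using that by (simp add: tensor_hmod_def cosum_def)
  have T': "tensor_hmod H V' W' h $$ (p, q) = cosum H h (\<lambda>a b. kronecker (V' a) (W' b) $$ (p, q))"
    if "p < ?n' * ?m'" "q < ?n' * ?m'" for p q
    using that by (simp add: tensor_hmod_def cosum_def)
  note [simp] = tensor_carrier[of V W h, THEN carrier_matD(1)] tensor_carrier[of V W h, THEN carrier_matD(2)]
    tensor_carrier[of V' W' h, THEN carrier_matD(1)] tensor_carrier[of V' W' h, THEN carrier_matD(2)]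
    carrier_matD[OF k] kc[THEN carrier_matD(1)] kc[THEN carrier_matD(2)]
  show "kronecker A B * tensor_hmod H V W h = tensor_hmod H V' W' h * kronecker A B"
  proof (rule eq_matI)
    fix p q assume "p < dim_row (tensor_hmod H V' W' h * kronecker A B)"
      "q < dim_col (tensor_hmod H V' W' h * kronecker A B)"
    then have pq: "p < ?n' * ?m'" "q < ?n * ?m" by auto
    have "(kronecker A B * tensor_hmod H V W h) $$ (p, q) =
        (\<Sum>r = 0..<?n * ?m. kronecker A B $$ (p, r) * cosum H h (\<lambda>a b. kronecker (V a) (W b) $$ (r, q)))"
      using pq by (simp add: scalar_prod_def T)
    also have "\<dots> = cosum H h (\<lambda>a b. (kronecker A B * kronecker (V a) (W b)) $$ (p, q))"
      using pq by (simp add: scalar_prod_def cosum_sum cosum_mult_left)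
    also have "\<dots> = cosum H h (\<lambda>a b. (kronecker (V' a) (W' b) * kronecker A B) $$ (p, q))"
      using m by (simp add: kronecker_mult[OF cA cB hmod_carrier hmod_carrier]
          kronecker_mult[OF hmod_carrier hmod_carrier cA cB] hmod_hom_commute[OF A] hmod_hom_commute[OF B])
    also have "\<dots> = (\<Sum>r = 0..<?n' * ?m'. cosum H h (\<lambda>a b. kronecker (V' a) (W' b) $$ (p, r)) * kronecker A B $$ (r, q))"
      using pq by (simp add: scalar_prod_def cosum_sum cosum_mult_right)
    also have "\<dots> = (tensor_hmod H V' W' h * kronecker A B) $$ (p, q)"
      using pq by (simp add: scalar_prod_def T')
    finally show "(kronecker A B * tensor_hmod H V W h) $$ (p, q) = (tensor_hmod H V' W' h * kronecker A B) $$ (p, q)" .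
  qed auto
qed

lemma tensor_cong:
  assumes m: "is_hmod H V" "is_hmod H V'" "is_hmod H W" "is_hmod H W'"
    and "hmod_iso V V'" "hmod_iso W W'"
  shows "hmod_iso (tensor_hmod H V W) (tensor_hmod H V' W')"
proof -
  obtain A B where A: "hmod_hom V V' A" "hmod_hom V' V B" "A * B = 1\<^sub>m (hdim V')" "B * A = 1\<^sub>m (hdim V)"
    using hmod_isoE[OF m(1,2) assms(5)] .
  obtain C D where C: "hmod_hom W W' C" "hmod_hom W' W D" "C * D = 1\<^sub>m (hdim W')" "D * C = 1\<^sub>m (hdim W)"
    using hmod_isoE[OF m(3,4) assms(6)] .
  note c = A(1,2)[THEN hmod_hom_carrier] C(1,2)[THEN hmod_hom_carrier]
  show ?thesis
    by (rule hmod_isoI[OF tensor_hom[OF m A(1) C(1)], of "kronecker B D"])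
      (use A C c kronecker_carrier[OF c(2,4)] in \<open>simp_all add: tensor_hdim kronecker_mult[OF c(1,3,2,4)]
        kronecker_mult[OF c(2,4,1,3)] kronecker_one\<close>)
qed

end

section \<open>The trivial module as a summand of a tensor product\<close>

lemma mat_trace_transpose: "A \<in> carrier_mat n n \<Longrightarrow> mat_trace (transpose_mat A) = mat_trace A"
  by (simp add: mat_trace_def)

context fin_dim_hopf_algebra
begin

lemma trivial_hdim: "hdim (trivial_hmod H) = 1"
  by (simp add: hdim_def trivial_hmod_def)

lemma trivial_hmod: "is_hmod H (trivial_hmod H)"
  unfolding is_hmod_def trivial_hdim
  by (auto simp: trivial_hmod_def eps_add eps_scale counit_mult counit_one scalar_prod_def intro!: eq_matI)

lemma trivial_indecomposable: "indecomposable_hmod H (trivial_hmod H)"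
  unfolding indecomposable_hmod_def
proof (intro conjI allI impI)
  fix U W assume *: "is_hmod H U \<and> is_hmod H W \<and> hmod_iso (trivial_hmod H) (direct_sum_hmod U W)"
  then have "hdim U + hdim W = 1"
    using hmod_iso_hdim[of "trivial_hmod H" "direct_sum_hmod U W"] direct_sum_hdim trivial_hdim by metis
  then show "hdim U = 0 \<or> hdim W = 0" by linarith
qed (simp_all add: trivial_hmod trivial_hdim)

text \<open>Row-major vectorisation, matching the index order of \<open>kronecker\<close>. It
  identifies vectors of \<open>V \<otimes> W\<close> with matrices, hence with linear maps from the
  dual space of one factor to the other.\<close>

definition col_of :: "'k mat \<Rightarrow> 'k mat" where
  "col_of A = mat (dim_row A * dim_col A) 1 (\<lambda>(p, _). A $$ (p div dim_col A, p mod dim_col A))"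

lemma col_of_carrier: "A \<in> carrier_mat n m \<Longrightarrow> col_of A \<in> carrier_mat (n * m) 1"
  by (auto simp: col_of_def)

lemma col_of_index: "A \<in> carrier_mat n m \<Longrightarrow> p < n * m \<Longrightarrow> col_of A $$ (p, 0) = A $$ (p div m, p mod m)"
  by (auto simp: col_of_def)

lemma col_of_surj:
  assumes x: "x \<in> carrier_mat (n * m) 1"
  obtains A where "A \<in> carrier_mat n m" "x = col_of A"
proof -
  define A where "A = mat n m (\<lambda>(i, j). x $$ (i * m + j, 0))"
  have A: "A \<in> carrier_mat n m" by (simp add: A_def)
  have "x = col_of A"
  proof (rule eq_matI)
    fix p q assume "p < dim_row (col_of A)" "q < dim_col (col_of A)"
    then have pq: "p < n * m" "q = 0" using col_of_carrier[OF A] by auto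
    have "x $$ (p, 0) = A $$ (p div m, p mod m)" using div_mod_bounds[OF pq(1)] by (simp add: A_def)
    then show "x $$ (p, q) = col_of A $$ (p, q)" using pq by (simp add: col_of_index[OF A])
  qed (use x col_of_carrier[OF A] in auto)
  with A show ?thesis using that by blast
qed

text \<open>The standard pairing of vectorised matrices is the trace form. It computes the scalar of
  a composite \<open>k -> V \<otimes> W -> k\<close>.\<close>

lemma col_of_inner:
  assumes A: "A \<in> carrier_mat n m" and B: "B \<in> carrier_mat n m"
  shows "transpose_mat (col_of A) * col_of B = mat_trace (transpose_mat A * B) \<cdot>\<^sub>m 1\<^sub>m 1"
proof (rule eq_matI)
  fix i j assume "i < dim_row (mat_trace (transpose_mat A * B) \<cdot>\<^sub>m 1\<^sub>m 1)"
    "j < dim_col (mat_trace (transpose_mat A * B) \<cdot>\<^sub>m 1\<^sub>m 1)"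
  then have ij: "i = 0" "j = 0" by auto
  have "(transpose_mat (col_of A) * col_of B) $$ (0, 0)
      = (\<Sum>p = 0..<n * m. A $$ (p div m, p mod m) * B $$ (p div m, p mod m))"
    using col_of_carrier[OF A] col_of_carrier[OF B]
    by (auto simp: scalar_prod_def col_of_index[OF A] col_of_index[OF B] intro!: sum.cong)
  also have "\<dots> = (\<Sum>i = 0..<n. \<Sum>j = 0..<m. A $$ (i, j) * B $$ (i, j))"
    by (rule sum_div_mod)
  also have "\<dots> = mat_trace (transpose_mat A * B)"
    using A B by (subst sum.swap) (auto simp: mat_trace_def scalar_prod_def lessThan_atLeast0 intro!: sum.cong)
  finally show "(transpose_mat (col_of A) * col_of B) $$ (i, j) = (mat_trace (transpose_mat A * B) \<cdot>\<^sub>m 1\<^sub>m 1) $$ (i, j)"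
    using ij by simp
qed (use col_of_carrier[OF A] col_of_carrier[OF B] in auto)

lemma mat_triple_index:
  assumes "A \<in> carrier_mat n k" "B \<in> carrier_mat k l" "C \<in> carrier_mat l m" "i < n" "j < m"
  shows "(A * B * C) $$ (i, j) = (\<Sum>p = 0..<k. \<Sum>q = 0..<l. A $$ (i, p) * B $$ (p, q) * C $$ (q, j))"
proof -
  have "(A * B * C) $$ (i, j) = (\<Sum>q = 0..<l. (\<Sum>p = 0..<k. A $$ (i, p) * B $$ (p, q)) * C $$ (q, j))"
  proof -
    have "A * B \<in> carrier_mat n l" using assms by auto
    then have "(A * B * C) $$ (i, j) = (\<Sum>q = 0..<l. (A * B) $$ (i, q) * C $$ (q, j))"
      using assms by (simp add: scalar_prod_def del: assoc_mult_mat)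
    also have "\<dots> = (\<Sum>q = 0..<l. (\<Sum>p = 0..<k. A $$ (i, p) * B $$ (p, q)) * C $$ (q, j))"
      using assms by (intro sum.cong) (auto simp: scalar_prod_def)
    finally show ?thesis .
  qed
  also have "\<dots> = (\<Sum>p = 0..<k. \<Sum>q = 0..<l. A $$ (i, p) * B $$ (p, q) * C $$ (q, j))"
    unfolding sum_distrib_right by (rule sum.swap)
  finally show ?thesis .
qed

lemma hmod_hom_from_trivial:
  "hmod_hom (trivial_hmod H) T x \<longleftrightarrow>
    x \<in> carrier_mat (hdim T) 1 \<and> (\<forall>h. T h * x = eps h \<cdot>\<^sub>m x)"
proof -
  have "x * trivial_hmod H h = eps h \<cdot>\<^sub>m x" if "x \<in> carrier_mat (hdim T) 1" for h
    using that by (intro eq_matI) (auto simp: trivial_hmod_def scalar_prod_def mult.commute)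
  then show ?thesis unfolding hmod_hom_def trivial_hdim by metis
qed

lemma hmod_hom_to_trivial:
  "hmod_hom T (trivial_hmod H) y \<longleftrightarrow>
    y \<in> carrier_mat 1 (hdim T) \<and> (\<forall>h. y * T h = eps h \<cdot>\<^sub>m y)"
proof -
  have "trivial_hmod H h * y = eps h \<cdot>\<^sub>m y" if "y \<in> carrier_mat 1 (hdim T)" for h
    using that by (intro eq_matI) (auto simp: trivial_hmod_def scalar_prod_def)
  then show ?thesis unfolding hmod_hom_def trivial_hdim by metis
qed

text \<open>Invariants of \<open>V \<otimes> W\<close> are module homomorphisms \<open>V\<^sup>* \<rightarrow> W\<close>.\<close>

lemma invariant_iff:
  assumes V: "is_hmod H V" and W: "is_hmod H W" and A: "A \<in> carrier_mat (hdim V) (hdim W)"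
  shows "hmod_hom (trivial_hmod H) (tensor_hmod H V W) (col_of A) \<longleftrightarrow>
    (\<forall>h. V (ant h) * A = A * transpose_mat (W h))"
proof -
  let ?n = "hdim V" and ?m = "hdim W" and ?T = "tensor_hmod H V W"
  note cV = hmod_carrier[OF V] and cW = hmod_carrier[OF W]
  note [simp] = hmod_dim[OF V] hmod_dim[OF W] carrier_matD[OF A]
  let ?D = "\<lambda>h i j. cosum H h (\<lambda>a b. (V a * A * transpose_mat (W b)) $$ (i, j))"
  \<comment> \<open>Under vectorisation \<open>h\<close> acts on \<open>A\<close> as the sum of
    \<open>V(h_1) A W(h_2)^T\<close>.\<close>
  have lhs: "(?T h * col_of A) $$ (p, 0) = ?D h (p div ?m) (p mod ?m)" if p: "p < ?n * ?m" for h p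
  proof -
    note d = div_mod_bounds[OF p]
    have "(?T h * col_of A) $$ (p, 0) = (\<Sum>q = 0..<?n * ?m. ?T h $$ (p, q) * A $$ (q div ?m, q mod ?m))"
      using p col_of_carrier[OF A] tensor_carrier[of V W h]
      by (auto simp: scalar_prod_def col_of_index[OF A] intro!: sum.cong)
    also have "\<dots> = cosum H h (\<lambda>a b. \<Sum>q = 0..<?n * ?m.
        V a $$ (p div ?m, q div ?m) * A $$ (q div ?m, q mod ?m) * W b $$ (p mod ?m, q mod ?m))"
      unfolding cosum_sum
    proof (intro sum.cong refl)
      fix q assume "q \<in> {0..<?n * ?m}"
      then have q: "q < ?n * ?m" by simp
      show "?T h $$ (p, q) * A $$ (q div ?m, q mod ?m) = cosum H h (\<lambda>a b.
          V a $$ (p div ?m, q div ?m) * A $$ (q div ?m, q mod ?m) * W b $$ (p mod ?m, q mod ?m))"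
        unfolding tensor_index[OF V W p q] cosum_mult_right[symmetric] by (simp add: mult.commute mult.left_commute)
    qed
    also have "\<dots> = ?D h (p div ?m) (p mod ?m)"
    proof -
      have "(\<Sum>q = 0..<?n * ?m. V a $$ (p div ?m, q div ?m) * A $$ (q div ?m, q mod ?m) * W b $$ (p mod ?m, q mod ?m))
          = (V a * A * transpose_mat (W b)) $$ (p div ?m, p mod ?m)" for a b
        using d by (subst sum_div_mod[where f = "\<lambda>k l. V a $$ (p div ?m, k) * A $$ (k, l) * W b $$ (p mod ?m, l)"])
          (simp add: mat_triple_index[OF cV A transpose_carrier_mat[THEN iffD2, OF cW]] del: index_mult_mat(1))
      then show ?thesis by simp
    qed
    finally show ?thesis .
  qed
  have "hmod_hom (trivial_hmod H) ?T (col_of A) \<longleftrightarrow> (\<forall>h. \<forall>i<?n. \<forall>j<?m. ?D h i j = eps h * A $$ (i, j))"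
    unfolding hmod_hom_from_trivial tensor_hdim
  proof (intro iffI conjI allI impI col_of_carrier[OF A])
    fix h i j assume "col_of A \<in> carrier_mat (?n * ?m) 1 \<and> (\<forall>h. ?T h * col_of A = eps h \<cdot>\<^sub>m col_of A)"
      and ij: "i < ?n" "j < ?m"
    then have e: "?T h * col_of A = eps h \<cdot>\<^sub>m col_of A" by blast
    have "i * ?m + j < Suc i * ?m" using ij by simp
    also have "\<dots> \<le> ?n * ?m" using ij by (intro mult_le_mono1) simp
    finally have p: "i * ?m + j < ?n * ?m" .
    have dm: "(i * ?m + j) div ?m = i" "(i * ?m + j) mod ?m = j" using ij by auto
    show "?D h i j = eps h * A $$ (i, j)"
      using ij lhs[OF p, of h, unfolded e dm] p col_of_carrier[OF A] by (simp add: col_of_index[OF A p] dm)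
  next
    fix h assume e: "\<forall>h. \<forall>i<?n. \<forall>j<?m. ?D h i j = eps h * A $$ (i, j)"
    show "?T h * col_of A = eps h \<cdot>\<^sub>m col_of A"
    proof (rule eq_matI)
      fix p q assume "p < dim_row (eps h \<cdot>\<^sub>m col_of A)" "q < dim_col (eps h \<cdot>\<^sub>m col_of A)"
      then have p: "p < ?n * ?m" "q = 0" using col_of_carrier[OF A] by auto
      show "(?T h * col_of A) $$ (p, q) = (eps h \<cdot>\<^sub>m col_of A) $$ (p, q)"
        using p div_mod_bounds[OF p(1)] col_of_carrier[OF A] e
        by (simp add: lhs[OF p(1)] col_of_index[OF A p(1)])
    qed (use col_of_carrier[OF A] tensor_carrier[of V W h] in auto)
  qed
  also have "\<dots> \<longleftrightarrow> (\<forall>h. V (ant h) * A = A * transpose_mat (W h))"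
  proof
    assume c: "\<forall>h. V (ant h) * A = A * transpose_mat (W h)"
    show "\<forall>h. \<forall>i<?n. \<forall>j<?m. ?D h i j = eps h * A $$ (i, j)"
    proof (intro allI impI)
      fix h i j assume ij: "i < ?n" "j < ?m"
      have e: "V a * A * transpose_mat (W b) = V (a * ant b) * A" for a b
        using c by (simp add: mat_assoc hmod_simps(3)[OF V])
      have "linear_form H (\<lambda>x. (V x * A) $$ (i, j))"
        using ij by (simp add: linear_form_iff hmod_simps[OF V] mat_add_mult mat_smult_mult del: index_mult_mat(1))
      from cosum_antipode_right[OF this, of h] show "?D h i j = eps h * A $$ (i, j)"
        using A by (simp add: e hmod_simps(4)[OF V] del: index_mult_mat(1))
    qed
  next
    assume e: "\<forall>h. \<forall>i<?n. \<forall>j<?m. ?D h i j = eps h * A $$ (i, j)"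
    show "\<forall>h. V (ant h) * A = A * transpose_mat (W h)"
    proof (intro allI eq_matI)
      fix h i j assume "i < dim_row (A * transpose_mat (W h))" "j < dim_col (A * transpose_mat (W h))"
      then have ij: "i < ?n" "j < ?m" by auto
      \<comment> \<open>The terms \<open>V(S(h_1)) V(h_2) A W(h_3)^T\<close> are summed in two ways:
        invariance collapses the last two components, the antipode axiom the first two.\<close>
      let ?F = "\<lambda>a u v. (V (ant a) * (V u * A * transpose_mat (W v))) $$ (i, j)"
      note l = linear_form_iff hmod_simps[OF V] hmod_simps[OF W] mat_add_mult mat_mult_add mat_smult_mult
        mat_mult_smult mat_transpose_add mat_transpose_smult ant_add ant_scale
      have "(V (ant h) * A) $$ (i, j) = cosum H h (\<lambda>a b. eps b * (V (ant a) * A) $$ (i, j))"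
        by (rule cosum_counit_right[symmetric]) (use ij in \<open>simp add: l del: index_mult_mat(1)\<close>)
      also have "\<dots> = cosum H h (\<lambda>a b. cosum H b (\<lambda>u v. ?F a u v))"
      proof -
        have "cosum H b (\<lambda>u v. ?F a u v) = eps b * (V (ant a) * A) $$ (i, j)" for a b
        proof -
          have "cosum H b (\<lambda>u v. ?F a u v) =
              cosum H b (\<lambda>u v. \<Sum>k = 0..<?n. V (ant a) $$ (i, k) * (V u * A * transpose_mat (W v)) $$ (k, j))"
            using ij by (simp add: scalar_prod_def)
          also have "\<dots> = (\<Sum>k = 0..<?n. V (ant a) $$ (i, k) * ?D b k j)"
            by (simp only: cosum_sum cosum_mult_left)
          also have "\<dots> = (\<Sum>k = 0..<?n. V (ant a) $$ (i, k) * (eps b * A $$ (k, j)))"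
            using e ij by (intro sum.cong) auto
          also have "\<dots> = eps b * (V (ant a) * A) $$ (i, j)"
            using ij by (simp add: scalar_prod_def sum_distrib_left mult.left_commute)
          finally show ?thesis .
        qed
        then show ?thesis by simp
      qed
      also have "\<dots> = cosum H h (\<lambda>a b. cosum H a (\<lambda>u v. ?F u v b))"
        by (rule cosum_coassoc[symmetric])
          (use ij in \<open>simp add: trilinear_form_def l del: index_mult_mat(1)\<close>)
      also have "\<dots> = cosum H h (\<lambda>a b. eps a * (A * transpose_mat (W b)) $$ (i, j))"
      proof -
        have "cosum H a (\<lambda>u v. ?F u v b) = eps a * (A * transpose_mat (W b)) $$ (i, j)" for a b
        proof -
          have "linear_form H (\<lambda>x. (V x * (A * transpose_mat (W b))) $$ (i, j))"
            using ij by (simp add: l del: index_mult_mat(1))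
          from cosum_antipode_left[OF this, of a] show ?thesis
            using A by (simp add: hmod_simps[OF V] mat_assoc del: index_mult_mat(1))
        qed
        then show ?thesis by simp
      qed
      also have "\<dots> = (A * transpose_mat (W h)) $$ (i, j)"
        by (rule cosum_counit_left) (use ij in \<open>simp add: l del: index_mult_mat(1)\<close>)
      finally show "(V (ant h) * A) $$ (i, j) = (A * transpose_mat (W h)) $$ (i, j)" .
    qed auto
  qed
  finally show ?thesis .
qed

text \<open>Invariant forms on \<open>V \<otimes> W\<close> are module homomorphisms \<open>V \<rightarrow> W\<^sup>*\<close>.\<close>

lemma coinvariant_iff:
  assumes V: "is_hmod H V" and W: "is_hmod H W" and A: "A \<in> carrier_mat (hdim V) (hdim W)"
  shows "hmod_hom (tensor_hmod H V W) (trivial_hmod H) (transpose_mat (col_of A)) \<longleftrightarrow>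
    (\<forall>h. transpose_mat (V h) * A = A * W (ant h))"
proof -
  let ?n = "hdim V" and ?m = "hdim W" and ?T = "tensor_hmod H V W"
  note cV = hmod_carrier[OF V] and cW = hmod_carrier[OF W]
  note [simp] = hmod_dim[OF V] hmod_dim[OF W] carrier_matD[OF A]
  let ?D = "\<lambda>h i j. cosum H h (\<lambda>a b. (transpose_mat (V a) * A * W b) $$ (i, j))"
  have lhs: "(transpose_mat (col_of A) * ?T h) $$ (0, p) = ?D h (p div ?m) (p mod ?m)" if p: "p < ?n * ?m" for h p
  proof -
    note d = div_mod_bounds[OF p]
    have "(transpose_mat (col_of A) * ?T h) $$ (0, p) = (\<Sum>q = 0..<?n * ?m. ?T h $$ (q, p) * A $$ (q div ?m, q mod ?m))"
      using p col_of_carrier[OF A] tensor_carrier[of V W h]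
      by (auto simp: scalar_prod_def col_of_index[OF A] mult.commute intro!: sum.cong)
    also have "\<dots> = cosum H h (\<lambda>a b. \<Sum>q = 0..<?n * ?m.
        V a $$ (q div ?m, p div ?m) * A $$ (q div ?m, q mod ?m) * W b $$ (q mod ?m, p mod ?m))"
      unfolding cosum_sum
    proof (intro sum.cong refl)
      fix q assume "q \<in> {0..<?n * ?m}"
      then have q: "q < ?n * ?m" by simp
      show "?T h $$ (q, p) * A $$ (q div ?m, q mod ?m) = cosum H h (\<lambda>a b.
          V a $$ (q div ?m, p div ?m) * A $$ (q div ?m, q mod ?m) * W b $$ (q mod ?m, p mod ?m))"
        unfolding tensor_index[OF V W q p] cosum_mult_right[symmetric] by (simp add: mult.commute mult.left_commute)
    qed
    also have "\<dots> = ?D h (p div ?m) (p mod ?m)"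
    proof -
      have "(\<Sum>q = 0..<?n * ?m. V a $$ (q div ?m, p div ?m) * A $$ (q div ?m, q mod ?m) * W b $$ (q mod ?m, p mod ?m))
          = (transpose_mat (V a) * A * W b) $$ (p div ?m, p mod ?m)" for a b
        using d by (subst sum_div_mod[where f = "\<lambda>k l. V a $$ (k, p div ?m) * A $$ (k, l) * W b $$ (l, p mod ?m)"])
          (simp add: mat_triple_index[OF transpose_carrier_mat[THEN iffD2, OF cV] A cW] del: index_mult_mat(1))
      then show ?thesis by simp
    qed
    finally show ?thesis .
  qed
  have ct: "transpose_mat (col_of A) \<in> carrier_mat 1 (?n * ?m)" using col_of_carrier[OF A] by simp
  have "hmod_hom ?T (trivial_hmod H) (transpose_mat (col_of A)) \<longleftrightarrow> (\<forall>h. \<forall>i<?n. \<forall>j<?m. ?D h i j = eps h * A $$ (i, j))"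
    unfolding hmod_hom_to_trivial tensor_hdim
  proof (intro iffI conjI allI impI ct)
    fix h i j assume "transpose_mat (col_of A) \<in> carrier_mat 1 (?n * ?m) \<and>
        (\<forall>h. transpose_mat (col_of A) * ?T h = eps h \<cdot>\<^sub>m transpose_mat (col_of A))"
      and ij: "i < ?n" "j < ?m"
    then have e: "transpose_mat (col_of A) * ?T h = eps h \<cdot>\<^sub>m transpose_mat (col_of A)" by blast
    have "i * ?m + j < Suc i * ?m" using ij by simp
    also have "\<dots> \<le> ?n * ?m" using ij by (intro mult_le_mono1) simp
    finally have p: "i * ?m + j < ?n * ?m" .
    have dm: "(i * ?m + j) div ?m = i" "(i * ?m + j) mod ?m = j" using ij by auto
    show "?D h i j = eps h * A $$ (i, j)"
      using ij lhs[OF p, of h, unfolded e dm] p col_of_carrier[OF A] by (simp add: col_of_index[OF A p] dm)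
  next
    fix h assume e: "\<forall>h. \<forall>i<?n. \<forall>j<?m. ?D h i j = eps h * A $$ (i, j)"
    show "transpose_mat (col_of A) * ?T h = eps h \<cdot>\<^sub>m transpose_mat (col_of A)"
    proof (rule eq_matI)
      fix q p assume "q < dim_row (eps h \<cdot>\<^sub>m transpose_mat (col_of A))" "p < dim_col (eps h \<cdot>\<^sub>m transpose_mat (col_of A))"
      then have p: "p < ?n * ?m" "q = 0" using col_of_carrier[OF A] by auto
      show "(transpose_mat (col_of A) * ?T h) $$ (q, p) = (eps h \<cdot>\<^sub>m transpose_mat (col_of A)) $$ (q, p)"
        using p div_mod_bounds[OF p(1)] col_of_carrier[OF A] e
        by (simp add: lhs[OF p(1)] col_of_index[OF A p(1)] del: index_mult_mat(1))
    qed (use col_of_carrier[OF A] tensor_carrier[of V W h] in auto)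
  qed
  also have "\<dots> \<longleftrightarrow> (\<forall>h. transpose_mat (V h) * A = A * W (ant h))"
  proof
    assume c: "\<forall>h. transpose_mat (V h) * A = A * W (ant h)"
    show "\<forall>h. \<forall>i<?n. \<forall>j<?m. ?D h i j = eps h * A $$ (i, j)"
    proof (intro allI impI)
      fix h i j assume ij: "i < ?n" "j < ?m"
      have e: "transpose_mat (V a) * A * W b = A * W (ant a * b)" for a b
        using c by (simp add: mat_assoc hmod_simps(3)[OF W])
      have "linear_form H (\<lambda>x. (A * W x) $$ (i, j))"
        using ij by (simp add: linear_form_iff hmod_simps[OF W] mat_mult_add mat_mult_smult del: index_mult_mat(1))
      from cosum_antipode_left[OF this, of h] show "?D h i j = eps h * A $$ (i, j)"
        using A by (simp add: e hmod_simps(4)[OF W] del: index_mult_mat(1))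
    qed
  next
    assume e: "\<forall>h. \<forall>i<?n. \<forall>j<?m. ?D h i j = eps h * A $$ (i, j)"
    show "\<forall>h. transpose_mat (V h) * A = A * W (ant h)"
    proof (intro allI eq_matI)
      fix h i j assume "i < dim_row (A * W (ant h))" "j < dim_col (A * W (ant h))"
      then have ij: "i < ?n" "j < ?m" by auto
      \<comment> \<open>The terms \<open>V(h_1)^T A W(h_2) W(S(h_3))\<close> are summed in two ways:
        the antipode axiom collapses the last two components, invariance the first two.\<close>
      let ?F = "\<lambda>u v b. (transpose_mat (V u) * A * W v * W (ant b)) $$ (i, j)"
      note l = linear_form_iff hmod_simps[OF V] hmod_simps[OF W] mat_add_mult mat_mult_add mat_smult_mult
        mat_mult_smult mat_transpose_add mat_transpose_smult ant_add ant_scale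
      have "(transpose_mat (V h) * A) $$ (i, j) = cosum H h (\<lambda>a b. eps b * (transpose_mat (V a) * A) $$ (i, j))"
        by (rule cosum_counit_right[symmetric]) (use ij in \<open>simp add: l del: index_mult_mat(1)\<close>)
      also have "\<dots> = cosum H h (\<lambda>a b. cosum H b (\<lambda>v b. ?F a v b))"
      proof -
        have "cosum H b (\<lambda>v b. ?F a v b) = eps b * (transpose_mat (V a) * A) $$ (i, j)" for a b
        proof -
          have "linear_form H (\<lambda>x. (transpose_mat (V a) * A * W x) $$ (i, j))"
            using ij by (simp add: l del: index_mult_mat(1))
          from cosum_antipode_right[OF this, of b] show ?thesis
            using A by (simp add: hmod_simps[OF W] mat_assoc del: index_mult_mat(1))
        qed
        then show ?thesis by simp
      qed
      also have "\<dots> = cosum H h (\<lambda>a b. cosum H a (\<lambda>u v. ?F u v b))"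
        by (rule cosum_coassoc[symmetric])
          (use ij in \<open>simp add: trilinear_form_def l del: index_mult_mat(1)\<close>)
      also have "\<dots> = cosum H h (\<lambda>a b. eps a * (A * W (ant b)) $$ (i, j))"
      proof -
        have "cosum H a (\<lambda>u v. ?F u v b) = eps a * (A * W (ant b)) $$ (i, j)" for a b
        proof -
          have "cosum H a (\<lambda>u v. ?F u v b) =
              cosum H a (\<lambda>u v. \<Sum>k = 0..<?m. (transpose_mat (V u) * A * W v) $$ (i, k) * W (ant b) $$ (k, j))"
            using ij by (simp add: scalar_prod_def)
          also have "\<dots> = (\<Sum>k = 0..<?m. ?D a i k * W (ant b) $$ (k, j))"
            by (simp only: cosum_sum cosum_mult_right)
          also have "\<dots> = (\<Sum>k = 0..<?m. (eps a * A $$ (i, k)) * W (ant b) $$ (k, j))"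
            using e ij by (intro sum.cong) auto
          also have "\<dots> = eps a * (A * W (ant b)) $$ (i, j)"
            using ij by (simp add: scalar_prod_def sum_distrib_left mult.assoc)
          finally show ?thesis .
        qed
        then show ?thesis by simp
      qed
      also have "\<dots> = (A * W (ant h)) $$ (i, j)"
        by (rule cosum_counit_left) (use ij in \<open>simp add: l del: index_mult_mat(1)\<close>)
      finally show "(transpose_mat (V h) * A) $$ (i, j) = (A * W (ant h)) $$ (i, j)" .
    qed auto
  qed
  finally show ?thesis .
qed

section \<open>Splitting the trivial module off a tensor product\<close>

text \<open>The module form of \<open>[T : 1] \<noteq> 0\<close>; the translation is
  \<open>class_decomp_summand\<close>.\<close>

definition trivial_summand :: "('k, 'h) hmod \<Rightarrow> bool" where
  "trivial_summand T \<longleftrightarrow> (\<exists>M. is_hmod H M \<and> hmod_iso T (direct_sum_hmod (trivial_hmod H) M))"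

text \<open>A splitting consists of homomorphisms \<open>k -> V \<otimes> W\<close> and
  \<open>V \<otimes> W -> k\<close> with composite \<open>1\<close>. They are vectorised matrices
  \<open>A\<close> and \<open>B\<close>, the two commutation rules are their equivariance, and the
  composite is the trace.\<close>

theorem tensor_trivial_summand_iff:
  assumes V: "is_hmod H V" and W: "is_hmod H W"
  shows "trivial_summand (tensor_hmod H V W) \<longleftrightarrow>
    (\<exists>A\<in>carrier_mat (hdim V) (hdim W). \<exists>B\<in>carrier_mat (hdim V) (hdim W).
      (\<forall>h. V (ant h) * A = A * transpose_mat (W h)) \<and> (\<forall>h. transpose_mat (V h) * B = B * W (ant h)) \<and>
      mat_trace (transpose_mat B * A) \<noteq> 0)"
proof
  let ?T = "tensor_hmod H V W" and ?k = "trivial_hmod H"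
  have T: "is_hmod H ?T" using tensor_hmod[OF V W] .
  assume "trivial_summand ?T"
  then obtain M where "is_hmod H M" "hmod_iso ?T (direct_sum_hmod ?k M)" by (auto simp: trivial_summand_def)
  then obtain x j y q where "biproduct ?T ?k M x j y q"
    using iso_direct_sum_biproduct[OF T trivial_hmod] by blast
  then have x: "hmod_hom ?k ?T x" and y: "hmod_hom ?T ?k y" and yx: "y * x = 1\<^sub>m 1"
    by (auto simp: biproduct_def trivial_hdim)
  have xc: "x \<in> carrier_mat (hdim V * hdim W) 1" using hmod_hom_carrier[OF x] by (simp add: tensor_hdim trivial_hdim)
  have yc: "transpose_mat y \<in> carrier_mat (hdim V * hdim W) 1"
    using hmod_hom_carrier[OF y] by (simp add: tensor_hdim trivial_hdim)
  obtain A where A: "A \<in> carrier_mat (hdim V) (hdim W)" "x = col_of A" using col_of_surj[OF xc] .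
  obtain B where B: "B \<in> carrier_mat (hdim V) (hdim W)" "transpose_mat y = col_of B" using col_of_surj[OF yc] .
  have yB: "y = transpose_mat (col_of B)" using B(2) by (metis transpose_transpose)
  have "mat_trace (transpose_mat B * A) \<cdot>\<^sub>m 1\<^sub>m 1 = 1\<^sub>m 1"
    using col_of_inner[OF B(1) A(1)] yx yB A(2) by simp
  from arg_cong[OF this, of "\<lambda>M. M $$ (0, 0)"] have "mat_trace (transpose_mat B * A) \<noteq> 0" by auto
  then show "\<exists>A\<in>carrier_mat (hdim V) (hdim W). \<exists>B\<in>carrier_mat (hdim V) (hdim W).
      (\<forall>h. V (ant h) * A = A * transpose_mat (W h)) \<and> (\<forall>h. transpose_mat (V h) * B = B * W (ant h)) \<and>
      mat_trace (transpose_mat B * A) \<noteq> 0"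
    using A B x y yB invariant_iff[OF V W A(1)] coinvariant_iff[OF V W B(1)] by blast
next
  let ?T = "tensor_hmod H V W" and ?k = "trivial_hmod H"
  have T: "is_hmod H ?T" using tensor_hmod[OF V W] .
  assume "\<exists>A\<in>carrier_mat (hdim V) (hdim W). \<exists>B\<in>carrier_mat (hdim V) (hdim W).
      (\<forall>h. V (ant h) * A = A * transpose_mat (W h)) \<and> (\<forall>h. transpose_mat (V h) * B = B * W (ant h)) \<and>
      mat_trace (transpose_mat B * A) \<noteq> 0"
  then obtain A B where A: "A \<in> carrier_mat (hdim V) (hdim W)" and B: "B \<in> carrier_mat (hdim V) (hdim W)"
    and iA: "\<forall>h. V (ant h) * A = A * transpose_mat (W h)" and iB: "\<forall>h. transpose_mat (V h) * B = B * W (ant h)"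
    and tr: "mat_trace (transpose_mat B * A) \<noteq> 0" (is "?c \<noteq> 0") by blast
  have x: "hmod_hom ?k ?T (col_of A)" using invariant_iff[OF V W A] iA by blast
  have y: "hmod_hom ?T ?k (transpose_mat (col_of B))" using coinvariant_iff[OF V W B] iB by blast
  \<comment> \<open>The trace is only known to be nonzero; dividing by it makes the composite the
    identity.\<close>
  let ?y = "(1 / ?c) \<cdot>\<^sub>m transpose_mat (col_of B)"
  have yT: "hmod_hom ?T ?k ?y"
    using y hmod_hom_dim[OF y] hmod_dim[OF T] hmod_dim[OF trivial_hmod] unfolding hmod_hom_def
    by (auto simp: mat_smult_mult mat_mult_smult)
  have "?y * col_of A = (1 / ?c) \<cdot>\<^sub>m (?c \<cdot>\<^sub>m 1\<^sub>m 1)"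
    using col_of_inner[OF B A] hmod_hom_dim[OF y] hmod_hom_dim[OF x] by (simp add: mat_smult_mult)
  also have "\<dots> = 1\<^sub>m 1" using tr by (intro eq_matI) auto
  finally have "?y * col_of A = 1\<^sub>m (hdim ?k)" by (simp add: trivial_hdim)
  from hmod_split[OF trivial_hmod T x yT this] show "trivial_summand ?T"
    using biproduct_iso_direct_sum[OF T trivial_hmod] unfolding trivial_summand_def by blast
qed

text \<open>With the dual of \<open>V\<close> as right factor the identity matrix is an invariant,
  the coevaluation. The pair \<open>A\<close>, \<open>B\<close> is replaced by \<open>1\<close> and
  \<open>B A^T\<close>, and cyclicity keeps the trace.\<close>

theorem trivial_summand_dual_right:
  assumes V: "is_hmod H V" and W: "is_hmod H W" and s: "trivial_summand (tensor_hmod H V W)"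
  shows "trivial_summand (tensor_hmod H V (dual_hmod H V))"
proof -
  obtain A B where A: "A \<in> carrier_mat (hdim V) (hdim W)" and B: "B \<in> carrier_mat (hdim V) (hdim W)"
    and iA: "\<And>h. V (ant h) * A = A * transpose_mat (W h)" and iB: "\<And>h. transpose_mat (V h) * B = B * W (ant h)"
    and tr: "mat_trace (transpose_mat B * A) \<noteq> 0"
    using s unfolding tensor_trivial_summand_iff[OF V W] by blast
  note [simp] = hmod_dim[OF V] hmod_dim[OF W] carrier_matD[OF A] carrier_matD[OF B]
  have cV: "V h \<in> carrier_mat (hdim V) (hdim V)" for h using hmod_carrier[OF V] .
  have 1: "transpose_mat (V h) * (B * transpose_mat A) = B * transpose_mat A * dual_hmod H V (ant h)" for h
  proof -
    have 1: "transpose_mat (V h) * (B * transpose_mat A) = B * (W (ant h) * transpose_mat A)"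
      using iB[of h] by (simp add: mat_assoc flip: mat_assoc)
    also have "W (ant h) * transpose_mat A = transpose_mat (A * transpose_mat (W (ant h)))"
      by (simp add: mat_transpose_mult)
    also have "\<dots> = transpose_mat A * dual_hmod H V (ant h)"
      unfolding iA[symmetric] by (simp add: mat_transpose_mult dual_hmod_def)
    finally show ?thesis by (simp add: mat_assoc dual_hmod_def)
  qed
  have 2: "V (ant h) * 1\<^sub>m (hdim V) = 1\<^sub>m (hdim V) * transpose_mat (dual_hmod H V h)" for h
    using cV[of "ant h"] by (simp add: dual_hmod_def)
  have 3: "mat_trace (transpose_mat (B * transpose_mat A) * 1\<^sub>m (hdim V)) = mat_trace (transpose_mat B * A)"
  proof -
    have "transpose_mat (B * transpose_mat A) * 1\<^sub>m (hdim V) = A * transpose_mat B"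
      using A B by (simp add: mat_transpose_mult right_mult_one_mat[of _ "hdim V"])
    then show ?thesis using A B by (simp add: mat_trace_mult_comm[of A "hdim V" "hdim W"])
  qed
  show ?thesis
    unfolding tensor_trivial_summand_iff[OF V dual_hmod[OF V]] dual_hdim[OF V]
  proof (rule bexI[of _ "1\<^sub>m (hdim V)"], rule bexI[of _ "B * transpose_mat A"], intro conjI allI)
    show "mat_trace (transpose_mat (B * transpose_mat A) * 1\<^sub>m (hdim V)) \<noteq> 0" using tr unfolding 3 .
  qed (fact 2, fact 1, use A B in auto)
qed

text \<open>With the dual of \<open>W\<close> as left factor the identity matrix is an invariant
  form, the evaluation. The pair \<open>A\<close>, \<open>B\<close> is replaced by
  \<open>B^T A\<close> and \<open>1\<close>, with the same trace.\<close>

theorem trivial_summand_dual_left: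
  assumes V: "is_hmod H V" and W: "is_hmod H W" and s: "trivial_summand (tensor_hmod H V W)"
  shows "trivial_summand (tensor_hmod H (dual_hmod H W) W)"
proof -
  obtain A B where A: "A \<in> carrier_mat (hdim V) (hdim W)" and B: "B \<in> carrier_mat (hdim V) (hdim W)"
    and iA: "\<And>h. V (ant h) * A = A * transpose_mat (W h)" and iB: "\<And>h. transpose_mat (V h) * B = B * W (ant h)"
    and tr: "mat_trace (transpose_mat B * A) \<noteq> 0"
    using s unfolding tensor_trivial_summand_iff[OF V W] by blast
  note [simp] = hmod_dim[OF V] hmod_dim[OF W] carrier_matD[OF A] carrier_matD[OF B]
  have 1: "dual_hmod H W (ant h) * (transpose_mat B * A) = transpose_mat B * A * transpose_mat (W h)" for h
  proof -
    have "dual_hmod H W (ant h) * transpose_mat B = transpose_mat (B * W (ant (ant h)))"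
      by (simp add: mat_transpose_mult dual_hmod_def)
    also have "\<dots> = transpose_mat B * V (ant h)" unfolding iB[symmetric] by (simp add: mat_transpose_mult)
    finally have "dual_hmod H W (ant h) * transpose_mat B * A = transpose_mat B * (V (ant h) * A)"
      by (simp add: mat_assoc)
    then show ?thesis unfolding iA by (simp add: mat_assoc dual_hmod_def)
  qed
  have 2: "transpose_mat (dual_hmod H W h) * 1\<^sub>m (hdim W) = 1\<^sub>m (hdim W) * W (ant h)" for h
    using hmod_carrier[OF W, of "ant h"] by (simp add: dual_hmod_def)
  have 3: "transpose_mat (1\<^sub>m (hdim W)) * (transpose_mat B * A) = transpose_mat B * A"
    using left_mult_one_mat[of "transpose_mat B * A" "hdim W" "hdim W"] A B by (simp add: mult_carrier_mat[of _ _ "hdim V"])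
  show ?thesis
    unfolding tensor_trivial_summand_iff[OF dual_hmod[OF W] W] dual_hdim[OF W]
  proof (rule bexI[of _ "transpose_mat B * A"], rule bexI[of _ "1\<^sub>m (hdim W)"], intro conjI allI)
    show "mat_trace (transpose_mat (1\<^sub>m (hdim W)) * (transpose_mat B * A)) \<noteq> 0" using tr unfolding 3 .
  qed (fact 1, fact 2, use A B in auto)
qed

text \<open>The matrices \<open>A\<^sup>T B\<close> and \<open>B A\<^sup>T\<close> are homomorphisms up to the twist by \<open>S\<^sup>2\<close> and have nonzero trace,
  so both are invertible; therefore \<open>A\<^sup>T\<close> is an isomorphism \<open>V\<^sup>* \<rightarrow> W\<close>.\<close>

theorem trivial_summand_imp_dual:
  assumes V: "indecomposable_hmod H V" and W: "indecomposable_hmod H W"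
    and s: "trivial_summand (tensor_hmod H V W)"
  shows "hmod_iso W (dual_hmod H V)"
proof -
  note mV = indecomposable_hmod_is_hmod[OF V] and mW = indecomposable_hmod_is_hmod[OF W]
  obtain A B where A: "A \<in> carrier_mat (hdim V) (hdim W)" and B: "B \<in> carrier_mat (hdim V) (hdim W)"
    and iA: "\<And>h. V (ant h) * A = A * transpose_mat (W h)" and iB: "\<And>h. transpose_mat (V h) * B = B * W (ant h)"
    and tr: "mat_trace (transpose_mat B * A) \<noteq> 0"
    using s unfolding tensor_trivial_summand_iff[OF mV mW] by blast
  note [simp] = hmod_dim[OF mV] hmod_dim[OF mW] carrier_matD[OF A] carrier_matD[OF B]
  let ?s = "\<lambda>h. ant (ant h)"
  have s: "surj ?s" using surj_antipode comp_surj[of ant ant] by (simp add: comp_def)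
  define M where "M = transpose_mat (transpose_mat B * A)"
  define N where "N = transpose_mat (A * transpose_mat B)"
  have M: "M \<in> carrier_mat (hdim W) (hdim W)" and N: "N \<in> carrier_mat (hdim V) (hdim V)"
    using A B by (auto simp: M_def N_def)
  note [simp] = carrier_matD[OF M] carrier_matD[OF N]
  have M': "M = transpose_mat A * B" and N': "N = B * transpose_mat A"
    by (simp_all add: M_def N_def mat_transpose_mult)
  have WM: "W h * M = M * W (?s h)" for h
  proof -
    have "W h * transpose_mat A = transpose_mat (A * transpose_mat (W h))" by (simp add: mat_transpose_mult)
    also have "\<dots> = transpose_mat A * transpose_mat (V (ant h))"
      unfolding iA[symmetric] by (simp add: mat_transpose_mult)
    finally have "W h * transpose_mat A * B = transpose_mat A * (transpose_mat (V (ant h)) * B)"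
      by (simp add: mat_assoc)
    then show ?thesis unfolding iB M' by (simp add: mat_assoc)
  qed
  have VN: "dual_hmod H V h * N = N * dual_hmod H V (?s h)" for h
  proof -
    have "dual_hmod H V h * B = B * W (?s h)" using iB[of "ant h"] by (simp add: dual_hmod_def)
    then have "dual_hmod H V h * B * transpose_mat A = B * (W (?s h) * transpose_mat A)"
      by (simp add: mat_assoc)
    also have "W (?s h) * transpose_mat A = transpose_mat (A * transpose_mat (W (?s h)))"
      by (simp add: mat_transpose_mult)
    also have "\<dots> = transpose_mat A * dual_hmod H V (?s h)"
      unfolding iA[symmetric] by (simp add: mat_transpose_mult dual_hmod_def)
    finally show ?thesis unfolding N' by (simp add: mat_assoc dual_hmod_def)
  qed
  have trM: "mat_trace M \<noteq> 0"
    using tr M unfolding M_def by (simp add: mat_trace_transpose[of _ "hdim W"])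
  have trN: "mat_trace N \<noteq> 0"
    using tr A B N unfolding N' by (simp add: mat_trace_mult_comm[of B "hdim V" "hdim W"])
      (metis M' M_def trM)
  have "det M \<noteq> 0" using indecomposable_twisted_fitting[OF W M s WM] trM by blast
  then obtain M1 where M1: "M1 \<in> carrier_mat (hdim W) (hdim W)" "M * M1 = 1\<^sub>m (hdim W)" "M1 * M = 1\<^sub>m (hdim W)"
    using invertible_det_obtain[OF M] by blast
  have "det N \<noteq> 0"
    using indecomposable_twisted_fitting[OF dual_indecomposable[OF V], unfolded dual_hdim[OF mV], OF N s VN] trN by blast
  then obtain N1 where N1: "N1 \<in> carrier_mat (hdim V) (hdim V)" "N * N1 = 1\<^sub>m (hdim V)" "N1 * N = 1\<^sub>m (hdim V)"
    using invertible_det_obtain[OF N] by blast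
  note [simp] = carrier_matD[OF M1(1)] carrier_matD[OF N1(1)]
  let ?A = "transpose_mat A" and ?L = "N1 * B"
  have AR: "?A * (B * M1) = 1\<^sub>m (hdim W)" using M1(2) unfolding M' by (simp add: mat_assoc)
  have LA: "?L * ?A = 1\<^sub>m (hdim V)" using N1(3) unfolding N' by (simp add: mat_assoc)
  \<comment> \<open>\<open>M\<close> provides a right inverse of \<open>A^T\<close> and
    \<open>N\<close> a left inverse; hence the two coincide.\<close>
  have "?L = ?L * (?A * (B * M1))" unfolding AR using N1(1) B by (simp add: right_mult_one_mat[of _ "hdim V"])
  also have "\<dots> = (?L * ?A) * (B * M1)" by (simp add: mat_assoc)
  also have "\<dots> = B * M1" unfolding LA using B M1(1) by (simp add: left_mult_one_mat[of _ _ "hdim W"])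
  finally have L: "?L = B * M1" .
  have "hmod_hom (dual_hmod H V) W ?A" unfolding hmod_hom_def dual_hdim[OF mV]
  proof (intro conjI allI)
    fix h
    have "?A * dual_hmod H V h = transpose_mat (V (ant h) * A)" by (simp add: mat_transpose_mult dual_hmod_def)
    also have "\<dots> = W h * ?A" unfolding iA by (simp add: mat_transpose_mult)
    finally show "?A * dual_hmod H V h = W h * ?A" .
  qed (use A in auto)
  from hmod_isoI[OF this, of ?L] have "hmod_iso (dual_hmod H V) W"
    using AR LA L mult_carrier_mat[OF N1(1) B] by (simp add: dual_hdim[OF mV])
  then show ?thesis using hmod_iso_sym[OF dual_hmod[OF mV] mW] by blast
qed

end

section \<open>Rings with an integral basis and a duality on it\<close>

context abelian_group
begin

lemma int_comb_superset:
  assumes "finite K" "K \<subseteq> carrier G" "Poly_Mapping.keys n \<subseteq> K"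
  shows "int_comb G n = (\<Oplus>b\<in>K. [Poly_Mapping.lookup n b] \<cdot> b)"
proof -
  have "[(0::int)] \<cdot> x = \<zero>" for x by (simp add: add_pow_def)
  then show ?thesis unfolding int_comb_def
    by (intro add.finprod_mono_neutral_cong_left) (use assms in \<open>auto simp: in_keys_iff Pi_def\<close>)
qed

lemma int_comb_closed:
  "Poly_Mapping.keys n \<subseteq> carrier G \<Longrightarrow> int_comb G n \<in> carrier G"
  unfolding int_comb_def by (rule finsum_closed) auto

lemma int_comb_zero: "int_comb G 0 = \<zero>"
  by (simp add: int_comb_def)

lemma int_comb_frag_of: "b \<in> carrier G \<Longrightarrow> int_comb G (frag_of b) = b"
  using add.int_pow_1[of b] by (simp add: int_comb_def)

lemma int_comb_add:
  assumes "Poly_Mapping.keys m \<subseteq> carrier G" "Poly_Mapping.keys n \<subseteq> carrier G"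
  shows "int_comb G (m + n) = int_comb G m \<oplus> int_comb G n"
proof -
  let ?K = "Poly_Mapping.keys m \<union> Poly_Mapping.keys n"
  have K: "finite ?K" "?K \<subseteq> carrier G" using assms by auto
  have "int_comb G (m + n) = (\<Oplus>b\<in>?K. [Poly_Mapping.lookup (m + n) b] \<cdot> b)"
    by (rule int_comb_superset[OF K]) (rule Poly_Mapping.keys_add)
  also have "\<dots> = (\<Oplus>b\<in>?K. [Poly_Mapping.lookup m b] \<cdot> b \<oplus> [Poly_Mapping.lookup n b] \<cdot> b)"
    by (rule add.finprod_cong') (use K in \<open>auto simp: lookup_add add.int_pow_mult Pi_def\<close>)
  also have "\<dots> = (\<Oplus>b\<in>?K. [Poly_Mapping.lookup m b] \<cdot> b) \<oplus> (\<Oplus>b\<in>?K. [Poly_Mapping.lookup n b] \<cdot> b)"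
    by (rule finsum_addf) (use K in auto)
  also have "\<dots> = int_comb G m \<oplus> int_comb G n"
    using int_comb_superset[OF K, of m] int_comb_superset[OF K, of n] by simp
  finally show ?thesis .
qed

lemma int_comb_diff:
  assumes "Poly_Mapping.keys m \<subseteq> carrier G" "Poly_Mapping.keys n \<subseteq> carrier G"
  shows "int_comb G (m - n) = int_comb G m \<ominus> int_comb G n"
proof -
  have k: "Poly_Mapping.keys (m - n) \<subseteq> carrier G" using keys_diff[of m n] assms by blast
  have "int_comb G m = int_comb G (m - n) \<oplus> int_comb G n"
    using int_comb_add[OF k assms(2)] by simp
  then show ?thesis using int_comb_closed[OF k] int_comb_closed[OF assms(2)]
    by (simp add: minus_eq add.m_assoc r_neg)
qed

lemma int_comb_additive:
  fixes L :: "'a \<Rightarrow> int"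
  assumes L: "\<And>x y. x \<in> carrier G \<Longrightarrow> y \<in> carrier G \<Longrightarrow> L (x \<oplus> y) = L x + L y"
    and n: "Poly_Mapping.keys n \<subseteq> carrier G"
  shows "L (int_comb G n) = (\<Sum>b\<in>Poly_Mapping.keys n. Poly_Mapping.lookup n b * L b)"
proof -
  let ?S = "\<lambda>n. \<Sum>b\<in>Poly_Mapping.keys n. Poly_Mapping.lookup n b * L b"
  have sup: "?S n = (\<Sum>b\<in>K. Poly_Mapping.lookup n b * L b)" if "finite K" "Poly_Mapping.keys n \<subseteq> K" for n K
    using that by (intro sum.mono_neutral_left) (auto simp: in_keys_iff)
  have "Poly_Mapping.keys n \<subseteq> carrier G \<and> L (int_comb G n) = ?S n"
    using n
  proof (induction n rule: frag_induction)
    case zero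
    have "L \<zero> = L \<zero> + L \<zero>" using L[of \<zero> \<zero>] by simp
    then show ?case by (simp add: int_comb_zero)
  next
    case (one x)
    then show ?case by (simp add: int_comb_frag_of)
  next
    case (diff a b)
    then have k: "Poly_Mapping.keys a \<subseteq> carrier G" "Poly_Mapping.keys b \<subseteq> carrier G"
      "Poly_Mapping.keys (a - b) \<subseteq> carrier G"
      using keys_diff[of a b] by auto
    have "int_comb G a = int_comb G (a - b) \<oplus> int_comb G b"
      using int_comb_add[OF k(3,2)] by simp
    then have "L (int_comb G (a - b)) = L (int_comb G a) - L (int_comb G b)"
      using L[OF int_comb_closed[OF k(3)] int_comb_closed[OF k(2)]] by simp
    also have "\<dots> = ?S a - ?S b" using diff by simp
    also have "\<dots> = ?S (a - b)"
    proof -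
      let ?K = "Poly_Mapping.keys a \<union> Poly_Mapping.keys b"
      have "?S a = (\<Sum>b\<in>?K. Poly_Mapping.lookup a b * L b)"
        "?S b = (\<Sum>c\<in>?K. Poly_Mapping.lookup b c * L c)"
        "?S (a - b) = (\<Sum>c\<in>?K. Poly_Mapping.lookup (a - b) c * L c)"
        using keys_diff[of a b] by (intro sup; simp)+
      then show ?thesis by (simp add: lookup_minus left_diff_distrib sum_subtractf)
    qed
    finally show ?case using k by blast
  qed
  then show ?thesis by blast
qed

end

text \<open>What the module theory has to deliver, separated from it. The unit axioms come in a left
  and a right version because \<open>st\<close> is injective on \<open>B\<close> but is not assumed
  to be an involution; this mirrors the double dual, which need not be isomorphic to the module it
  comes from.\<close>

locale star_based_ring = ring R for R (structure) +
  fixes B :: "'a set" and st :: "'a \<Rightarrow> 'a"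
  assumes basis_closed: "B \<subseteq> carrier R"
    and basis_unique: "x \<in> carrier R \<Longrightarrow> \<exists>!n. Poly_Mapping.keys n \<subseteq> B \<and> int_comb R n = x"
    and one_basis: "\<one> \<in> B"
    and structure_nonneg: "x \<in> B \<Longrightarrow> y \<in> B \<Longrightarrow> z \<in> B \<Longrightarrow> 0 \<le> basis_coeff R B (x \<otimes> y) z"
    and star_basis: "x \<in> B \<Longrightarrow> st x \<in> B"
    and star_inj: "inj_on st B"
    and unit_star_right: "x \<in> B \<Longrightarrow> y \<in> B \<Longrightarrow> basis_coeff R B (x \<otimes> y) \<one> \<noteq> 0 \<Longrightarrow>
      basis_coeff R B (x \<otimes> st x) \<one> \<noteq> 0"
    and unit_star_left: "x \<in> B \<Longrightarrow> y \<in> B \<Longrightarrow> basis_coeff R B (x \<otimes> y) \<one> \<noteq> 0 \<Longrightarrow>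
      basis_coeff R B (st y \<otimes> y) \<one> \<noteq> 0"
    and unit_star_unique: "x \<in> B \<Longrightarrow> y \<in> B \<Longrightarrow> basis_coeff R B (x \<otimes> y) \<one> \<noteq> 0 \<Longrightarrow> y = st x"
begin

abbreviation coeff :: "'a \<Rightarrow> 'a \<Rightarrow> int" where "coeff \<equiv> basis_coeff R B"

lemma basis_carrier: "b \<in> B \<Longrightarrow> b \<in> carrier R"
  using basis_closed by blast

lemma coords_exist:
  assumes "x \<in> carrier R"
  obtains n where "Poly_Mapping.keys n \<subseteq> B" "int_comb R n = x" "coeff x = Poly_Mapping.lookup n"
proof -
  obtain n where n: "Poly_Mapping.keys n \<subseteq> B" "int_comb R n = x" using basis_unique[OF assms] by blast
  have "(THE n. Poly_Mapping.keys n \<subseteq> B \<and> int_comb R n = x) = n"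
    using basis_unique[OF assms] n by (intro the1_equality) auto
  then show ?thesis using n that by (simp add: basis_coeff_def fun_eq_iff)
qed

lemma coeff_int_comb:
  assumes "Poly_Mapping.keys n \<subseteq> B"
  shows "coeff (int_comb R n) = Poly_Mapping.lookup n"
proof -
  have c: "int_comb R n \<in> carrier R" using assms basis_closed by (intro int_comb_closed) auto
  have "(THE m. Poly_Mapping.keys m \<subseteq> B \<and> int_comb R m = int_comb R n) = n"
    using basis_unique[OF c] assms by (intro the1_equality) auto
  then show ?thesis by (simp add: basis_coeff_def fun_eq_iff)
qed

lemma coeff_outside: "x \<in> carrier R \<Longrightarrow> b \<notin> B \<Longrightarrow> coeff x b = 0"
  by (metis coords_exist in_keys_iff subsetD)

lemma coeff_add:
  assumes "x \<in> carrier R" "y \<in> carrier R"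
  shows "coeff (x \<oplus> y) b = coeff x b + coeff y b"
proof -
  obtain m where m: "Poly_Mapping.keys m \<subseteq> B" "int_comb R m = x" "coeff x = Poly_Mapping.lookup m"
    using coords_exist[OF assms(1)] .
  obtain n where n: "Poly_Mapping.keys n \<subseteq> B" "int_comb R n = y" "coeff y = Poly_Mapping.lookup n"
    using coords_exist[OF assms(2)] .
  have "x \<oplus> y = int_comb R (m + n)" using int_comb_add[of m n] m n basis_closed by auto
  moreover have "Poly_Mapping.keys (m + n) \<subseteq> B" using m n Poly_Mapping.keys_add[of m n] by blast
  ultimately show ?thesis using coeff_int_comb m n by (simp add: lookup_add)
qed

lemma coeff_basis: "b \<in> B \<Longrightarrow> coeff b c = (if c = b then 1 else 0)"
  using coeff_int_comb[of "frag_of b"] int_comb_frag_of[OF basis_carrier] by simp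

text \<open>An additive function is determined by its values on the basis. \<open>L\<close> is
  arbitrary because it will be a coefficient of a product with one factor fixed, on either
  side.\<close>

lemma coeff_expand:
  assumes L: "\<And>x y. x \<in> carrier R \<Longrightarrow> y \<in> carrier R \<Longrightarrow> L (x \<oplus> y) = L x + L y"
    and x: "x \<in> carrier R"
  shows "\<exists>K. finite K \<and> K \<subseteq> B \<and> (\<forall>b. b \<notin> K \<longrightarrow> coeff x b = 0) \<and> L x = (\<Sum>b\<in>K. coeff x b * L b)"
proof -
  obtain n where n: "Poly_Mapping.keys n \<subseteq> B" "int_comb R n = x" "coeff x = Poly_Mapping.lookup n"
    using coords_exist[OF x] .
  have "L x = (\<Sum>b\<in>Poly_Mapping.keys n. coeff x b * L b)"
    using int_comb_additive[of L n, OF L] n basis_closed by auto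
  then show ?thesis using n by (intro exI[of _ "Poly_Mapping.keys n"]) (auto simp: in_keys_iff)
qed

lemma coeff_mult_right_add:
  "z \<in> carrier R \<Longrightarrow> x \<in> carrier R \<Longrightarrow> y \<in> carrier R \<Longrightarrow> coeff (z \<otimes> (x \<oplus> y)) b = coeff (z \<otimes> x) b + coeff (z \<otimes> y) b"
  by (simp add: r_distr coeff_add)

lemma coeff_mult_left_add:
  "z \<in> carrier R \<Longrightarrow> x \<in> carrier R \<Longrightarrow> y \<in> carrier R \<Longrightarrow> coeff ((x \<oplus> y) \<otimes> z) b = coeff (x \<otimes> z) b + coeff (y \<otimes> z) b"
  by (simp add: l_distr coeff_add)

lemma int_span_iff:
  assumes "S \<subseteq> B"
  shows "x \<in> int_span R S \<longleftrightarrow> x \<in> carrier R \<and> (\<forall>b. b \<notin> S \<longrightarrow> coeff x b = 0)"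
proof
  assume "x \<in> int_span R S"
  then obtain n where n: "Poly_Mapping.keys n \<subseteq> S" "x = int_comb R n" by (auto simp: int_span_def)
  then show "x \<in> carrier R \<and> (\<forall>b. b \<notin> S \<longrightarrow> coeff x b = 0)"
    using assms basis_closed coeff_int_comb[of n] int_comb_closed[of n] by (auto simp: in_keys_iff)
next
  assume "x \<in> carrier R \<and> (\<forall>b. b \<notin> S \<longrightarrow> coeff x b = 0)"
  then obtain n where "Poly_Mapping.keys n \<subseteq> B" "int_comb R n = x" "coeff x = Poly_Mapping.lookup n"
    and "\<forall>b. b \<notin> S \<longrightarrow> coeff x b = 0"
    using coords_exist by blast
  then show "x \<in> int_span R S" unfolding int_span_def by (intro CollectI exI[of _ n]) (auto simp: in_keys_iff)
qed

lemma basis_in_span: "S \<subseteq> B \<Longrightarrow> b \<in> B \<Longrightarrow> b \<in> int_span R S \<longleftrightarrow> b \<in> S"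
  by (auto simp: int_span_iff coeff_basis basis_carrier)

lemma int_span_mono_iff: "S \<subseteq> B \<Longrightarrow> T \<subseteq> B \<Longrightarrow> int_span R S \<subseteq> int_span R T \<longleftrightarrow> S \<subseteq> T"
proof
  assume "S \<subseteq> B" "T \<subseteq> B" "int_span R S \<subseteq> int_span R T"
  then show "S \<subseteq> T" using basis_in_span by blast
qed (unfold int_span_def, blast)

lemma int_span_eq_iff: "S \<subseteq> B \<Longrightarrow> T \<subseteq> B \<Longrightarrow> int_span R S = int_span R T \<longleftrightarrow> S = T"
  using int_span_mono_iff[of S T] int_span_mono_iff[of T S] by blast

lemma one_notin_ideal:
  assumes Y: "Y \<subset> B" and I: "ideal (int_span R Y) R"
  shows "\<one> \<notin> Y"
proof
  assume "\<one> \<in> Y"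
  then have "\<one> \<in> int_span R Y" using basis_in_span[of Y \<one>] one_basis Y by blast
  then have "int_span R Y = carrier R" using ideal.one_imp_carrier[OF I] by blast
  then have "B \<subseteq> Y" using basis_in_span[of Y] Y basis_closed by blast
  then show False using Y by blast
qed

lemma ideal_unit_coeff:
  assumes Y: "Y \<subset> B" and I: "ideal (int_span R Y) R" and x: "x \<in> int_span R Y" and y: "y \<in> carrier R"
  shows "coeff (x \<otimes> y) \<one> = 0" "coeff (y \<otimes> x) \<one> = 0"
proof -
  have "x \<otimes> y \<in> int_span R Y" "y \<otimes> x \<in> int_span R Y"
    using ideal.I_r_closed[OF I x y] ideal.I_l_closed[OF I x y] .
  then show "coeff (x \<otimes> y) \<one> = 0" "coeff (y \<otimes> x) \<one> = 0"
    using int_span_iff[of Y] Y one_notin_ideal[OF Y I] by auto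
qed

text \<open>These basis elements span \<open>P_plus\<close>; those of \<open>null_left\<close> span
  \<open>P_minus\<close>.\<close>

definition null_right :: "'a set" where "null_right = {x \<in> B. coeff (x \<otimes> st x) \<one> = 0}"
definition null_left :: "'a set" where "null_left = {x \<in> B. coeff (st x \<otimes> x) \<one> = 0}"

lemma ideal_basis_null:
  assumes "Y \<subset> B" "ideal (int_span R Y) R"
  shows "Y \<subseteq> null_right" "Y \<subseteq> null_left"
proof -
  have "coeff (x \<otimes> st x) \<one> = 0 \<and> coeff (st x \<otimes> x) \<one> = 0" if "x \<in> Y" for x
  proof -
    have "x \<in> B" "x \<in> int_span R Y" using that assms basis_in_span[of Y x] by auto
    then show ?thesis using ideal_unit_coeff[OF assms, of x "st x"] star_basis basis_carrier by blast
  qed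
  then show "Y \<subseteq> null_right" "Y \<subseteq> null_left" using assms by (auto simp: null_right_def null_left_def)
qed

lemma exists_basis_left:
  assumes x: "x \<in> carrier R" and y: "y \<in> carrier R" and "coeff (x \<otimes> y) \<one> \<noteq> 0"
  shows "\<exists>b\<in>B. coeff (b \<otimes> y) \<one> \<noteq> 0"
proof -
  obtain K where K: "finite K" "K \<subseteq> B" "coeff (x \<otimes> y) \<one> = (\<Sum>b\<in>K. coeff x b * coeff (b \<otimes> y) \<one>)"
    using coeff_expand[of "\<lambda>x. coeff (x \<otimes> y) \<one>" x] x y by (auto simp: coeff_mult_left_add)
  show ?thesis
  proof (rule ccontr)
    assume "\<not> ?thesis"
    then have "coeff (x \<otimes> y) \<one> = 0" unfolding K(3) using K(2) by (intro sum.neutral) auto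
    then show False using assms(3) by simp
  qed
qed

lemma exists_basis_right:
  assumes x: "x \<in> carrier R" and y: "y \<in> carrier R" and "coeff (x \<otimes> y) \<one> \<noteq> 0"
  shows "\<exists>b\<in>B. coeff (x \<otimes> b) \<one> \<noteq> 0"
proof -
  obtain K where K: "finite K" "K \<subseteq> B" "coeff (x \<otimes> y) \<one> = (\<Sum>b\<in>K. coeff y b * coeff (x \<otimes> b) \<one>)"
    using coeff_expand[of "\<lambda>y. coeff (x \<otimes> y) \<one>" y] x y by (auto simp: coeff_mult_right_add)
  show ?thesis
  proof (rule ccontr)
    assume "\<not> ?thesis"
    then have "coeff (x \<otimes> y) \<one> = 0" unfolding K(3) using K(2) by (intro sum.neutral) auto
    then show False using assms(3) by simp
  qed
qed

text \<open>When \<open>p\<close> is expanded over the basis, its unit component contributes a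
  positive amount to the coefficient at \<open>z\<close>, and no other component contributes a
  negative one, so nothing cancels.\<close>

lemma coeff_mult_unit_pos:
  assumes p: "p \<in> carrier R" "\<And>b. b \<in> B \<Longrightarrow> 0 \<le> coeff p b" "coeff p \<one> \<noteq> 0" and z: "z \<in> B"
  shows "coeff (p \<otimes> z) z \<noteq> 0" "coeff (z \<otimes> p) z \<noteq> 0"
proof -
  note zc = basis_carrier[OF z]
  have p1: "0 < coeff p \<one>" using p(2,3) one_basis by force
  obtain K where K: "finite K" "K \<subseteq> B" "\<And>b. b \<notin> K \<Longrightarrow> coeff p b = 0"
      "coeff (p \<otimes> z) z = (\<Sum>b\<in>K. coeff p b * coeff (b \<otimes> z) z)"
    using coeff_expand[of "\<lambda>x. coeff (x \<otimes> z) z" p] p zc by (auto simp: coeff_mult_left_add)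
  have "\<one> \<in> K" using K(3) p(3) by blast
  then have "coeff p \<one> * coeff (\<one> \<otimes> z) z \<le> coeff (p \<otimes> z) z"
    unfolding K(4) using K(1,2) p(2) structure_nonneg z
    by (intro member_le_sum) auto
  then show "coeff (p \<otimes> z) z \<noteq> 0" using p1 zc coeff_basis[OF z] by simp
  obtain K where K: "finite K" "K \<subseteq> B" "\<And>b. b \<notin> K \<Longrightarrow> coeff p b = 0"
      "coeff (z \<otimes> p) z = (\<Sum>b\<in>K. coeff p b * coeff (z \<otimes> b) z)"
    using coeff_expand[of "\<lambda>x. coeff (z \<otimes> x) z" p] p zc by (auto simp: coeff_mult_right_add)
  have "\<one> \<in> K" using K(3) p(3) by blast
  then have "coeff p \<one> * coeff (z \<otimes> \<one>) z \<le> coeff (z \<otimes> p) z"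
    unfolding K(4) using K(1,2) p(2) structure_nonneg z
    by (intro member_le_sum) auto
  then show "coeff (z \<otimes> p) z \<noteq> 0" using p1 zc coeff_basis[OF z] by simp
qed

section \<open>The quotient by an ideal spanned by basis elements\<close>

definition quot_pairing :: "'a set \<Rightarrow> 'a set \<Rightarrow> int" where
  "quot_pairing A C = (THE n. \<exists>x\<in>A. \<exists>y\<in>C. n = coeff (x \<otimes> y) \<one>)"

context
  fixes X I
  assumes X: "X \<subset> B" and I: "ideal (int_span R X) R" and I_def: "I = int_span R X"
begin

interpretation ideal I R using I by (simp add: I_def)

interpretation Q: ring "R Quot I" by (rule quotient_is_ring)

lemma quot_carrier: "carrier (R Quot I) = (\<lambda>x. I +> x) ` carrier R"
  by (auto simp: FactRing_def A_RCOSETS_def')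

lemma quot_zero: "\<zero>\<^bsub>R Quot I\<^esub> = I"
  by (simp add: FactRing_def)

lemma coset_eq_zero_iff: "x \<in> carrier R \<Longrightarrow> I +> x = I \<longleftrightarrow> x \<in> I"
  using a_rcos_const a_rcos_self by blast

lemma quot_add: "x \<in> carrier R \<Longrightarrow> y \<in> carrier R \<Longrightarrow> (I +> x) \<oplus>\<^bsub>R Quot I\<^esub> (I +> y) = I +> (x \<oplus> y)"
  by (simp add: FactRing_def a_rcos_sum)

lemma quot_mult: "x \<in> carrier R \<Longrightarrow> y \<in> carrier R \<Longrightarrow> (I +> x) \<otimes>\<^bsub>R Quot I\<^esub> (I +> y) = I +> (x \<otimes> y)"
  by (simp add: FactRing_def rcoset_mult_add)

lemma coset_rep: "y \<in> I +> x \<Longrightarrow> \<exists>i\<in>I. y = i \<oplus> x"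
  by (auto simp: a_r_coset_def')

text \<open>Changing representatives alters the product by elements of the ideal, and these have no
  component along the unit because a proper basis ideal does not contain it.\<close>

lemma quot_pairing_coset:
  assumes x: "x \<in> carrier R" and y: "y \<in> carrier R"
  shows "quot_pairing (I +> x) (I +> y) = coeff (x \<otimes> y) \<one>"
proof -
  have "coeff (x' \<otimes> y') \<one> = coeff (x \<otimes> y) \<one>" if x': "x' \<in> I +> x" and y': "y' \<in> I +> y" for x' y'
  proof -
    obtain i j where ij: "i \<in> I" "j \<in> I" "x' = i \<oplus> x" "y' = j \<oplus> y" using coset_rep[OF x'] coset_rep[OF y'] by blast
    have c: "i \<in> carrier R" "j \<in> carrier R" "y' \<in> carrier R" using ij y a_Hcarr by auto
    have "coeff (x' \<otimes> y') \<one> = coeff (i \<otimes> y') \<one> + coeff (x \<otimes> y') \<one>"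
      unfolding ij(3) by (rule coeff_mult_left_add[OF c(3,1) x])
    also have "coeff (x \<otimes> y') \<one> = coeff (x \<otimes> j) \<one> + coeff (x \<otimes> y) \<one>"
      unfolding ij(4) by (rule coeff_mult_right_add[OF x c(2) y])
    finally show ?thesis
      using ideal_unit_coeff(1)[OF X I ij(1)[unfolded I_def] c(3)] ideal_unit_coeff(2)[OF X I ij(2)[unfolded I_def] x]
      by simp
  qed
  note rep = this
  show ?thesis unfolding quot_pairing_def
  proof (rule the_equality)
    show "\<exists>x'\<in>I +> x. \<exists>y'\<in>I +> y. coeff (x \<otimes> y) \<one> = coeff (x' \<otimes> y') \<one>"
      using a_rcos_self[OF x] a_rcos_self[OF y] by blast
    show "n = coeff (x \<otimes> y) \<one>" if "\<exists>x'\<in>I +> x. \<exists>y'\<in>I +> y. n = coeff (x' \<otimes> y') \<one>" for n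
      using that rep by blast
  qed
qed

text \<open>The radicals of the pairing are the images of the radicals of the form on
  \<open>R\<close>. Such an image contains the zero coset, and it is nothing more exactly if the
  radical upstairs lies in \<open>I\<close>.\<close>

lemma nondegenerate_iff_radicals:
  "nondegenerate_form (R Quot I) quot_pairing \<longleftrightarrow>
    (\<forall>x\<in>carrier R. (\<forall>y\<in>carrier R. coeff (x \<otimes> y) \<one> = 0) \<longrightarrow> x \<in> I) \<and>
    (\<forall>y\<in>carrier R. (\<forall>x\<in>carrier R. coeff (x \<otimes> y) \<one> = 0) \<longrightarrow> y \<in> I)"
proof -
  have im: "f ` S = {I} \<longleftrightarrow> (\<forall>x\<in>S. f x = I)" if "I \<in> f ` S" for f and S :: "'a set"
    using that by auto
  have z: "I = I +> \<zero>" using coset_eq_zero_iff[of \<zero>] by auto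
  have c0: "coeff \<zero> \<one> = 0" using coeff_add[of \<zero> \<zero> \<one>] by simp
  have 1: "{x \<in> carrier (R Quot I). \<forall>y\<in>carrier (R Quot I). quot_pairing x y = 0} = {I} \<longleftrightarrow>
    (\<forall>x\<in>carrier R. (\<forall>y\<in>carrier R. coeff (x \<otimes> y) \<one> = 0) \<longrightarrow> x \<in> I)"
  proof -
    have "I \<in> {x \<in> carrier (R Quot I). \<forall>y\<in>carrier (R Quot I). quot_pairing x y = 0}"
      unfolding quot_carrier using quot_pairing_coset[of \<zero>] c0 z by auto
    moreover have "{x \<in> carrier (R Quot I). \<forall>y\<in>carrier (R Quot I). quot_pairing x y = 0} =
        (\<lambda>x. I +> x) ` {x \<in> carrier R. \<forall>y\<in>carrier R. coeff (x \<otimes> y) \<one> = 0}"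
      unfolding quot_carrier using quot_pairing_coset by auto
    ultimately have "I \<in> (+>) I ` {x \<in> carrier R. \<forall>y\<in>carrier R. coeff (x \<otimes> y) \<one> = 0}" and
      eq: "{x \<in> carrier (R Quot I). \<forall>y\<in>carrier (R Quot I). quot_pairing x y = 0} = (+>) I ` {x \<in> carrier R. \<forall>y\<in>carrier R. coeff (x \<otimes> y) \<one> = 0}" by simp_all
    then show ?thesis unfolding eq im[OF \<open>I \<in> (+>) I ` {x \<in> carrier R. \<forall>y\<in>carrier R. coeff (x \<otimes> y) \<one> = 0}\<close>] by (auto simp: coset_eq_zero_iff)
  qed
  have 2: "{y \<in> carrier (R Quot I). \<forall>x\<in>carrier (R Quot I). quot_pairing x y = 0} = {I} \<longleftrightarrow>
    (\<forall>y\<in>carrier R. (\<forall>x\<in>carrier R. coeff (x \<otimes> y) \<one> = 0) \<longrightarrow> y \<in> I)"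
  proof -
    have "I \<in> {y \<in> carrier (R Quot I). \<forall>x\<in>carrier (R Quot I). quot_pairing x y = 0}"
      unfolding quot_carrier using quot_pairing_coset[of _ \<zero>] c0 z by auto
    moreover have "{y \<in> carrier (R Quot I). \<forall>x\<in>carrier (R Quot I). quot_pairing x y = 0} =
        (\<lambda>x. I +> x) ` {y \<in> carrier R. \<forall>x\<in>carrier R. coeff (x \<otimes> y) \<one> = 0}"
      unfolding quot_carrier using quot_pairing_coset by auto
    ultimately have "I \<in> (+>) I ` {y \<in> carrier R. \<forall>x\<in>carrier R. coeff (x \<otimes> y) \<one> = 0}" and
      eq: "{y \<in> carrier (R Quot I). \<forall>x\<in>carrier (R Quot I). quot_pairing x y = 0} = (+>) I ` {y \<in> carrier R. \<forall>x\<in>carrier R. coeff (x \<otimes> y) \<one> = 0}" by simp_all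
    then show ?thesis unfolding eq im[OF \<open>I \<in> (+>) I ` {y \<in> carrier R. \<forall>x\<in>carrier R. coeff (x \<otimes> y) \<one> = 0}\<close>] by (auto simp: coset_eq_zero_iff)
  qed
  show ?thesis unfolding nondegenerate_form_def quot_zero 1 2 ..
qed

text \<open>The cosets of \<open>B - X\<close> form a basis of the quotient, with the coefficients
  of representatives. Coefficient functions descend to cosets and give uniqueness; existence follows
  by transporting the coordinates of \<open>w\<close> and dropping those in
  \<open>X\<close>.\<close>

lemma quot_basis_coeff:
  assumes w: "w \<in> carrier R" and z: "z \<in> B - X"
  shows "basis_coeff (R Quot I) ((\<lambda>x. I +> x) ` (B - X)) (I +> w) (I +> z) = coeff w z"
proof -
  let ?g = "\<lambda>x. I +> x"
  let ?QB = "?g ` (B - X)"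
  \<comment> \<open>The coefficient at \<open>c\<close> as a function of cosets. For
    \<open>c\<close> outside \<open>X\<close> it does not depend on the representative, because
    elements of \<open>I\<close> have no such component.\<close>
  define L where "L c A = (THE n. \<exists>w\<in>A. n = coeff w c)" for c A
  have L: "L c (I +> v) = coeff v c" if v: "v \<in> carrier R" and c: "c \<in> B - X" for c v
  proof -
    have "coeff v' c = coeff v c" if "v' \<in> I +> v" for v'
    proof -
      obtain i where i: "i \<in> I" "v' = i \<oplus> v" using coset_rep \<open>v' \<in> I +> v\<close> by blast
      then have "coeff i c = 0" using c X int_span_iff[of X i] by (auto simp: I_def)
      then show ?thesis using i v coeff_add[of i v c] a_Hcarr by simp
    qed
    note rep = this
    show ?thesis unfolding L_def
    proof (rule the_equality)
      show "\<exists>w\<in>I +> v. coeff v c = coeff w c" using a_rcos_self[OF v] by blast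
      show "n = coeff v c" if "\<exists>w\<in>I +> v. n = coeff w c" for n using that rep by blast
    qed
  qed
  have L_add: "L c (x \<oplus>\<^bsub>R Quot I\<^esub> y) = L c x + L c y"
    if "c \<in> B - X" "x \<in> carrier (R Quot I)" "y \<in> carrier (R Quot I)" for c x y
    using that unfolding quot_carrier by (auto simp: quot_add L coeff_add)
  have QBc: "?QB \<subseteq> carrier (R Quot I)" unfolding quot_carrier using basis_closed by blast
  have lookup: "Poly_Mapping.lookup n (I +> c) = L c (int_comb (R Quot I) n)"
    if n: "Poly_Mapping.keys n \<subseteq> ?QB" and c: "c \<in> B - X" for n c
  proof -
    have "L c (int_comb (R Quot I) n) = (\<Sum>q\<in>Poly_Mapping.keys n. Poly_Mapping.lookup n q * L c q)"
      using L_add[OF c] n QBc by (intro Q.int_comb_additive) auto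
    also have "\<dots> = (\<Sum>q\<in>Poly_Mapping.keys n. if q = I +> c then Poly_Mapping.lookup n q else 0)"
    proof (intro sum.cong refl)
      fix q assume "q \<in> Poly_Mapping.keys n"
      then obtain b where b: "b \<in> B - X" "q = I +> b" using n by blast
      have Lb: "L c q = (if c = b then 1 else 0)" using b c L[OF basis_carrier c] by (simp add: coeff_basis)
      have Lc: "L c (I +> c) = 1" using c L[OF basis_carrier c] by (simp add: coeff_basis)
      \<comment> \<open>Distinct elements of \<open>B - X\<close> have distinct cosets, because
        \<open>L c\<close> separates them.\<close>
      have "q = I +> c \<longleftrightarrow> c = b" using Lb Lc b(2) by (auto split: if_splits)
      then show "Poly_Mapping.lookup n q * L c q = (if q = I +> c then Poly_Mapping.lookup n q else 0)"
        using Lb by simp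
    qed
    also have "\<dots> = Poly_Mapping.lookup n (I +> c)" by (simp add: in_keys_iff)
    finally show ?thesis by simp
  qed
  obtain m where m: "Poly_Mapping.keys m \<subseteq> B" "int_comb R m = w" using coords_exist[OF w] by blast
  have "Poly_Mapping.keys m \<subseteq> B \<and> (\<exists>n. Poly_Mapping.keys n \<subseteq> ?QB \<and> int_comb (R Quot I) n = I +> int_comb R m)"
    using m(1)
  proof (induction m rule: frag_induction)
    case zero
    have "I +> \<zero> = I" using coset_eq_zero_iff[of \<zero>] by auto
    then show ?case by (intro conjI exI[of _ 0]) (auto simp: Q.int_comb_zero int_comb_zero quot_zero)
  next
    case (one b)
    show ?case
    proof (cases "b \<in> X")
      case True
      then have "b \<in> I" using X basis_in_span[of X b] one by (auto simp: I_def)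
      then show ?thesis using one basis_carrier[OF one] coset_eq_zero_iff[of b]
        by (intro conjI exI[of _ 0]) (auto simp: Q.int_comb_zero int_comb_frag_of quot_zero)
    next
      case False
      then show ?thesis using one basis_carrier[OF one] QBc
        by (intro conjI exI[of _ "frag_of (I +> b)"]) (auto simp: Q.int_comb_frag_of int_comb_frag_of)
    qed
  next
    case (diff a b)
    obtain n where n1: "Poly_Mapping.keys n \<subseteq> ?QB" "int_comb (R Quot I) n = I +> int_comb R a"
      using conjunct2[OF diff(1)] by (elim exE conjE)
    obtain n' where n2: "Poly_Mapping.keys n' \<subseteq> ?QB" "int_comb (R Quot I) n' = I +> int_comb R b"
      using conjunct2[OF diff(2)] by (elim exE conjE)
    note n = n1 n2
    have kc: "Poly_Mapping.keys a \<subseteq> carrier R" "Poly_Mapping.keys b \<subseteq> carrier R"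
      "Poly_Mapping.keys (a - b) \<subseteq> carrier R" and kB: "Poly_Mapping.keys (a - b) \<subseteq> B"
      using diff basis_closed keys_diff[of a b] by auto
    have kn: "Poly_Mapping.keys (n - n') \<subseteq> ?QB" using n keys_diff[of n n'] by blast
    note c = int_comb_closed[OF kc(1)] int_comb_closed[OF kc(2)] int_comb_closed[OF kc(3)]
    have cc: "I +> int_comb R b \<in> carrier (R Quot I)" "I +> int_comb R (a - b) \<in> carrier (R Quot I)"
      unfolding quot_carrier using c by auto
    have "int_comb R a = int_comb R (a - b) \<oplus> int_comb R b" using int_comb_add[OF kc(3,2)] by simp
    then have "I +> int_comb R a = (I +> int_comb R (a - b)) \<oplus>\<^bsub>R Quot I\<^esub> (I +> int_comb R b)"
      using quot_add[OF c(3,2)] by simp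
    moreover have "(u \<oplus>\<^bsub>R Quot I\<^esub> v) \<ominus>\<^bsub>R Quot I\<^esub> v = u"
      if "u \<in> carrier (R Quot I)" "v \<in> carrier (R Quot I)" for u v
      using that by (simp add: Q.minus_eq Q.add.m_assoc Q.r_neg)
    ultimately have "(I +> int_comb R a) \<ominus>\<^bsub>R Quot I\<^esub> (I +> int_comb R b) = I +> int_comb R (a - b)"
      using cc by metis
    moreover have "int_comb (R Quot I) (n - n') = int_comb (R Quot I) n \<ominus>\<^bsub>R Quot I\<^esub> int_comb (R Quot I) n'"
      using n QBc by (intro Q.int_comb_diff) auto
    ultimately show ?case using n kn kB by (intro conjI exI[of _ "n - n'"]) auto
  qed
  then obtain n where n: "Poly_Mapping.keys n \<subseteq> ?QB" "int_comb (R Quot I) n = I +> w" using m(2) by blast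
  have "n' = n" if "Poly_Mapping.keys n' \<subseteq> ?QB" "int_comb (R Quot I) n' = I +> w" for n'
  proof (rule poly_mapping_eqI)
    fix q
    show "Poly_Mapping.lookup n' q = Poly_Mapping.lookup n q"
    proof (cases "q \<in> ?QB")
      case True
      then show ?thesis using lookup[OF n(1)] lookup[OF that(1)] n(2) that(2) by auto
    next
      case False
      then show ?thesis using n(1) that(1) by (metis in_keys_iff subsetD)
    qed
  qed
  note uniq = this
  have "(THE n. Poly_Mapping.keys n \<subseteq> ?QB \<and> int_comb (R Quot I) n = I +> w) = n"
  proof (rule the_equality)
    show "Poly_Mapping.keys n \<subseteq> ?QB \<and> int_comb (R Quot I) n = I +> w" using n by blast
    show "m = n" if "Poly_Mapping.keys m \<subseteq> ?QB \<and> int_comb (R Quot I) m = I +> w" for m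
      using uniq that by blast
  qed
  then show ?thesis using lookup[OF n(1) z] n(2) L[OF w z] by (simp add: basis_coeff_def)
qed

lemma transitive_iff:
  "transitive_wrt (R Quot I) ((\<lambda>x. I +> x) ` (B - X)) \<longleftrightarrow>
    (\<forall>a\<in>B - X. \<forall>c\<in>B - X. \<exists>b1\<in>B - X. \<exists>b2\<in>B - X. coeff (a \<otimes> b1) c \<noteq> 0 \<and> coeff (b2 \<otimes> a) c \<noteq> 0)"
proof -
  have "basis_coeff (R Quot I) ((\<lambda>x. I +> x) ` (B - X)) ((I +> a) \<otimes>\<^bsub>R Quot I\<^esub> (I +> b)) (I +> c) = coeff (a \<otimes> b) c"
    if "a \<in> B - X" "b \<in> B - X" "c \<in> B - X" for a b c
  proof -
    have ab: "a \<in> carrier R" "b \<in> carrier R" using that basis_carrier by auto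
    show ?thesis unfolding quot_mult[OF ab] by (rule quot_basis_coeff[OF m_closed[OF ab] that(3)])
  qed
  then show ?thesis
    unfolding transitive_wrt_def ball_simps bex_simps by (intro ball_cong bex_cong refl) simp
qed

lemma null_imp_left_radical:
  assumes N: "null_right = X" and x: "x \<in> carrier R" and 0: "\<And>y. y \<in> carrier R \<Longrightarrow> coeff (x \<otimes> y) \<one> = 0"
  shows "x \<in> I"
proof -
  have "coeff x z = 0" if z: "z \<in> B - X" for z
  proof -
    have sz: "st z \<in> carrier R" using z star_basis basis_carrier by blast
    obtain K where K: "finite K" "K \<subseteq> B" "\<forall>b. b \<notin> K \<longrightarrow> coeff x b = 0"
      "coeff (x \<otimes> st z) \<one> = (\<Sum>b\<in>K. coeff x b * coeff (b \<otimes> st z) \<one>)"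
      using coeff_expand[of "\<lambda>x. coeff (x \<otimes> st z) \<one>" x] x sz by (auto simp: coeff_mult_left_add)
    have "(\<Sum>b\<in>K. coeff x b * coeff (b \<otimes> st z) \<one>) = (\<Sum>b\<in>K. if b = z then coeff x z * coeff (z \<otimes> st z) \<one> else 0)"
    proof (intro sum.cong refl)
      fix b assume "b \<in> K"
      then have b: "b \<in> B" using K by blast
      \<comment> \<open>Uniqueness gives \<open>st z = st b\<close>, so injectivity of
        \<open>st\<close> identifies \<open>b\<close>.\<close>
      have "b = z" if "coeff (b \<otimes> st z) \<one> \<noteq> 0"
        using unit_star_unique[OF b star_basis that] star_inj b z by (auto dest: inj_onD)
      then show "coeff x b * coeff (b \<otimes> st z) \<one> = (if b = z then coeff x z * coeff (z \<otimes> st z) \<one> else 0)" by auto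
    qed
    then have "coeff x z * coeff (z \<otimes> st z) \<one> = 0" using K 0[OF sz] by (auto split: if_splits)
    moreover have "coeff (z \<otimes> st z) \<one> \<noteq> 0" using z N by (auto simp: null_right_def)
    ultimately show ?thesis by simp
  qed
  then show ?thesis using x X int_span_iff[of X x] coeff_outside[OF x] unfolding I_def by blast
qed

lemma null_imp_right_radical:
  assumes N: "null_left = X" and x: "x \<in> carrier R" and 0: "\<And>y. y \<in> carrier R \<Longrightarrow> coeff (y \<otimes> x) \<one> = 0"
  shows "x \<in> I"
proof -
  have "coeff x z = 0" if z: "z \<in> B - X" for z
  proof -
    have szB: "st z \<in> B" using z star_basis by blast
    note sz = basis_carrier[OF szB]
    have nz: "coeff (st z \<otimes> z) \<one> \<noteq> 0" using z N by (auto simp: null_left_def)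
    obtain K where K: "finite K" "K \<subseteq> B" "\<forall>b. b \<notin> K \<longrightarrow> coeff x b = 0"
      "coeff (st z \<otimes> x) \<one> = (\<Sum>b\<in>K. coeff x b * coeff (st z \<otimes> b) \<one>)"
      using coeff_expand[of "\<lambda>x. coeff (st z \<otimes> x) \<one>" x] x sz by (auto simp: coeff_mult_right_add)
    have "(\<Sum>b\<in>K. coeff x b * coeff (st z \<otimes> b) \<one>) = (\<Sum>b\<in>K. if b = z then coeff x z * coeff (st z \<otimes> z) \<one> else 0)"
    proof (intro sum.cong refl)
      fix b assume "b \<in> K"
      then have b: "b \<in> B" using K by blast
      \<comment> \<open>Uniqueness, applied to \<open>st z\<close> as the left factor, shows that
        both \<open>b\<close> and \<open>z\<close> equal \<open>st (st z)\<close>.\<close>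
      have "b = z" if "coeff (st z \<otimes> b) \<one> \<noteq> 0"
        using unit_star_unique[OF szB b that] unit_star_unique[OF szB _ nz] z by simp
      then show "coeff x b * coeff (st z \<otimes> b) \<one> = (if b = z then coeff x z * coeff (st z \<otimes> z) \<one> else 0)" by auto
    qed
    then have "coeff x z * coeff (st z \<otimes> z) \<one> = 0" using K 0[OF sz] by (auto split: if_splits)
    then show ?thesis using nz by simp
  qed
  then show ?thesis using x X int_span_iff[of X x] coeff_outside[OF x] unfolding I_def by blast
qed

theorem nondegenerate_iff_null:
  "nondegenerate_form (R Quot I) quot_pairing \<longleftrightarrow> null_right = X \<and> null_left = X"
proof
  assume "null_right = X \<and> null_left = X"
  then show "nondegenerate_form (R Quot I) quot_pairing"
    unfolding nondegenerate_iff_radicals using null_imp_left_radical null_imp_right_radical by blast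
next
  assume n: "nondegenerate_form (R Quot I) quot_pairing"
  have "x \<notin> null_right \<and> x \<notin> null_left" if x: "x \<in> B - X" for x
  proof -
    have xI: "x \<notin> I" using x X basis_in_span[of X x] by (auto simp: I_def)
    have xc: "x \<in> carrier R" "x \<in> B" using x basis_carrier by auto
    obtain y where y: "y \<in> carrier R" "coeff (x \<otimes> y) \<one> \<noteq> 0"
      using n xI xc unfolding nondegenerate_iff_radicals by blast
    obtain y' where y': "y' \<in> carrier R" "coeff (y' \<otimes> x) \<one> \<noteq> 0"
      using n xI xc unfolding nondegenerate_iff_radicals by blast
    show ?thesis
      using exists_basis_right[OF xc(1) y] exists_basis_left[OF y'(1) xc(1) y'(2)] xc(2)
        unit_star_right unit_star_left unfolding null_right_def null_left_def by blast
  qed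
  then show "null_right = X \<and> null_left = X"
    using ideal_basis_null[OF X I] unfolding null_right_def null_left_def by blast
qed

theorem transitive_iff_null:
  "transitive_wrt (R Quot I) ((\<lambda>x. I +> x) ` (B - X)) \<longleftrightarrow> null_right = X \<and> null_left = X"
  unfolding transitive_iff
proof
  assume t: "\<forall>a\<in>B - X. \<forall>c\<in>B - X. \<exists>b1\<in>B - X. \<exists>b2\<in>B - X. coeff (a \<otimes> b1) c \<noteq> 0 \<and> coeff (b2 \<otimes> a) c \<noteq> 0"
  have "\<one> \<in> B - X" using one_basis one_notin_ideal[OF X I] by blast
  then have "x \<notin> null_right \<and> x \<notin> null_left" if x: "x \<in> B - X" for x
    using t x unit_star_right unit_star_left unfolding null_right_def null_left_def by blast
  then show "null_right = X \<and> null_left = X"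
    using ideal_basis_null[OF X I] unfolding null_right_def null_left_def by blast
next
  assume N: "null_right = X \<and> null_left = X"
  show "\<forall>a\<in>B - X. \<forall>c\<in>B - X. \<exists>b1\<in>B - X. \<exists>b2\<in>B - X. coeff (a \<otimes> b1) c \<noteq> 0 \<and> coeff (b2 \<otimes> a) c \<noteq> 0"
  proof (intro ballI)
    fix a c assume a: "a \<in> B - X" and c: "c \<in> B - X"
    have aB: "a \<in> B" "st a \<in> B" and cB: "c \<in> B" using a c star_basis by auto
    note car = basis_carrier[OF aB(1)] basis_carrier[OF aB(2)] basis_carrier[OF cB]
    have I_coeff: "coeff i c = 0" if "i \<in> I" for i
      using that c X int_span_iff[of X i] by (auto simp: I_def)
    have XI: "b \<in> I" if "b \<in> X" for b using that X basis_in_span[of X b] by (auto simp: I_def)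
    have n1: "coeff (a \<otimes> st a) \<one> \<noteq> 0" and n2: "coeff (st a \<otimes> a) \<one> \<noteq> 0"
      using N a by (auto simp: null_right_def null_left_def)
    have "coeff (a \<otimes> (st a \<otimes> c)) c \<noteq> 0"
      using coeff_mult_unit_pos(1)[of "a \<otimes> st a" c] structure_nonneg[OF aB] n1 cB car by (simp add: m_assoc)
    moreover obtain K where K: "finite K" "K \<subseteq> B"
      "coeff (a \<otimes> (st a \<otimes> c)) c = (\<Sum>b\<in>K. coeff (st a \<otimes> c) b * coeff (a \<otimes> b) c)"
      using coeff_expand[of "\<lambda>x. coeff (a \<otimes> x) c" "st a \<otimes> c"] car by (auto simp: coeff_mult_right_add)
    ultimately obtain b1 where b1: "b1 \<in> K" "coeff (a \<otimes> b1) c \<noteq> 0"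
      by (metis (no_types, lifting) mult_zero_right sum.neutral)
    \<comment> \<open>If \<open>b1\<close> were in \<open>X\<close>, the product \<open>a b1\<close>
      would lie in the ideal and have no coefficient at \<open>c\<close>.\<close>
    then have "b1 \<in> B - X" using K(2) I_coeff XI I_l_closed[of b1 a] car by blast
    have "coeff ((c \<otimes> st a) \<otimes> a) c \<noteq> 0"
      using coeff_mult_unit_pos(2)[of "st a \<otimes> a" c] structure_nonneg[OF aB(2,1)] n2 cB car by (simp add: m_assoc)
    moreover obtain K' where K': "finite K'" "K' \<subseteq> B"
      "coeff ((c \<otimes> st a) \<otimes> a) c = (\<Sum>b\<in>K'. coeff (c \<otimes> st a) b * coeff (b \<otimes> a) c)"
      using coeff_expand[of "\<lambda>x. coeff (x \<otimes> a) c" "c \<otimes> st a"] car by (auto simp: coeff_mult_left_add)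
    ultimately obtain b2 where b2: "b2 \<in> K'" "coeff (b2 \<otimes> a) c \<noteq> 0"
      by (metis (no_types, lifting) mult_zero_right sum.neutral)
    then have "b2 \<in> B - X" using K'(2) I_coeff XI I_r_closed[of b2 a] car by blast
    show "\<exists>b1\<in>B - X. \<exists>b2\<in>B - X. coeff (a \<otimes> b1) c \<noteq> 0 \<and> coeff (b2 \<otimes> a) c \<noteq> 0"
      using \<open>b1 \<in> B - X\<close> \<open>b2 \<in> B - X\<close> b1 b2 by blast
  qed
qed

end

end

section \<open>The Green ring\<close>

definition mod_classes :: "('k::field, 'h::ring_1) hopf \<Rightarrow> ('k, 'h) hmod set set" where
  "mod_classes H = {iso_class H V |V. is_hmod H V}"

definition ind_classes :: "('k::field, 'h::ring_1) hopf \<Rightarrow> ('k, 'h) hmod set set" where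
  "ind_classes H = {iso_class H V |V. indecomposable_hmod H V}"

text \<open>The formal sum of the indecomposable summands of a class. The choice of module and
  decomposition does not matter by Krull-Schmidt uniqueness, which is the content of
  \<open>class_decomp_eq\<close>.\<close>

definition class_decomp :: "('k::field, 'h::ring_1) hopf \<Rightarrow> ('k, 'h) hmod set \<Rightarrow> ('k, 'h) hmod set \<Rightarrow>\<^sub>0 int" where
  "class_decomp H C = (SOME x. \<exists>V Es. is_hmod H V \<and> C = iso_class H V \<and>
     (\<forall>E\<in>set Es. indecomposable_hmod H E) \<and> hmod_iso V (direct_sum_list Es) \<and>
     x = (\<Sum>E\<leftarrow>Es. frag_of (iso_class H E)))"

lemma class_decomp_eq:
  assumes V: "is_hmod H V" and Es: "\<forall>E\<in>set Es. indecomposable_hmod H E"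
    and iso: "hmod_iso V (direct_sum_list Es)"
  shows "class_decomp H (iso_class H V) = (\<Sum>E\<leftarrow>Es. frag_of (iso_class H E))"
  unfolding class_decomp_def
proof (rule some_equality)
  show "\<exists>V' Es'. is_hmod H V' \<and> iso_class H V = iso_class H V' \<and> (\<forall>E\<in>set Es'. indecomposable_hmod H E) \<and>
      hmod_iso V' (direct_sum_list Es') \<and>
      (\<Sum>E\<leftarrow>Es. frag_of (iso_class H E)) = (\<Sum>E\<leftarrow>Es'. frag_of (iso_class H E))"
    using assms by blast
next
  fix x assume "\<exists>V' Es'. is_hmod H V' \<and> iso_class H V = iso_class H V' \<and> (\<forall>E\<in>set Es'. indecomposable_hmod H E) \<and>
      hmod_iso V' (direct_sum_list Es') \<and> x = (\<Sum>E\<leftarrow>Es'. frag_of (iso_class H E))"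
  then obtain V' Es' where *: "is_hmod H V'" "iso_class H V = iso_class H V'"
    "\<forall>E\<in>set Es'. indecomposable_hmod H E" "hmod_iso V' (direct_sum_list Es')"
    "x = (\<Sum>E\<leftarrow>Es'. frag_of (iso_class H E))" by blast
  have m: "is_hmod H (direct_sum_list Es)" "is_hmod H (direct_sum_list Es')"
    using Es *(3) by (auto intro!: direct_sum_list_hmod dest: indecomposable_hmod_is_hmod)
  have "hmod_iso V' V" using iso_class_eq_iff[OF *(1) V] *(2) by simp
  then have "hmod_iso V' (direct_sum_list Es)" using hmod_iso_trans[OF *(1) V m(1) _ iso] by blast
  then have "hmod_iso (direct_sum_list Es') (direct_sum_list Es)"
    using hmod_iso_trans[OF m(2) *(1) m(1)] hmod_iso_sym[OF *(1) m(2) *(4)] by blast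
  then have ks: "image_mset (iso_class H) (mset Es') = image_mset (iso_class H) (mset Es)"
    using krull_schmidt_uniqueness *(3) Es by blast
  have "(\<Sum>E\<leftarrow>As. frag_of (iso_class H E)) = sum_mset (image_mset frag_of (image_mset (iso_class H) (mset As)))" for As
    by (simp add: image_mset.compositionality comp_def flip: mset_map sum_mset_sum_list)
  then show "x = (\<Sum>E\<leftarrow>Es. frag_of (iso_class H E))" using ks *(5) by simp
qed

lemma class_decomp_obtain:
  assumes V: "is_hmod H V"
  obtains Es where "\<forall>E\<in>set Es. indecomposable_hmod H E" "hmod_iso V (direct_sum_list Es)"
    "class_decomp H (iso_class H V) = (\<Sum>E\<leftarrow>Es. frag_of (iso_class H E))"
  using krull_schmidt_existence[OF V] class_decomp_eq[OF V] by blast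

lemma class_decomp_direct_sum:
  assumes U: "is_hmod H U" and V: "is_hmod H V"
  shows "class_decomp H (iso_class H (direct_sum_hmod U V)) =
    class_decomp H (iso_class H U) + class_decomp H (iso_class H V)"
proof -
  obtain Es where E: "\<forall>E\<in>set Es. indecomposable_hmod H E" "hmod_iso U (direct_sum_list Es)"
    "class_decomp H (iso_class H U) = (\<Sum>E\<leftarrow>Es. frag_of (iso_class H E))"
    using class_decomp_obtain[OF U] .
  obtain Fs where F: "\<forall>E\<in>set Fs. indecomposable_hmod H E" "hmod_iso V (direct_sum_list Fs)"
    "class_decomp H (iso_class H V) = (\<Sum>E\<leftarrow>Fs. frag_of (iso_class H E))"
    using class_decomp_obtain[OF V] .
  have m: "is_hmod H (direct_sum_list Es)" "is_hmod H (direct_sum_list Fs)"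
    using E F by (auto intro!: direct_sum_list_hmod dest: indecomposable_hmod_is_hmod)
  have app: "direct_sum_list (Es @ Fs) = direct_sum_hmod (direct_sum_list Es) (direct_sum_list Fs)"
    by (rule direct_sum_list_append[of Es Fs H]) (use E F in \<open>auto dest: indecomposable_hmod_is_hmod\<close>)
  have "hmod_iso (direct_sum_hmod U V) (direct_sum_list (Es @ Fs))"
    unfolding app by (rule direct_sum_cong[OF U m(1) V m(2) E(2) F(2)])
  moreover have "\<forall>E\<in>set (Es @ Fs). indecomposable_hmod H E" using E(1) F(1) by auto
  ultimately have "class_decomp H (iso_class H (direct_sum_hmod U V)) = (\<Sum>E\<leftarrow>Es @ Fs. frag_of (iso_class H E))"
    using class_decomp_eq[OF direct_sum_hmod[OF U V]] by blast
  then show ?thesis using E(3) F(3) by simp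
qed

lemma class_decomp_indecomposable:
  assumes "indecomposable_hmod H E"
  shows "class_decomp H (iso_class H E) = frag_of (iso_class H E)"
proof -
  have m: "is_hmod H E" using assms by (rule indecomposable_hmod_is_hmod)
  have "hmod_iso E (direct_sum_list [E])"
    using hmod_iso_refl[OF m] direct_sum_zero_right[OF m] by simp
  then show ?thesis using class_decomp_eq[OF m, of "[E]"] assms by simp
qed

lemma class_decomp_nonneg:
  assumes "is_hmod H V"
  shows "0 \<le> Poly_Mapping.lookup (class_decomp H (iso_class H V)) C"
proof -
  have "0 \<le> Poly_Mapping.lookup (\<Sum>E\<leftarrow>Es. frag_of (iso_class H E)) C" for Es
    by (induction Es) (simp_all add: lookup_add)
  moreover obtain Es where "class_decomp H (iso_class H V) = (\<Sum>E\<leftarrow>Es. frag_of (iso_class H E))"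
    using class_decomp_obtain[OF assms] .
  ultimately show ?thesis by simp
qed

lemma class_decomp_keys:
  assumes "is_hmod H V"
  shows "Poly_Mapping.keys (class_decomp H (iso_class H V)) \<subseteq> ind_classes H"
proof -
  obtain Es where E: "\<forall>E\<in>set Es. indecomposable_hmod H E"
    "class_decomp H (iso_class H V) = (\<Sum>E\<leftarrow>Es. frag_of (iso_class H E))"
    using class_decomp_obtain[OF assms] .
  have "Poly_Mapping.keys (\<Sum>E\<leftarrow>Es. frag_of (iso_class H E)) \<subseteq> ind_classes H"
    using E(1)
  proof (induction Es)
    case (Cons E Es)
    then show ?case
      using Poly_Mapping.keys_add[of "frag_of (iso_class H E)" "\<Sum>E\<leftarrow>Es. frag_of (iso_class H E)"]
      by (auto simp: ind_classes_def)
  qed simp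
  then show ?thesis using E(2) by simp
qed

lemma summand_in_list:
  assumes "\<forall>E\<in>set Es. is_hmod H E" "E \<in> set Es"
  shows "\<exists>M. is_hmod H M \<and> hmod_iso (direct_sum_list Es) (direct_sum_hmod E M)"
  using assms
proof (induction Es)
  case (Cons F Es)
  have F: "is_hmod H F" and Es: "is_hmod H (direct_sum_list Es)"
    using Cons.prems by (auto intro: direct_sum_list_hmod)
  show ?case
  proof (cases "E = F")
    case True
    then show ?thesis using Es hmod_iso_refl[OF direct_sum_hmod[OF F Es]] by auto
  next
    case False
    then have E: "E \<in> set Es" "is_hmod H E" using Cons.prems by auto
    obtain M where M: "is_hmod H M" "hmod_iso (direct_sum_list Es) (direct_sum_hmod E M)"
      using Cons.IH E Cons.prems by auto
    note d = direct_sum_hmod[OF E(2) M(1)] direct_sum_hmod[OF F M(1)] direct_sum_hmod[OF F E(2)] direct_sum_hmod[OF E(2) F]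
    have "hmod_iso (direct_sum_hmod F (direct_sum_list Es)) (direct_sum_hmod F (direct_sum_hmod E M))"
      using direct_sum_cong[OF F F Es d(1) hmod_iso_refl[OF F] M(2)] .
    moreover have "hmod_iso (direct_sum_hmod F (direct_sum_hmod E M)) (direct_sum_hmod E (direct_sum_hmod F M))"
      unfolding direct_sum_assoc[OF F E(2) M(1)] direct_sum_assoc[OF E(2) F M(1)]
      using direct_sum_cong[OF d(3,4) M(1) M(1) direct_sum_comm[OF F E(2)] hmod_iso_refl[OF M(1)]] .
    ultimately have "hmod_iso (direct_sum_list (F # Es)) (direct_sum_hmod E (direct_sum_hmod F M))"
      using hmod_iso_trans[OF direct_sum_hmod[OF F Es] direct_sum_hmod[OF F d(1)] direct_sum_hmod[OF E(2) d(2)]]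
      by simp
    then show ?thesis using d(2) by blast
  qed
qed simp

text \<open>Multiplicities are nonnegative, so the contribution of a summand \<open>E\<close> is not
  cancelled by the rest; conversely a class with nonzero multiplicity occurs in the list of
  summands.\<close>

lemma class_decomp_summand:
  assumes V: "is_hmod H V" and E: "indecomposable_hmod H E"
  shows "Poly_Mapping.lookup (class_decomp H (iso_class H V)) (iso_class H E) \<noteq> 0 \<longleftrightarrow>
    (\<exists>M. is_hmod H M \<and> hmod_iso V (direct_sum_hmod E M))"
proof
  note mE = indecomposable_hmod_is_hmod[OF E]
  assume "\<exists>M. is_hmod H M \<and> hmod_iso V (direct_sum_hmod E M)"
  then obtain M where M: "is_hmod H M" "hmod_iso V (direct_sum_hmod E M)" by blast
  then have "iso_class H V = iso_class H (direct_sum_hmod E M)"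
    using iso_class_eq_iff[OF V direct_sum_hmod[OF mE M(1)]] by simp
  then have "class_decomp H (iso_class H V) = frag_of (iso_class H E) + class_decomp H (iso_class H M)"
    using class_decomp_direct_sum[OF mE M(1)] class_decomp_indecomposable[OF E] by simp
  then show "Poly_Mapping.lookup (class_decomp H (iso_class H V)) (iso_class H E) \<noteq> 0"
    using class_decomp_nonneg[OF M(1), of "iso_class H E"] by (simp add: lookup_add)
next
  note mE = indecomposable_hmod_is_hmod[OF E]
  assume nz: "Poly_Mapping.lookup (class_decomp H (iso_class H V)) (iso_class H E) \<noteq> 0"
  obtain Es where Es: "\<forall>E\<in>set Es. indecomposable_hmod H E" "hmod_iso V (direct_sum_list Es)"
    "class_decomp H (iso_class H V) = (\<Sum>E\<leftarrow>Es. frag_of (iso_class H E))"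
    using class_decomp_obtain[OF V] .
  have mEs: "\<forall>E\<in>set Es. is_hmod H E" using Es(1) by (auto dest: indecomposable_hmod_is_hmod)
  have "\<exists>F\<in>set Es. iso_class H F = iso_class H E"
  proof (rule ccontr)
    assume "\<not> ?thesis"
    then have "Poly_Mapping.lookup (\<Sum>E\<leftarrow>Es. frag_of (iso_class H E)) (iso_class H E) = 0"
      by (induction Es) (auto simp: lookup_add)
    then show False using nz Es(3) by simp
  qed
  then obtain F where F: "F \<in> set Es" "iso_class H F = iso_class H E" by blast
  have mF: "is_hmod H F" using F mEs by blast
  obtain M where M: "is_hmod H M" "hmod_iso (direct_sum_list Es) (direct_sum_hmod F M)"
    using summand_in_list[OF mEs F(1)] by blast
  have "hmod_iso F E" using F(2) iso_class_eq_iff[OF mF mE] by simp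
  then have "hmod_iso (direct_sum_hmod F M) (direct_sum_hmod E M)"
    using direct_sum_cong[OF mF mE M(1) M(1) _ hmod_iso_refl[OF M(1)]] by blast
  moreover have "is_hmod H (direct_sum_list Es)" using mEs by (intro direct_sum_list_hmod) auto
  ultimately have "hmod_iso V (direct_sum_hmod E M)"
    using hmod_iso_trans[OF V _ direct_sum_hmod[OF mF M(1)] Es(2) M(2)]
      hmod_iso_trans[OF V direct_sum_hmod[OF mF M(1)] direct_sum_hmod[OF mE M(1)]] by blast
  then show "\<exists>M. is_hmod H M \<and> hmod_iso V (direct_sum_hmod E M)" using M(1) by blast
qed

section \<open>The defining relations, normal forms and the basis of the Green ring\<close>

lemma free_class_ring_add_monoid: "add_monoid (free_class_ring H) = free_Abelian_group (mod_classes H)"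
  by (simp add: free_class_ring_def free_Abelian_group_def mod_classes_def)

lemma free_class_ring_simps:
  "carrier (free_class_ring H) = {x. Poly_Mapping.keys x \<subseteq> mod_classes H}"
  "add (free_class_ring H) = (+)" "\<zero>\<^bsub>free_class_ring H\<^esub> = 0"
  by (simp_all add: free_class_ring_def mod_classes_def)

definition basic_relations :: "('k::field, 'h::ring_1) hopf \<Rightarrow> (('k, 'h) hmod set \<Rightarrow>\<^sub>0 int) set" where
  "basic_relations H =
     {frag_of (iso_class H (direct_sum_hmod U V)) - frag_of (iso_class H U) - frag_of (iso_class H V)
        |U V. is_hmod H U \<and> is_hmod H V}"

lemma green_relations_eq: "green_relations H = generate (free_Abelian_group (mod_classes H)) (basic_relations H)"
  unfolding green_relations_def basic_relations_def free_class_ring_add_monoid ..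

lemma iso_class_in_mod_classes: "is_hmod H V \<Longrightarrow> iso_class H V \<in> mod_classes H"
  by (auto simp: mod_classes_def)

lemma basic_relations_keys:
  "x \<in> basic_relations H \<Longrightarrow> Poly_Mapping.keys x \<subseteq> mod_classes H"
proof -
  assume "x \<in> basic_relations H"
  then obtain U V where m: "is_hmod H U" "is_hmod H V" and x: "x = frag_of (iso_class H (direct_sum_hmod U V)) -
      frag_of (iso_class H U) - frag_of (iso_class H V)" by (auto simp: basic_relations_def)
  have "Poly_Mapping.keys x \<subseteq> {iso_class H (direct_sum_hmod U V), iso_class H U, iso_class H V}"
    unfolding x
    using keys_diff[of "frag_of (iso_class H (direct_sum_hmod U V)) - frag_of (iso_class H U)" "frag_of (iso_class H V)"]
      keys_diff[of "frag_of (iso_class H (direct_sum_hmod U V))" "frag_of (iso_class H U)"] by auto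
  then show ?thesis using m direct_sum_hmod[OF m] by (auto intro: iso_class_in_mod_classes)
qed

lemma green_relations_subgroup: "subgroup (green_relations H) (free_Abelian_group (mod_classes H))"
proof -
  have "basic_relations H \<subseteq> carrier (free_Abelian_group (mod_classes H))"
  proof
    fix x assume "x \<in> basic_relations H"
    from basic_relations_keys[OF this] show "x \<in> carrier (free_Abelian_group (mod_classes H))" by simp
  qed
  then show ?thesis unfolding green_relations_eq by (intro group.generate_is_subgroup) auto
qed

lemma green_relations_keys: "x \<in> green_relations H \<Longrightarrow> Poly_Mapping.keys x \<subseteq> mod_classes H"
  using subsetD[OF subgroup.subset[OF green_relations_subgroup], of x H] by simp

lemma green_relations_closed:
  "0 \<in> green_relations H"
  "x \<in> green_relations H \<Longrightarrow> y \<in> green_relations H \<Longrightarrow> x + y \<in> green_relations H"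
  "x \<in> green_relations H \<Longrightarrow> - x \<in> green_relations H"
  "x \<in> green_relations H \<Longrightarrow> y \<in> green_relations H \<Longrightarrow> x - y \<in> green_relations H"
proof -
  show 0: "0 \<in> green_relations H" using subgroup.one_closed[OF green_relations_subgroup, of H] by simp
  show a: "x + y \<in> green_relations H" if "x \<in> green_relations H" "y \<in> green_relations H" for x y
    using subgroup.m_closed[OF green_relations_subgroup that] by simp
  show i: "- x \<in> green_relations H" if "x \<in> green_relations H" for x
    using subgroup.m_inv_closed[OF green_relations_subgroup that] green_relations_keys[OF that] by simp
  show "x - y \<in> green_relations H" if "x \<in> green_relations H" "y \<in> green_relations H"
    using a[OF that(1) i[OF that(2)]] by simp
qed

text \<open>The universal property of the quotient: a function of classes that is additive on direct
  sums kills all relations. It is applied to the decomposition and to the decomposition of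
  duals.\<close>

lemma frag_extend_green_relations:
  assumes f: "\<And>U V. is_hmod H U \<Longrightarrow> is_hmod H V \<Longrightarrow>
      f (iso_class H (direct_sum_hmod U V)) = f (iso_class H U) + f (iso_class H V)"
    and x: "x \<in> green_relations H"
  shows "frag_extend f x = 0"
proof -
  have 0: "frag_extend f h = 0" if "h \<in> basic_relations H" for h
    using that f by (auto simp: basic_relations_def frag_extend_diff)
  from x show ?thesis
    unfolding green_relations_eq
  proof (induction rule: generate.induct)
    case (inv h)
    then show ?case using 0[OF inv] basic_relations_keys[OF inv] by (simp add: frag_extend_minus)
  qed (auto simp: 0 frag_extend_add)
qed

text \<open>The normal form of a formal combination of classes: every class is replaced by the sum
  of its indecomposable summands.\<close>

abbreviation decomp :: "('k::field, 'h::ring_1) hopf \<Rightarrow> (('k, 'h) hmod set \<Rightarrow>\<^sub>0 int) \<Rightarrow> ('k, 'h) hmod set \<Rightarrow>\<^sub>0 int" where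
  "decomp H \<equiv> frag_extend (class_decomp H)"

lemma decomp_keys:
  assumes "Poly_Mapping.keys x \<subseteq> mod_classes H"
  shows "Poly_Mapping.keys (decomp H x) \<subseteq> ind_classes H"
  using keys_frag_extend[of "class_decomp H" x] class_decomp_keys[of H] assms
  by (fastforce simp: mod_classes_def)

lemma ind_classes_subset: "ind_classes H \<subseteq> mod_classes H"
  by (auto simp: ind_classes_def mod_classes_def dest: indecomposable_hmod_is_hmod)

lemma direct_sum_list_relation:
  assumes "\<forall>E\<in>set Es. is_hmod H E"
  shows "frag_of (iso_class H (direct_sum_list Es)) - (\<Sum>E\<leftarrow>Es. frag_of (iso_class H E)) \<in> green_relations H"
  using assms
proof (induction Es)
  case Nil
  \<comment> \<open>The empty sum: the relation for \<open>0 \<oplus> 0 = 0\<close> shows that the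
    class of the zero module is itself a relation.\<close>
  have "frag_of (iso_class H (direct_sum_hmod zero_hmod zero_hmod)) - frag_of (iso_class H zero_hmod) -
      frag_of (iso_class H zero_hmod) \<in> green_relations H"
    unfolding green_relations_eq basic_relations_def using zero_hmod(1)[of H] by (intro generate.incl) blast
  then have "- frag_of (iso_class H zero_hmod) \<in> green_relations H"
    by (simp add: direct_sum_zero_left[OF zero_hmod(1)[of H]])
  from green_relations_closed(3)[OF this] show ?case by simp
next
  case (Cons E Es)
  have m: "is_hmod H E" "is_hmod H (direct_sum_list Es)" using Cons.prems by (auto intro: direct_sum_list_hmod)
  have "frag_of (iso_class H (direct_sum_hmod E (direct_sum_list Es))) - frag_of (iso_class H E) -
      frag_of (iso_class H (direct_sum_list Es)) \<in> green_relations H"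
    unfolding green_relations_eq basic_relations_def using m by (intro generate.incl) blast
  from green_relations_closed(2)[OF this Cons.IH] Cons.prems show ?case
    by (simp add: algebra_simps)
qed

lemma class_decomp_relation:
  assumes V: "is_hmod H V"
  shows "frag_of (iso_class H V) - class_decomp H (iso_class H V) \<in> green_relations H"
proof -
  obtain Es where E: "\<forall>E\<in>set Es. indecomposable_hmod H E" "hmod_iso V (direct_sum_list Es)"
    "class_decomp H (iso_class H V) = (\<Sum>E\<leftarrow>Es. frag_of (iso_class H E))"
    using class_decomp_obtain[OF V] .
  have mE: "\<forall>E\<in>set Es. is_hmod H E" using E(1) by (auto dest: indecomposable_hmod_is_hmod)
  then have "is_hmod H (direct_sum_list Es)" by (intro direct_sum_list_hmod) auto
  then have "iso_class H V = iso_class H (direct_sum_list Es)" using iso_class_eq_iff[OF V] E(2) by blast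
  then show ?thesis using direct_sum_list_relation[OF mE] E(3) by simp
qed

lemma decomp_relation:
  assumes "Poly_Mapping.keys x \<subseteq> mod_classes H"
  shows "x - decomp H x \<in> green_relations H"
  using assms
proof (induction x rule: frag_induction)
  case zero
  show ?case using green_relations_closed(1) by simp
next
  case (one C)
  then show ?case using class_decomp_relation by (auto simp: mod_classes_def)
next
  case (diff a b)
  from green_relations_closed(4)[OF diff] show ?case by (simp add: frag_extend_diff algebra_simps)
qed

text \<open>Decomposition is additive and so kills relations; conversely an element and its normal
  form differ by a relation. Equality in the Green ring is thereby decided by normal forms.\<close>

theorem green_relations_iff:
  "x \<in> green_relations H \<longleftrightarrow> Poly_Mapping.keys x \<subseteq> mod_classes H \<and> decomp H x = 0"
  using green_relations_keys frag_extend_green_relations[of H "class_decomp H"] class_decomp_direct_sum[of H]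
    decomp_relation[of x H] by fastforce

lemma decomp_idem:
  assumes "Poly_Mapping.keys x \<subseteq> ind_classes H"
  shows "decomp H x = x"
proof -
  have "decomp H x = frag_extend frag_of x"
    using assms class_decomp_indecomposable by (intro frag_extend_eq) (auto simp: ind_classes_def)
  then show ?thesis using frag_expansion[of x] by simp
qed

definition green_coset :: "('k::field, 'h::ring_1) hopf \<Rightarrow> (('k, 'h) hmod set \<Rightarrow>\<^sub>0 int) \<Rightarrow> ('k, 'h) green_elem" where
  "green_coset H x = green_relations H +>\<^bsub>free_class_ring H\<^esub> x"

lemma green_class_coset: "green_class H V = green_coset H (frag_of (iso_class H V))"
  by (simp add: green_class_def green_coset_def)

lemma in_green_coset:
  assumes x: "Poly_Mapping.keys x \<subseteq> mod_classes H"
  shows "y \<in> green_coset H x \<longleftrightarrow> Poly_Mapping.keys y \<subseteq> mod_classes H \<and> decomp H y = decomp H x"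
proof -
  have "y \<in> green_coset H x \<longleftrightarrow> (\<exists>n\<in>green_relations H. y = n + x)"
    by (simp add: green_coset_def a_r_coset_def' free_class_ring_simps)
  also have "\<dots> \<longleftrightarrow> y - x \<in> green_relations H"
    by (metis add_diff_cancel diff_add_cancel)
  also have "\<dots> \<longleftrightarrow> Poly_Mapping.keys (y - x) \<subseteq> mod_classes H \<and> decomp H y = decomp H x"
    by (simp add: green_relations_iff frag_extend_diff)
  also have "Poly_Mapping.keys (y - x) \<subseteq> mod_classes H \<longleftrightarrow> Poly_Mapping.keys y \<subseteq> mod_classes H"
    using keys_diff[of y x] Poly_Mapping.keys_add[of "y - x" x] x by auto
  finally show ?thesis .
qed

lemma green_coset_eq_iff:
  assumes "Poly_Mapping.keys x \<subseteq> mod_classes H" "Poly_Mapping.keys y \<subseteq> mod_classes H"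
  shows "green_coset H x = green_coset H y \<longleftrightarrow> decomp H x = decomp H y"
proof
  assume "green_coset H x = green_coset H y"
  moreover have "x \<in> green_coset H x" using assms by (simp add: in_green_coset)
  ultimately show "decomp H x = decomp H y" using in_green_coset[OF assms(2), of x] by simp
next
  assume e: "decomp H x = decomp H y"
  show "green_coset H x = green_coset H y"
    by (rule Set.set_eqI) (simp add: in_green_coset[OF assms(1)] in_green_coset[OF assms(2)] e)
qed

lemma green_carrier: "carrier (green_ring H) = green_coset H ` {x. Poly_Mapping.keys x \<subseteq> mod_classes H}"
  by (auto simp: green_ring_def FactRing_def A_RCOSETS_def' green_coset_def free_class_ring_simps)

lemma green_add:
  assumes x: "Poly_Mapping.keys x \<subseteq> mod_classes H" and y: "Poly_Mapping.keys y \<subseteq> mod_classes H"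
  shows "green_coset H x \<oplus>\<^bsub>green_ring H\<^esub> green_coset H y = green_coset H (x + y)"
proof -
  have xy: "Poly_Mapping.keys (x + y) \<subseteq> mod_classes H" using Poly_Mapping.keys_add[of x y] x y by blast
  have "green_coset H x \<oplus>\<^bsub>green_ring H\<^esub> green_coset H y = {a + b |a b. a \<in> green_coset H x \<and> b \<in> green_coset H y}"
    by (auto simp: green_ring_def FactRing_def set_add_def' free_class_ring_simps)
  also have "\<dots> = green_coset H (x + y)"
  proof (intro Set.set_eqI iffI)
    fix z assume "z \<in> {a + b |a b. a \<in> green_coset H x \<and> b \<in> green_coset H y}"
    then obtain a b where z: "z = a + b" "a \<in> green_coset H x" "b \<in> green_coset H y" by blast
    then show "z \<in> green_coset H (x + y)"
      using Poly_Mapping.keys_add[of a b] unfolding in_green_coset[OF xy] in_green_coset[OF x] in_green_coset[OF y]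
      by (auto simp: frag_extend_add)
  next
    fix z assume z: "z \<in> green_coset H (x + y)"
    then have "z - y \<in> green_coset H x" using keys_diff[of z y] y
      unfolding in_green_coset[OF xy] in_green_coset[OF x] by (auto simp: frag_extend_add frag_extend_diff)
    moreover have "y \<in> green_coset H y" using y by (simp add: in_green_coset[OF y])
    moreover have "z = (z - y) + y" by simp
    ultimately show "z \<in> {a + b |a b. a \<in> green_coset H x \<and> b \<in> green_coset H y}" by blast
  qed
  finally show ?thesis .
qed

text \<open>Multiplication of cosets is well defined as soon as \<open>green_ring H\<close> is known to be closed under
  multiplication: the product of two cosets, a union of cosets by definition, is then a single one.\<close>

lemma green_mult:
  assumes R: "ring (green_ring H)"
    and x: "Poly_Mapping.keys x \<subseteq> mod_classes H" and y: "Poly_Mapping.keys y \<subseteq> mod_classes H"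
    and xy: "Poly_Mapping.keys (x \<otimes>\<^bsub>free_class_ring H\<^esub> y) \<subseteq> mod_classes H"
  shows "green_coset H x \<otimes>\<^bsub>green_ring H\<^esub> green_coset H y = green_coset H (x \<otimes>\<^bsub>free_class_ring H\<^esub> y)"
proof -
  have "green_coset H x \<otimes>\<^bsub>green_ring H\<^esub> green_coset H y \<in> carrier (green_ring H)"
    using x y by (intro monoid.m_closed ring.is_monoid[OF R]) (auto simp: green_carrier)
  then obtain z where z: "Poly_Mapping.keys z \<subseteq> mod_classes H"
    "green_coset H x \<otimes>\<^bsub>green_ring H\<^esub> green_coset H y = green_coset H z" by (auto simp: green_carrier)
  have "green_coset H x \<otimes>\<^bsub>green_ring H\<^esub> green_coset H y =
      (\<Union>a\<in>green_coset H x. \<Union>b\<in>green_coset H y. green_coset H (a \<otimes>\<^bsub>free_class_ring H\<^esub> b))"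
    by (simp add: green_ring_def FactRing_def rcoset_mult_def green_coset_def)
  moreover have "x \<in> green_coset H x" "y \<in> green_coset H y" using x y by (simp_all add: in_green_coset)
  ultimately have "green_coset H (x \<otimes>\<^bsub>free_class_ring H\<^esub> y) \<subseteq> green_coset H z" using z(2) by blast
  moreover have "x \<otimes>\<^bsub>free_class_ring H\<^esub> y \<in> green_coset H (x \<otimes>\<^bsub>free_class_ring H\<^esub> y)"
    using xy by (simp add: in_green_coset[OF xy])
  ultimately have "x \<otimes>\<^bsub>free_class_ring H\<^esub> y \<in> green_coset H z" by blast
  then have "decomp H (x \<otimes>\<^bsub>free_class_ring H\<^esub> y) = decomp H z" by (simp add: in_green_coset[OF z(1)])
  then show ?thesis using z green_coset_eq_iff[OF xy z(1)] by simp
qed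

text \<open>The choice of a representative is harmless because the normal form is constant on a
  coset.\<close>

definition green_coords :: "('k::field, 'h::ring_1) hopf \<Rightarrow> ('k, 'h) green_elem \<Rightarrow> ('k, 'h) hmod set \<Rightarrow>\<^sub>0 int" where
  "green_coords H A = decomp H (SOME x. x \<in> A)"

lemma green_coords_coset:
  assumes x: "Poly_Mapping.keys x \<subseteq> mod_classes H"
  shows "green_coords H (green_coset H x) = decomp H x"
proof -
  have "x \<in> green_coset H x" using x by (simp add: in_green_coset)
  then have "(SOME y. y \<in> green_coset H x) \<in> green_coset H x" by (rule someI)
  then show ?thesis unfolding green_coords_def by (simp add: in_green_coset[OF x])
qed

lemma green_coords_class:
  "is_hmod H V \<Longrightarrow> green_coords H (green_class H V) = class_decomp H (iso_class H V)"
  by (simp add: green_class_coset green_coords_coset iso_class_in_mod_classes)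

lemma green_class_eq_iff:
  assumes "indecomposable_hmod H E" "indecomposable_hmod H F"
  shows "green_class H E = green_class H F \<longleftrightarrow> iso_class H E = iso_class H F"
proof
  assume "green_class H E = green_class H F"
  then have "class_decomp H (iso_class H E) = class_decomp H (iso_class H F)"
    using green_coords_class assms indecomposable_hmod_is_hmod by metis
  then show "iso_class H E = iso_class H F"
    using class_decomp_indecomposable[OF assms(1)] class_decomp_indecomposable[OF assms(2)]
    by (simp add: frag_of_eq)
qed (simp add: green_class_coset)

lemma green_basis_closed: "green_basis H \<subseteq> carrier (green_ring H)"
  using iso_class_in_mod_classes indecomposable_hmod_is_hmod
  by (fastforce simp: green_basis_def green_carrier green_class_coset)

text \<open>Reading off a coordinate is additive and takes the value \<open>1\<close> or
  \<open>0\<close> on basis elements. This is the linear independence of the basis.\<close>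

lemma lookup_green_coords_int_comb:
  assumes R: "ring (green_ring H)" and n: "Poly_Mapping.keys n \<subseteq> green_basis H" and E: "indecomposable_hmod H E"
  shows "Poly_Mapping.lookup (green_coords H (int_comb (green_ring H) n)) (iso_class H E) =
    Poly_Mapping.lookup n (green_class H E)"
proof -
  interpret ring "green_ring H" by (rule R)
  let ?L = "\<lambda>A. Poly_Mapping.lookup (green_coords H A) (iso_class H E)"
  have "?L (A \<oplus>\<^bsub>green_ring H\<^esub> A') = ?L A + ?L A'"
    if A: "A \<in> carrier (green_ring H)" and A': "A' \<in> carrier (green_ring H)" for A A'
  proof -
    obtain x where x: "Poly_Mapping.keys x \<subseteq> mod_classes H" "A = green_coset H x"
      using A by (auto simp: green_carrier)
    obtain y where y: "Poly_Mapping.keys y \<subseteq> mod_classes H" "A' = green_coset H y"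
      using A' by (auto simp: green_carrier)
    note xy = x y
    moreover have "Poly_Mapping.keys (x + y) \<subseteq> mod_classes H" using Poly_Mapping.keys_add[of x y] xy by blast
    ultimately show ?thesis by (simp add: green_add green_coords_coset frag_extend_add lookup_add)
  qed
  moreover have "Poly_Mapping.keys n \<subseteq> carrier (green_ring H)" using n green_basis_closed by blast
  ultimately have "?L (int_comb (green_ring H) n) = (\<Sum>b\<in>Poly_Mapping.keys n. Poly_Mapping.lookup n b * ?L b)"
    by (rule int_comb_additive)
  also have "\<dots> = (\<Sum>b\<in>Poly_Mapping.keys n. if b = green_class H E then Poly_Mapping.lookup n b else 0)"
  proof (intro sum.cong refl)
    fix b assume "b \<in> Poly_Mapping.keys n"
    then obtain F where F: "b = green_class H F" "indecomposable_hmod H F" using n by (auto simp: green_basis_def)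
    then have "?L b = (if b = green_class H E then 1 else 0)"
      using green_class_eq_iff[OF F(2) E] green_coords_class[OF indecomposable_hmod_is_hmod[OF F(2)]]
        class_decomp_indecomposable[OF F(2)] by auto
    then show "Poly_Mapping.lookup n b * ?L b = (if b = green_class H E then Poly_Mapping.lookup n b else 0)" by simp
  qed
  also have "\<dots> = Poly_Mapping.lookup n (green_class H E)" by (simp add: in_keys_iff)
  finally show ?thesis .
qed

text \<open>For existence a representative is replaced by its normal form, a combination of
  indecomposable classes, which is lifted by induction. For uniqueness the coordinates are read off
  by the preceding lemma.\<close>

lemma green_basis_unique:
  assumes R: "ring (green_ring H)" and A: "A \<in> carrier (green_ring H)"
  shows "\<exists>!n. Poly_Mapping.keys n \<subseteq> green_basis H \<and> int_comb (green_ring H) n = A"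
proof -
  interpret ring "green_ring H" by (rule R)
  obtain x where x: "Poly_Mapping.keys x \<subseteq> mod_classes H" "A = green_coset H x" using A by (auto simp: green_carrier)
  have "Poly_Mapping.keys d \<subseteq> ind_classes H \<and>
    (\<exists>n. Poly_Mapping.keys n \<subseteq> green_basis H \<and> int_comb (green_ring H) n = green_coset H d)"
    if "Poly_Mapping.keys d \<subseteq> ind_classes H" for d
    using that
  proof (induction d rule: frag_induction)
    case zero
    have "green_coset H 0 = \<zero>\<^bsub>green_ring H\<^esub>"
      using in_green_coset[of 0 H] by (auto simp: green_ring_def FactRing_def green_relations_iff)
    then show ?case by (intro conjI exI[of _ 0]) (simp_all add: int_comb_zero)
  next
    case (one C)
    then obtain E where E: "indecomposable_hmod H E" "C = iso_class H E" by (auto simp: ind_classes_def)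
    then have b: "green_class H E \<in> green_basis H" by (auto simp: green_basis_def)
    then have "int_comb (green_ring H) (frag_of (green_class H E)) = green_class H E"
      using green_basis_closed by (intro int_comb_frag_of) blast
    then show ?case using one b E(2) green_class_coset[of H E]
      by (intro conjI exI[of _ "frag_of (green_class H E)"]) auto
  next
    case (diff a b)
    obtain n where n: "Poly_Mapping.keys n \<subseteq> green_basis H" "int_comb (green_ring H) n = green_coset H a"
      using conjunct2[OF diff(1)] by (elim exE conjE)
    obtain m where m: "Poly_Mapping.keys m \<subseteq> green_basis H" "int_comb (green_ring H) m = green_coset H b"
      using conjunct2[OF diff(2)] by (elim exE conjE)
    have ab: "Poly_Mapping.keys (a - b) \<subseteq> ind_classes H" using diff keys_diff[of a b] by blast
    have k: "Poly_Mapping.keys a \<subseteq> mod_classes H" "Poly_Mapping.keys b \<subseteq> mod_classes H"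
      "Poly_Mapping.keys (a - b) \<subseteq> mod_classes H" using diff ab ind_classes_subset by blast+
    have "green_coset H a = green_coset H (a - b) \<oplus>\<^bsub>green_ring H\<^esub> green_coset H b"
      using green_add[OF k(3,2)] by simp
    moreover have "(u \<oplus>\<^bsub>green_ring H\<^esub> v) \<ominus>\<^bsub>green_ring H\<^esub> v = u"
      if "u \<in> carrier (green_ring H)" "v \<in> carrier (green_ring H)" for u v
      using that by (simp add: minus_eq add.m_assoc r_neg)
    moreover have "green_coset H (a - b) \<in> carrier (green_ring H)" "green_coset H b \<in> carrier (green_ring H)"
      using k by (auto simp: green_carrier)
    ultimately have "green_coset H a \<ominus>\<^bsub>green_ring H\<^esub> green_coset H b = green_coset H (a - b)" by metis
    moreover have "int_comb (green_ring H) (n - m) = green_coset H a \<ominus>\<^bsub>green_ring H\<^esub> green_coset H b"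
      using int_comb_diff[of n m] n m green_basis_closed[of H] by auto
    moreover have "Poly_Mapping.keys (n - m) \<subseteq> green_basis H" using n m keys_diff[of n m] by blast
    ultimately show ?case using ab by (intro conjI exI[of _ "n - m"]) auto
  qed
  from this[OF decomp_keys[OF x(1)]]
  obtain n where n: "Poly_Mapping.keys n \<subseteq> green_basis H" "int_comb (green_ring H) n = green_coset H (decomp H x)"
    by (elim exE conjE)
  have kd: "Poly_Mapping.keys (decomp H x) \<subseteq> mod_classes H" using decomp_keys[OF x(1)] ind_classes_subset by blast
  have "green_coset H (decomp H x) = A"
    unfolding x(2) green_coset_eq_iff[OF kd x(1)] using decomp_idem[OF decomp_keys[OF x(1)]] .
  then have nA: "int_comb (green_ring H) n = A" using n(2) by simp
  have "m = n" if m: "Poly_Mapping.keys m \<subseteq> green_basis H" "int_comb (green_ring H) m = A" for m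
  proof (rule poly_mapping_eqI)
    fix b
    show "Poly_Mapping.lookup m b = Poly_Mapping.lookup n b"
    proof (cases "b \<in> green_basis H")
      case True
      then obtain E where E: "b = green_class H E" "indecomposable_hmod H E" by (auto simp: green_basis_def)
      show ?thesis unfolding E(1)
        using lookup_green_coords_int_comb[OF R m(1) E(2)] lookup_green_coords_int_comb[OF R n(1) E(2)] m(2) nA by simp
    next
      case False
      then show ?thesis using n(1) m(1) by (metis in_keys_iff subsetD)
    qed
  qed
  note uniq = this
  show ?thesis
  proof (rule ex1I)
    show "Poly_Mapping.keys n \<subseteq> green_basis H \<and> int_comb (green_ring H) n = A" using n(1) nA by simp
    show "m = n" if "Poly_Mapping.keys m \<subseteq> green_basis H \<and> int_comb (green_ring H) m = A" for m
      using uniq[OF conjunct1[OF that] conjunct2[OF that]] .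
  qed
qed

lemma green_basis_coeff:
  assumes R: "ring (green_ring H)" and A: "A \<in> carrier (green_ring H)" and E: "indecomposable_hmod H E"
  shows "basis_coeff (green_ring H) (green_basis H) A (green_class H E) =
    Poly_Mapping.lookup (green_coords H A) (iso_class H E)"
proof -
  let ?n = "THE n. Poly_Mapping.keys n \<subseteq> green_basis H \<and> int_comb (green_ring H) n = A"
  have "Poly_Mapping.keys ?n \<subseteq> green_basis H \<and> int_comb (green_ring H) ?n = A"
    using theI'[OF green_basis_unique[OF R A]] .
  then show ?thesis using lookup_green_coords_int_comb[OF R _ E, of ?n] by (simp add: basis_coeff_def)
qed

section \<open>Products, duals and the unit on classes of modules\<close>

context fin_dim_hopf_algebra
begin

lemma tensor_class_iso:
  assumes V: "is_hmod H V" and W: "is_hmod H W"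
  shows "tensor_class H (iso_class H V) (iso_class H W) = iso_class H (tensor_hmod H V W)"
proof -
  have "iso_class H (tensor_hmod H V' W') = iso_class H (tensor_hmod H V W)"
    if "V' \<in> iso_class H V" "W' \<in> iso_class H W" for V' W'
  proof -
    have m: "is_hmod H V'" "is_hmod H W'" "hmod_iso V V'" "hmod_iso W W'"
      using that by (auto simp: iso_class_def)
    show ?thesis
      using iso_class_eq_iff[OF tensor_hmod[OF V W] tensor_hmod[OF m(1,2)]] tensor_cong[OF V m(1) W m(2-4)]
      by simp
  qed
  moreover have "V \<in> iso_class H V" "W \<in> iso_class H W"
    using hmod_iso_refl[OF V] hmod_iso_refl[OF W] V W by (auto simp: iso_class_def)
  ultimately show ?thesis unfolding tensor_class_def by blast
qed

lemma dual_class_iso: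
  assumes V: "is_hmod H V"
  shows "dual_class H (iso_class H V) = iso_class H (dual_hmod H V)"
proof -
  have "iso_class H (dual_hmod H V') = iso_class H (dual_hmod H V)" if "V' \<in> iso_class H V" for V'
  proof -
    have m: "is_hmod H V'" "hmod_iso V V'" using that by (auto simp: iso_class_def)
    show ?thesis
      using iso_class_eq_iff[OF dual_hmod[OF V] dual_hmod[OF m(1)]] dual_iso_iff[OF V m(1)] m(2) by simp
  qed
  moreover have "V \<in> iso_class H V" using hmod_iso_refl[OF V] V by (auto simp: iso_class_def)
  ultimately show ?thesis unfolding dual_class_def by blast
qed

lemma green_class_mult:
  assumes R: "ring (green_ring H)" and V: "is_hmod H V" and W: "is_hmod H W"
  shows "green_class H V \<otimes>\<^bsub>green_ring H\<^esub> green_class H W = green_class H (tensor_hmod H V W)"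
proof -
  have e: "frag_of (iso_class H V) \<otimes>\<^bsub>free_class_ring H\<^esub> frag_of (iso_class H W) = frag_of (iso_class H (tensor_hmod H V W))"
    by (simp add: free_class_ring_def tensor_class_iso[OF V W])
  show ?thesis unfolding green_class_coset
    by (subst green_mult[OF R]) (simp_all add: e iso_class_in_mod_classes V W tensor_hmod)
qed

text \<open>The dual of a direct sum is the direct sum of the duals, so decomposing after dualising
  still kills relations. Hence all cosets in the union that defines \<open>green_dual\<close>
  agree.\<close>

lemma green_dual_class:
  assumes V: "is_hmod H V"
  shows "green_dual H (green_class H V) = green_class H (dual_hmod H V)"
proof -
  let ?d = "frag_extend (\<lambda>C. frag_of (dual_class H C))"
  have keys: "Poly_Mapping.keys (?d x) \<subseteq> mod_classes H" if "Poly_Mapping.keys x \<subseteq> mod_classes H" for x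
  proof
    fix C assume "C \<in> Poly_Mapping.keys (?d x)"
    then obtain D where "D \<in> Poly_Mapping.keys x" "C = dual_class H D"
      using keys_frag_extend[of "\<lambda>C. frag_of (dual_class H C)" x] by (auto split: if_splits)
    moreover from this that obtain U where "is_hmod H U" "D = iso_class H U" by (auto simp: mod_classes_def)
    ultimately show "C \<in> mod_classes H" by (simp add: dual_class_iso dual_hmod iso_class_in_mod_classes)
  qed
  have dd: "decomp H (?d x) = frag_extend (\<lambda>C. class_decomp H (dual_class H C)) x" for x
    using frag_extend_compose[of "class_decomp H" "dual_class H" x] by (simp add: comp_def)
  have d0: "decomp H (?d x) = 0" if "x \<in> green_relations H" for x
    unfolding dd
  proof (rule frag_extend_green_relations[OF _ that])
    fix U V assume m: "is_hmod H U" "is_hmod H V"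
    show "class_decomp H (dual_class H (iso_class H (direct_sum_hmod U V))) =
        class_decomp H (dual_class H (iso_class H U)) + class_decomp H (dual_class H (iso_class H V))"
      using m by (simp add: dual_class_iso direct_sum_hmod dual_direct_sum class_decomp_direct_sum dual_hmod)
  qed
  let ?x = "frag_of (iso_class H V)"
  have x: "Poly_Mapping.keys ?x \<subseteq> mod_classes H" using V by (simp add: iso_class_in_mod_classes)
  have "green_coset H (?d a) = green_coset H (?d ?x)" if a: "a \<in> green_coset H ?x" for a
  proof -
    have ka: "Poly_Mapping.keys a \<subseteq> mod_classes H" using a by (simp add: in_green_coset[OF x])
    have "a - ?x \<in> green_relations H"
      using a keys_diff[of a ?x] x ka by (auto simp: in_green_coset[OF x] green_relations_iff frag_extend_diff)
    from d0[OF this] have "decomp H (?d a) = decomp H (?d ?x)" by (simp add: frag_extend_diff)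
    then show ?thesis using green_coset_eq_iff[OF keys[OF ka] keys[OF x]] by simp
  qed
  moreover have "?x \<in> green_coset H ?x" using x by (simp add: in_green_coset)
  moreover have "green_dual H (green_coset H ?x) = (\<Union>a\<in>green_coset H ?x. green_coset H (?d a))"
    by (simp add: green_dual_def green_coset_def)
  ultimately have "green_dual H (green_coset H ?x) = green_coset H (?d ?x)" by blast
  then show ?thesis using V by (simp add: green_class_coset dual_class_iso)
qed

lemma green_one: "\<one>\<^bsub>green_ring H\<^esub> = green_class H (trivial_hmod H)"
  by (simp add: green_ring_def FactRing_def green_class_def free_class_ring_def)

text \<open>Structure constants are multiplicities of indecomposables in tensor products; both their
  nonnegativity and the unit criterion come from this.\<close>

lemma green_mult_coeff:
  assumes R: "ring (green_ring H)" and V: "indecomposable_hmod H V" and W: "indecomposable_hmod H W"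
    and E: "indecomposable_hmod H E"
  shows "basis_coeff (green_ring H) (green_basis H) (green_class H V \<otimes>\<^bsub>green_ring H\<^esub> green_class H W) (green_class H E) =
    Poly_Mapping.lookup (class_decomp H (iso_class H (tensor_hmod H V W))) (iso_class H E)"
proof -
  note m = indecomposable_hmod_is_hmod[OF V] indecomposable_hmod_is_hmod[OF W]
  have "green_class H (tensor_hmod H V W) \<in> carrier (green_ring H)"
    using tensor_hmod[OF m] by (simp add: green_carrier green_class_coset iso_class_in_mod_classes)
  then show ?thesis
    unfolding green_class_mult[OF R m] by (simp add: green_basis_coeff[OF R _ E] green_coords_class tensor_hmod m)
qed

lemma green_unit_coeff:
  assumes R: "ring (green_ring H)" and V: "indecomposable_hmod H V" and W: "indecomposable_hmod H W"
  shows "basis_coeff (green_ring H) (green_basis H) (green_class H V \<otimes>\<^bsub>green_ring H\<^esub> green_class H W) \<one>\<^bsub>green_ring H\<^esub> \<noteq> 0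
    \<longleftrightarrow> trivial_summand (tensor_hmod H V W)"
  unfolding green_one green_mult_coeff[OF R V W trivial_indecomposable] trivial_summand_def
  using class_decomp_summand[OF tensor_hmod trivial_indecomposable] V W indecomposable_hmod_is_hmod by blast

theorem star_based_green_ring:
  assumes R: "ring (green_ring H)"
  shows "star_based_ring (green_ring H) (green_basis H) (green_dual H)"
proof -
  interpret ring "green_ring H" by (rule R)
  have ind: "\<exists>V. indecomposable_hmod H V \<and> x = green_class H V" if "x \<in> green_basis H" for x
    using that by (auto simp: green_basis_def)
  have dual: "green_dual H (green_class H V) = green_class H (dual_hmod H V)" if "indecomposable_hmod H V" for V
    using green_dual_class[OF indecomposable_hmod_is_hmod[OF that]] .
  show ?thesis
  proof unfold_locales
    show "green_basis H \<subseteq> carrier (green_ring H)" by (rule green_basis_closed)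
    show "\<exists>!n. Poly_Mapping.keys n \<subseteq> green_basis H \<and> int_comb (green_ring H) n = x"
      if "x \<in> carrier (green_ring H)" for x
      using green_basis_unique[OF R that] .
    show "\<one>\<^bsub>green_ring H\<^esub> \<in> green_basis H"
      unfolding green_one green_basis_def using trivial_indecomposable by blast
    show "0 \<le> basis_coeff (green_ring H) (green_basis H) (x \<otimes>\<^bsub>green_ring H\<^esub> y) z"
      if xyz: "x \<in> green_basis H" "y \<in> green_basis H" "z \<in> green_basis H" for x y z
    proof -
      obtain V W E where V: "indecomposable_hmod H V" "x = green_class H V"
        and W: "indecomposable_hmod H W" "y = green_class H W" and E: "indecomposable_hmod H E" "z = green_class H E"
        using ind[OF xyz(1)] ind[OF xyz(2)] ind[OF xyz(3)] by (elim exE conjE)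
      note m = indecomposable_hmod_is_hmod[OF V(1)] indecomposable_hmod_is_hmod[OF W(1)]
      show ?thesis unfolding V(2) W(2) E(2) green_mult_coeff[OF R V(1) W(1) E(1)]
        by (rule class_decomp_nonneg[OF tensor_hmod[OF m]])
    qed
    show "green_dual H x \<in> green_basis H" if x: "x \<in> green_basis H" for x
    proof -
      obtain V where V: "indecomposable_hmod H V" "x = green_class H V" using ind[OF x] by blast
      show ?thesis unfolding V(2) dual[OF V(1)] green_basis_def using dual_indecomposable[OF V(1)] by blast
    qed
    show "inj_on (green_dual H) (green_basis H)"
    proof (rule inj_onI)
      fix x y assume x: "x \<in> green_basis H" and y: "y \<in> green_basis H" and e: "green_dual H x = green_dual H y"
      obtain V where V: "indecomposable_hmod H V" "x = green_class H V" using ind[OF x] by blast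
      obtain W where W: "indecomposable_hmod H W" "y = green_class H W" using ind[OF y] by blast
      note m = indecomposable_hmod_is_hmod[OF V(1)] indecomposable_hmod_is_hmod[OF W(1)]
      have "iso_class H (dual_hmod H V) = iso_class H (dual_hmod H W)"
        using e unfolding V(2) W(2) dual[OF V(1)] dual[OF W(1)]
          green_class_eq_iff[OF dual_indecomposable[OF V(1)] dual_indecomposable[OF W(1)]] .
      then have "hmod_iso V W"
        unfolding iso_class_eq_iff[OF dual_hmod[OF m(1)] dual_hmod[OF m(2)]] dual_iso_iff[OF m] .
      then show "x = y" unfolding V(2) W(2) green_class_eq_iff[OF V(1) W(1)] iso_class_eq_iff[OF m] .
    qed
    fix x y assume x: "x \<in> green_basis H" and y: "y \<in> green_basis H"
      and nz: "basis_coeff (green_ring H) (green_basis H) (x \<otimes>\<^bsub>green_ring H\<^esub> y) \<one>\<^bsub>green_ring H\<^esub> \<noteq> 0"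
    obtain V where V: "indecomposable_hmod H V" "x = green_class H V" using ind[OF x] by blast
    obtain W where W: "indecomposable_hmod H W" "y = green_class H W" using ind[OF y] by blast
    note m = indecomposable_hmod_is_hmod[OF V(1)] indecomposable_hmod_is_hmod[OF W(1)]
    have s: "trivial_summand (tensor_hmod H V W)" using nz unfolding V(2) W(2) green_unit_coeff[OF R V(1) W(1)] .
    show "basis_coeff (green_ring H) (green_basis H) (x \<otimes>\<^bsub>green_ring H\<^esub> green_dual H x) \<one>\<^bsub>green_ring H\<^esub> \<noteq> 0"
      unfolding V(2) dual[OF V(1)] green_unit_coeff[OF R V(1) dual_indecomposable[OF V(1)]]
      by (rule trivial_summand_dual_right[OF m s])
    show "basis_coeff (green_ring H) (green_basis H) (green_dual H y \<otimes>\<^bsub>green_ring H\<^esub> y) \<one>\<^bsub>green_ring H\<^esub> \<noteq> 0"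
      unfolding W(2) dual[OF W(1)] green_unit_coeff[OF R dual_indecomposable[OF W(1)] W(1)]
      by (rule trivial_summand_dual_left[OF m s])
    have "iso_class H W = iso_class H (dual_hmod H V)"
      unfolding iso_class_eq_iff[OF m(2) dual_hmod[OF m(1)]] by (rule trivial_summand_imp_dual[OF V(1) W(1) s])
    then show "y = green_dual H x"
      unfolding V(2) W(2) dual[OF V(1)] green_class_eq_iff[OF W(1) dual_indecomposable[OF V(1)]] .
  qed
qed

end

theorem theorem2p3:
  fixes H :: "('k::alg_closed_field, 'h::ring_1) hopf"
    and X :: "('k, 'h) green_elem set"
  assumes "fin_dim_hopf_algebra H"
    and "\<not> semisimple_ring TYPE('h)"
    and "spans_rep_ideal H X"
  shows "(nondegenerate_form (quot_ring H X) (quot_form H) \<longleftrightarrow>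
            P_plus H = P_minus H \<and> P_minus H = int_span (green_ring H) X \<and>
            int_span (green_ring H) X = I_max H) \<and>
         (P_plus H = P_minus H \<and> P_minus H = int_span (green_ring H) X \<and>
            int_span (green_ring H) X = I_max H \<longleftrightarrow>
            transitive_wrt (quot_ring H X) (quot_basis H X))"
proof -
  let ?G = "green_ring H" and ?B = "green_basis H"
  have X: "X \<subset> ?B" and I: "ideal (int_span ?G X) ?G"
    using assms(3) by (auto simp: spans_rep_ideal_def)
  \<comment> \<open>The locale \<open>ideal\<close> contains the ring axioms of its ambient
    structure; this is the source of \<open>ring (green_ring H)\<close>.\<close>
  interpret star_based_ring ?G ?B "green_dual H"
    using fin_dim_hopf_algebra.star_based_green_ring[OF assms(1) ideal.axioms(2)[OF I]] .
  have plus: "P_plus H = int_span ?G null_right" and minus: "P_minus H = int_span ?G null_left"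
    by (simp_all add: P_plus_def P_minus_def null_right_def null_left_def unit_coeff_def)
  have pairing: "quot_form H = quot_pairing"
    by (simp add: fun_eq_iff quot_form_def quot_pairing_def unit_coeff_def)
  have sub: "null_right \<subseteq> ?B" "null_left \<subseteq> ?B" "X \<subseteq> ?B"
    using X by (auto simp: null_right_def null_left_def)
  \<comment> \<open>Every representation ideal is spanned inside \<open>null_right\<close>. Once
    that set equals \<open>X\<close>, the given ideal is the largest one, so the description of
    \<open>I_max\<close> has a unique solution, and the last equality of the second statement
    follows from the others.\<close>
  have max: "int_span ?G X = I_max H" if N: "null_right = X"
    unfolding I_max_def
  proof (rule the_equality[symmetric])
    have le: "J \<subseteq> int_span ?G X" if J: "rep_ideal H J" for J
    proof -
      obtain Y where Y: "Y \<subset> ?B" "ideal (int_span ?G Y) ?G" "J = int_span ?G Y"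
        using J by (auto simp: rep_ideal_def spans_rep_ideal_def)
      then have "Y \<subseteq> X" using ideal_basis_null(1)[OF Y(1,2)] N by simp
      then show ?thesis using Y(1,3) sub(3) int_span_mono_iff[of Y X] by blast
    qed
    have rX: "rep_ideal H (int_span ?G X)" using assms(3) by (auto simp: rep_ideal_def)
    then show "rep_ideal H (int_span ?G X) \<and> (\<forall>J. rep_ideal H J \<longrightarrow> J \<subseteq> int_span ?G X)" using le by blast
    show "I = int_span ?G X" if "rep_ideal H I \<and> (\<forall>J. rep_ideal H J \<longrightarrow> J \<subseteq> I)" for I
      using that le rX by blast
  qed
  have "P_plus H = P_minus H \<and> P_minus H = int_span ?G X \<and> int_span ?G X = I_max H \<longleftrightarrow>
      null_right = X \<and> null_left = X"
    unfolding plus minus using int_span_eq_iff[OF sub(1,2)] int_span_eq_iff[OF sub(2,3)] max by metis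
  moreover have "nondegenerate_form (quot_ring H X) (quot_form H) \<longleftrightarrow> null_right = X \<and> null_left = X"
    unfolding pairing quot_ring_def by (rule nondegenerate_iff_null[OF X I refl])
  moreover have "transitive_wrt (quot_ring H X) (quot_basis H X) \<longleftrightarrow> null_right = X \<and> null_left = X"
    unfolding quot_ring_def quot_basis_def by (rule transitive_iff_null[OF X I refl])
  ultimately show ?thesis by blast
qed

end
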